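(* Let $X$ be a compact Hausdorff space and let $A=C(X)$ be the $C^*$-algebra of complex continuous functions on $X$. (a) $\mathcal{U}_0(A)$ is quasi-isometrically universal for separable metric spaces if and only if $X$ is not totally disconnected; and $\mathcal{U}(A)$ is coarsely universal for separable metric spaces if and only if $X$ is not totally disconnected. (b) For each $G\in\{\mathcal{U}_0(A),\mathcal{U}(A)\}$: $G$ admits a coarse embedding into a Hilbert space if and only if $X$ is totally disconnected, and $G$ has the Haagerup property if and only if $X$ is totally disconnected.
   Context: $\mathcal{U}(A)$ is the unitary group of $A$ with the norm topology, $\mathcal{U}_0(A)$ its connected component of the identity. A subset of a topological group $G$ is bounded if it has finite diameter for every continuous left-invariant pseudometric on $G$. Topological groups carry the left-coarse structure whose controlled sets are those $E\subseteq G\times G$ for which $\{x^{-1}y:(x,y)\in E\}$ is bounded; metric spaces carry their usual bounded coarse structure. A map $f$ between two such spaces is a coarse embedding if it maps controlled sets to controlled sets and preimages of controlled sets (under $f\times f$) are controlled. For maps between metric spaces this is equivalent to the existence of non-decreasing $\rho_1,\rho_2:[0,\infty)\to[0,\infty)$ with $\lim_{t\to\infty}\rho_1(t)=\infty$ and $\rho_1(d(x,y))\le d(f(x),f(y))\le\rho_2(d(x,y))$. The quasi-isometry type of $\mathcal{U}_0(A)$ is given by a maximal compatible left-invariant metric, e.g. the one induced by $\mathrm{cel}(u)=\inf\{\sum_{j=1}^n\|a_j\| : a_j\in A\text{ self-adjoint},\ u=\exp(\mathrm{i}a_1)\cdots\exp(\mathrm{i}a_n)\}$. A quasi-isometric embedding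 is a map with $\frac1K d(x,y)-L\le d(f(x),f(y))\le Kd(x,y)+L$ for some $K,L>0$. A space is quasi-isometrically (resp. coarsely) universal for separable metric spaces if every separable metric space admits a quasi-isometric (resp. coarse) embedding into it. $G$ has the Haagerup property if it admits a continuous action by affine isometries on a Hilbert space such that for some (equivalently any) vector $\xi$, $\|g\xi\|\to\infty$ whenever $g$ eventually leaves every bounded subset of $G$. *)

theory Defs
  imports "HOL-Analysis.Analysis" "HOL-Algebra.Module" "HOL-Algebra.Group_Action"
begin

section \<open>The Banach algebra of bounded continuous functions\<close>

text \<open>The library proves completeness only over metric domains; the argument works over any
  topological space.\<close>

instance bcontfun :: (topological_space, complete_space) complete_space
proof
  fix f :: "nat \<Rightarrow> ('a, 'b) bcontfun"
  assume "Cauchy f"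
  then obtain g where "uniform_limit UNIV f g sequentially"
    using uniformly_convergent_eq_cauchy[of "\<lambda>_. True" f]
    unfolding Cauchy_def uniform_limit_sequentially_iff
    by (metis dist_fun_lt_imp_dist_val_lt)
  from uniform_limit_bcontfunE[OF this sequentially_bot]
  obtain l' where "g = apply_bcontfun l'" "(f \<longlonglongrightarrow> l')" by metis
  then show "convergent f"
    by (intro convergentI)
qed

instance bcontfun :: (topological_space, banach) banach ..

instantiation bcontfun :: (topological_space, real_normed_algebra_1) real_normed_algebra_1
begin

context
  includes bcontfun.lifting
begin

lift_definition one_bcontfun :: "'a \<Rightarrow>\<^sub>C 'b" is "\<lambda>_. 1"
  by (rule const_bcontfun)

lift_definition times_bcontfun :: "('a \<Rightarrow>\<^sub>C 'b) \<Rightarrow> ('a \<Rightarrow>\<^sub>C 'b) \<Rightarrow> 'a \<Rightarrow>\<^sub>C 'b" is "\<lambda>f g x. f x * g x"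
proof -
  fix f g :: "'a \<Rightarrow> 'b"
  assume "f \<in> bcontfun" "g \<in> bcontfun"
  then have c: "continuous_on UNIV f" "continuous_on UNIV g"
    and "bounded (range f)" "bounded (range g)" by (auto simp: bcontfun_def)
  then obtain a b where "\<And>x. norm (f x) \<le> a" "\<And>x. norm (g x) \<le> b"
    unfolding bounded_iff by blast
  then have "norm (f x * g x) \<le> a * b" for x
    by (meson mult_mono norm_ge_zero norm_mult_ineq order_trans)
  with c show "(\<lambda>x. f x * g x) \<in> bcontfun"
    by (intro bcontfun_normI) (auto intro!: continuous_intros)
qed

end

instance
proof
  include bcontfun.lifting
  fix a b c :: "'a \<Rightarrow>\<^sub>C 'b" and r :: real
  show "a * b * c = a * (b * c)" by transfer (simp add: mult.assoc)
  show "1 * a = a" "a * 1 = a" by (transfer, simp)+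
  show "(a + b) * c = a * c + b * c" "a * (b + c) = a * b + a * c"
    by (transfer, simp add: algebra_simps)+
  show "r *\<^sub>R a * b = r *\<^sub>R (a * b)" "a * r *\<^sub>R b = r *\<^sub>R (a * b)"
    by (transfer, simp)+
  show "(0 :: 'a \<Rightarrow>\<^sub>C 'b) \<noteq> 1"
    by transfer (metis zero_neq_one)
  have ap: "apply_bcontfun (a * b) x = a x * b x" for x
    by transfer simp
  show "norm (a * b) \<le> norm a * norm b"
    by (rule norm_bound) (unfold ap, meson mult_mono norm_bounded norm_ge_zero norm_mult_ineq order_trans)
  have one: "apply_bcontfun (1 :: 'a \<Rightarrow>\<^sub>C 'b) x = 1" for x
    by transfer simp
  show "norm (1 :: 'a \<Rightarrow>\<^sub>C 'b) = 1"
    using norm_bounded[of "1 :: 'a \<Rightarrow>\<^sub>C 'b"] norm_bound[of "1 :: 'a \<Rightarrow>\<^sub>C 'b" 1]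
    by (simp add: one antisym)
qed

end

context
  includes bcontfun.lifting
begin

lift_definition adjoint_bcontfun ::
  "('a::topological_space \<Rightarrow>\<^sub>C complex) \<Rightarrow> ('a \<Rightarrow>\<^sub>C complex)" is "\<lambda>f x. cnj (f x)"
  by (auto simp: bcontfun_def bounded_iff intro!: continuous_intros)

end

lemmas [simp] = one_bcontfun.rep_eq times_bcontfun.rep_eq adjoint_bcontfun.rep_eq


section \<open>Unitary groups and exponential length\<close>

text \<open>On a compact space every continuous function is bounded, so \<open>'x \<Rightarrow>\<^sub>C complex\<close>
  is then the C*-algebra of all continuous functions.\<close>

definition selfadjoint :: "('x::topological_space \<Rightarrow>\<^sub>C complex) \<Rightarrow> bool" where
  "selfadjoint a \<longleftrightarrow> adjoint_bcontfun a = a"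

definition unitary_group :: "('x::topological_space \<Rightarrow>\<^sub>C complex) monoid" where
  "unitary_group =
    \<lparr>carrier = {u. adjoint_bcontfun u * u = 1 \<and> u * adjoint_bcontfun u = 1}, mult = (*), one = 1\<rparr>"

definition unitary_group0 :: "('x::topological_space \<Rightarrow>\<^sub>C complex) monoid" where
  "unitary_group0 =
    unitary_group\<lparr>carrier := connected_component_set (carrier unitary_group) 1\<rparr>"

definition norm_topology :: "('v::real_normed_vector, 'm) monoid_scheme \<Rightarrow> 'v topology" where
  "norm_topology G = top_of_set (carrier G)"

definition cel :: "('x::topological_space \<Rightarrow>\<^sub>C complex) \<Rightarrow> real" where
  "cel u = Inf {sum_list (map norm as) | as.
     (\<forall>a\<in>set as. selfadjoint a) \<and>
     u = prod_list (map (\<lambda>a. exp (const_bcontfun \<i> * a)) as)}"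

definition cel_dist ::
  "('x::topological_space \<Rightarrow>\<^sub>C complex) \<Rightarrow> ('x \<Rightarrow>\<^sub>C complex) \<Rightarrow> real" where
  "cel_dist u v = cel (inv\<^bsub>unitary_group0\<^esub> u \<otimes>\<^bsub>unitary_group0\<^esub> v)"

lemma adjoint_mult: "adjoint_bcontfun (a * b) = adjoint_bcontfun b * adjoint_bcontfun a"
  and adjoint_adjoint [simp]: "adjoint_bcontfun (adjoint_bcontfun a) = a"
  and adjoint_one [simp]: "adjoint_bcontfun 1 = 1"
  by (auto intro!: bcontfun_eqI)

lemma group_unitary_group: "group unitary_group"
proof (rule groupI)
  fix x y :: "'a \<Rightarrow>\<^sub>C complex"
  assume "x \<in> carrier unitary_group" "y \<in> carrier unitary_group"
  then show "x \<otimes>\<^bsub>unitary_group\<^esub> y \<in> carrier unitary_group"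
    by (simp add: unitary_group_def adjoint_mult) (metis mult.assoc mult_1_left)
next
  fix x :: "'a \<Rightarrow>\<^sub>C complex"
  assume "x \<in> carrier unitary_group"
  then show "\<exists>y\<in>carrier unitary_group. y \<otimes>\<^bsub>unitary_group\<^esub> x = \<one>\<^bsub>unitary_group\<^esub>"
    by (intro bexI[of _ "adjoint_bcontfun x"]) (simp_all add: unitary_group_def)
qed (simp_all add: unitary_group_def mult.assoc)

lemma inv_unitary_group:
  assumes "u \<in> carrier unitary_group"
  shows "inv\<^bsub>unitary_group\<^esub> u = adjoint_bcontfun u"
  using assms by (intro group.inv_equality[OF group_unitary_group]) (simp_all add: unitary_group_def)

lemma adjoint_diff: "adjoint_bcontfun (a - b) = adjoint_bcontfun a - adjoint_bcontfun b"
  by (auto intro!: bcontfun_eqI)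

lemma norm_adjoint: "norm (adjoint_bcontfun a) = norm a"
proof (rule antisym)
  show "norm (adjoint_bcontfun a) \<le> norm a"
    by (rule norm_bound) (simp add: norm_bounded)
  have "norm (apply_bcontfun a x) \<le> norm (adjoint_bcontfun a)" for x
    using norm_bounded[of "adjoint_bcontfun a" x] by simp
  then show "norm a \<le> norm (adjoint_bcontfun a)"
    by (rule norm_bound)
qed

lemma continuous_on_adjoint: "continuous_on S adjoint_bcontfun"
  unfolding continuous_on_iff
  by (metis adjoint_diff norm_adjoint dist_norm)

lemma subgroup_unitary_group0: "subgroup (carrier unitary_group0) unitary_group"
proof -
  interpret group "unitary_group :: ('a \<Rightarrow>\<^sub>C complex) monoid" by (rule group_unitary_group)
  let ?U = "carrier unitary_group :: ('a \<Rightarrow>\<^sub>C complex) set"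
  let ?C = "connected_component_set ?U 1"
  have one: "1 \<in> ?U" by (simp add: unitary_group_def)
  have C: "carrier unitary_group0 = ?C" by (simp add: unitary_group0_def)
  have sub: "?C \<subseteq> ?U" by (rule connected_component_subset)
  have one': "1 \<in> ?C" using one by simp
  have mem: "y \<in> ?C" if "x \<in> ?C" "connected T" "T \<subseteq> ?U" "x \<in> T" "y \<in> T" for x y T
    using connected_component_maximal[OF that(4,2,3)] that connected_component_eq by blast
  show ?thesis
  proof (rule subgroupI)
    show "carrier unitary_group0 \<subseteq> ?U" "carrier (unitary_group0 :: ('a \<Rightarrow>\<^sub>C complex) monoid) \<noteq> {}"
      unfolding C using sub one' by blast+
  next
    fix a assume "a \<in> carrier (unitary_group0 :: ('a \<Rightarrow>\<^sub>C complex) monoid)"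
    then have a: "a \<in> ?C" by (simp add: C)
    have "adjoint_bcontfun a \<in> ?C"
    proof (rule mem[where T = "adjoint_bcontfun ` ?C", OF one'])
      show "connected (adjoint_bcontfun ` ?C)"
        by (intro connected_continuous_image continuous_on_adjoint connected_connected_component)
      show "adjoint_bcontfun ` ?C \<subseteq> ?U"
        using sub by (auto simp: unitary_group_def)
      show "1 \<in> adjoint_bcontfun ` ?C"
        using one' by (metis adjoint_one imageI)
    qed (use a in auto)
    moreover have "a \<in> ?U" using a sub by blast
    ultimately show "inv\<^bsub>unitary_group\<^esub> a \<in> carrier unitary_group0"
      by (simp add: C inv_unitary_group)
  next
    fix a b :: "'a \<Rightarrow>\<^sub>C complex"
    assume "a \<in> carrier unitary_group0" "b \<in> carrier unitary_group0"
    then have a: "a \<in> ?C" and b: "b \<in> ?C" by (simp_all add: C)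
    have "a * b \<in> ?C"
    proof (rule mem[where T = "(*) a ` ?C", OF a])
      show "connected ((*) a ` ?C)"
        by (intro connected_continuous_image continuous_intros connected_connected_component)
      show "(*) a ` ?C \<subseteq> ?U"
      proof clarify
        fix c assume "connected_component ?U 1 c"
        then have "c \<in> ?U" "a \<in> ?U" using sub a by auto
        then show "a * c \<in> ?U"
          using m_closed[of a c] by (simp add: unitary_group_def)
      qed
      show "a \<in> (*) a ` ?C"
        using one' by (metis imageI mult_1_right)
    qed (use b in auto)
    then show "a \<otimes>\<^bsub>unitary_group\<^esub> b \<in> carrier unitary_group0"
      by (simp add: C) (simp add: unitary_group_def)
  qed
qed

lemma group_unitary_group0: "group unitary_group0"
  using group.subgroup_imp_group[OF group_unitary_group subgroup_unitary_group0]
  by (simp add: unitary_group0_def)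


section \<open>Coarse structures\<close>

definition left_invariant_pseudometric ::
  "('g, 'm) monoid_scheme \<Rightarrow> ('g \<Rightarrow> 'g \<Rightarrow> real) \<Rightarrow> bool" where
  "left_invariant_pseudometric G d \<longleftrightarrow>
     (\<forall>x\<in>carrier G. \<forall>y\<in>carrier G. 0 \<le> d x y \<and> d x y = d y x) \<and>
     (\<forall>x\<in>carrier G. d x x = 0) \<and>
     (\<forall>x\<in>carrier G. \<forall>y\<in>carrier G. \<forall>z\<in>carrier G. d x z \<le> d x y + d y z) \<and>
     (\<forall>g\<in>carrier G. \<forall>x\<in>carrier G. \<forall>y\<in>carrier G. d (g \<otimes>\<^bsub>G\<^esub> x) (g \<otimes>\<^bsub>G\<^esub> y) = d x y)"

definition group_bounded :: "('g, 'm) monoid_scheme \<Rightarrow> 'g topology \<Rightarrow> 'g set \<Rightarrow> bool" where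
  "group_bounded G T B \<longleftrightarrow> B \<subseteq> carrier G \<and>
     (\<forall>d. left_invariant_pseudometric G d \<and>
          continuous_map (prod_topology T T) euclideanreal (\<lambda>(x, y). d x y) \<longrightarrow>
          (\<exists>C. \<forall>x\<in>B. \<forall>y\<in>B. d x y \<le> C))"

definition group_controlled ::
  "('g, 'm) monoid_scheme \<Rightarrow> 'g topology \<Rightarrow> ('g \<times> 'g) set \<Rightarrow> bool" where
  "group_controlled G T E \<longleftrightarrow> E \<subseteq> carrier G \<times> carrier G \<and>
     group_bounded G T {inv\<^bsub>G\<^esub> x \<otimes>\<^bsub>G\<^esub> y | x y. (x, y) \<in> E}"

definition metric_controlled :: "'a set \<Rightarrow> ('a \<Rightarrow> 'a \<Rightarrow> real) \<Rightarrow> ('a \<times> 'a) set \<Rightarrow> bool" where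
  "metric_controlled M d E \<longleftrightarrow> E \<subseteq> M \<times> M \<and> (\<exists>C. \<forall>(x, y)\<in>E. d x y \<le> C)"

definition coarse_embedding ::
  "'a set \<Rightarrow> (('a \<times> 'a) set \<Rightarrow> bool) \<Rightarrow> 'b set \<Rightarrow> (('b \<times> 'b) set \<Rightarrow> bool) \<Rightarrow> ('a \<Rightarrow> 'b) \<Rightarrow> bool" where
  "coarse_embedding X ctrlX Y ctrlY f \<longleftrightarrow> f ` X \<subseteq> Y \<and>
     (\<forall>E. ctrlX E \<longrightarrow> ctrlY (map_prod f f ` E)) \<and>
     (\<forall>E. ctrlY E \<longrightarrow> ctrlX (map_prod f f -` E \<inter> X \<times> X))"

definition quasi_isometric_embedding ::
  "'a set \<Rightarrow> ('a \<Rightarrow> 'a \<Rightarrow> real) \<Rightarrow> 'b set \<Rightarrow> ('b \<Rightarrow> 'b \<Rightarrow> real) \<Rightarrow> ('a \<Rightarrow> 'b) \<Rightarrow> bool" where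
  "quasi_isometric_embedding M d N e f \<longleftrightarrow> f ` M \<subseteq> N \<and>
     (\<exists>K>0. \<exists>L>0. \<forall>x\<in>M. \<forall>y\<in>M.
        d x y / K - L \<le> e (f x) (f y) \<and> e (f x) (f y) \<le> K * d x y + L)"


section \<open>Universality for separable metric spaces\<close>

text \<open>HOL cannot quantify over all types inside a formula. Every separable metric space is
  isometric to one whose points are real sequences, so metrics on sets of sequences suffice;
  the lemmas \<open>qi_universalD\<close> and \<open>coarsely_universalD\<close> recover arbitrary point types.\<close>

definition qi_universal :: "'b set \<Rightarrow> ('b \<Rightarrow> 'b \<Rightarrow> real) \<Rightarrow> bool" where
  "qi_universal N e \<longleftrightarrow>
     (\<forall>(M :: (nat \<Rightarrow> real) set) d.
        Metric_space M d \<and> separable_space (Metric_space.mtopology M d) \<longrightarrow>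
        (\<exists>f. quasi_isometric_embedding M d N e f))"

definition coarsely_universal :: "'b set \<Rightarrow> (('b \<times> 'b) set \<Rightarrow> bool) \<Rightarrow> bool" where
  "coarsely_universal Y ctrl \<longleftrightarrow>
     (\<forall>(M :: (nat \<Rightarrow> real) set) d.
        Metric_space M d \<and> separable_space (Metric_space.mtopology M d) \<longrightarrow>
        (\<exists>f. coarse_embedding M (metric_controlled M d) Y ctrl f))"

lemma separable_metric_space_isometric_copy:
  fixes M :: "'a set"
  assumes "Metric_space M d" "separable_space (Metric_space.mtopology M d)"
  obtains j :: "'a \<Rightarrow> nat \<Rightarrow> real" and d'
  where "inj_on j M" "Metric_space (j ` M) d'" "separable_space (Metric_space.mtopology (j ` M) d')"
    "\<And>x y. x \<in> M \<Longrightarrow> y \<in> M \<Longrightarrow> d' (j x) (j y) = d x y"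
proof -
  interpret Metric_space M d by fact
  obtain C where C: "countable C" "C \<subseteq> M" "Abstract_Topology.closure_of mtopology C = M"
    using assms(2) by (auto simp: separable_space_def)
  define j where "j x n = d x (from_nat_into C n)" for x n
  have inj: "inj_on j M"
  proof (rule inj_onI)
    fix x y assume xy: "x \<in> M" "y \<in> M" "j x = j y"
    have "d x y \<le> r" if "r > 0" for r
    proof -
      have "x \<in> Abstract_Topology.closure_of mtopology C" using C xy by simp
      then have "\<forall>r>0. \<exists>y\<in>C. y \<in> mball x r" by (simp add: metric_closure_of)
      then obtain c where c: "c \<in> C" "c \<in> mball x (r/2)"
        using \<open>r > 0\<close> half_gt_zero by blast
      then obtain n where "from_nat_into C n = c"
        using C(1) by (metis from_nat_into_surj)
      then have "d x c = d y c" using fun_cong[OF xy(3), of n] by (simp add: j_def)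
      moreover have "d x c < r/2" using c by simp
      moreover have "d x y \<le> d x c + d y c"
        using triangle'[of x c y] triangle[of x c y] commute c C xy by (metis subsetD)
      ultimately show ?thesis by linarith
    qed
    then have "d x y \<le> 0" by (meson dense_ge)
    then show "x = y" using xy nonneg[of x y] zero by fastforce
  qed
  define d' where "d' u v = d (inv_into M j u) (inv_into M j v)" for u v
  have iso: "d' (j x) (j y) = d x y" if "x \<in> M" "y \<in> M" for x y
    using that inj by (simp add: d'_def)
  have ms: "Metric_space (j ` M) d'"
  proof
    show "0 \<le> d' x y" for x y by (simp add: d'_def)
    show "d' x y = d' y x" for x y by (simp add: d'_def commute)
    show "(d' x y = 0) = (x = y)" if "x \<in> j ` M" "y \<in> j ` M" for x y
      using that inj by (auto simp: iso inj_on_eq_iff)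
    show "d' x z \<le> d' x y + d' y z" if "x \<in> j ` M" "y \<in> j ` M" "z \<in> j ` M" for x y z
      using that triangle by (auto simp: iso)
  qed
  interpret J: Metric_space "j ` M" d' by (rule ms)
  have "continuous_map mtopology J.mtopology j"
    unfolding metric_continuous_map[OF ms] using iso by auto
  moreover have "j ` topspace mtopology = topspace J.mtopology" by simp
  ultimately have "separable_space J.mtopology"
    using separable_space_continuous_map_image assms(2) by metis
  then show ?thesis using that[OF inj ms] iso by blast
qed

lemma qi_universalD:
  fixes M :: "'a set"
  assumes "qi_universal N e" "Metric_space M d" "separable_space (Metric_space.mtopology M d)"
  shows "\<exists>f. quasi_isometric_embedding M d N e f"
proof -
  obtain j :: "'a \<Rightarrow> nat \<Rightarrow> real" and d' where j: "inj_on j M" "Metric_space (j ` M) d'"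
    "separable_space (Metric_space.mtopology (j ` M) d')"
    "\<And>x y. x \<in> M \<Longrightarrow> y \<in> M \<Longrightarrow> d' (j x) (j y) = d x y"
    using separable_metric_space_isometric_copy[OF assms(2,3)] by blast
  obtain f where f: "quasi_isometric_embedding (j ` M) d' N e f"
    using assms(1) j(2,3) unfolding qi_universal_def by blast
  have "quasi_isometric_embedding M d N e (f \<circ> j)"
    using f by (fastforce simp: quasi_isometric_embedding_def j(4))
  then show ?thesis by blast
qed

lemma coarsely_universalD:
  fixes M :: "'a set"
  assumes "coarsely_universal Y ctrl" "Metric_space M d" "separable_space (Metric_space.mtopology M d)"
  shows "\<exists>f. coarse_embedding M (metric_controlled M d) Y ctrl f"
proof -
  obtain j :: "'a \<Rightarrow> nat \<Rightarrow> real" and d' where j: "inj_on j M" "Metric_space (j ` M) d'"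
    "separable_space (Metric_space.mtopology (j ` M) d')"
    "\<And>x y. x \<in> M \<Longrightarrow> y \<in> M \<Longrightarrow> d' (j x) (j y) = d x y"
    using separable_metric_space_isometric_copy[OF assms(2,3)] by blast
  obtain f where f: "coarse_embedding (j ` M) (metric_controlled (j ` M) d') Y ctrl f"
    using assms(1) j(2,3) unfolding coarsely_universal_def by blast
  have "coarse_embedding M (metric_controlled M d) Y ctrl (f \<circ> j)"
    unfolding coarse_embedding_def
  proof (intro conjI allI impI)
    show "(f \<circ> j) ` M \<subseteq> Y" using f by (auto simp: coarse_embedding_def)
  next
    fix E assume E: "metric_controlled M d E"
    then have "metric_controlled (j ` M) d' (map_prod j j ` E)"
      unfolding metric_controlled_def
    proof (elim conjE exE, intro conjI exI)
      fix C assume "E \<subseteq> M \<times> M" "\<forall>(x, y)\<in>E. d x y \<le> C"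
      then show "\<forall>(x, y)\<in>map_prod j j ` E. d' x y \<le> C" using j(4) by fastforce
    qed auto
    then have "ctrl (map_prod f f ` map_prod j j ` E)"
      using f by (auto simp: coarse_embedding_def)
    then show "ctrl (map_prod (f \<circ> j) (f \<circ> j) ` E)"
      by (simp add: image_comp map_prod_compose)
  next
    fix E assume "ctrl E"
    then have "metric_controlled (j ` M) d' (map_prod f f -` E \<inter> j ` M \<times> j ` M)"
      using f by (auto simp: coarse_embedding_def)
    then obtain C where C: "\<forall>(x, y) \<in> map_prod f f -` E \<inter> j ` M \<times> j ` M. d' x y \<le> C"
      unfolding metric_controlled_def by blast
    have "d x y \<le> C" if "(x, y) \<in> map_prod (f \<circ> j) (f \<circ> j) -` E \<inter> M \<times> M" for x y
      using that j(4)[of x y] bspec[OF C, of "(j x, j y)"] by simp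
    then show "metric_controlled M d (map_prod (f \<circ> j) (f \<circ> j) -` E \<inter> M \<times> M)"
      unfolding metric_controlled_def by blast
  qed
  then show ?thesis by blast
qed


section \<open>Hilbert spaces and the Haagerup property\<close>

definition real_ring :: "real ring" where
  "real_ring = \<lparr>carrier = UNIV, mult = (*), one = 1, zero = 0, add = (+)\<rparr>"

text \<open>The value outside the carrier is immaterial, but the locale \<^locale>\<open>Metric_space\<close> requires
  a distance to be non-negative and symmetric everywhere.\<close>

definition hilbert_dist ::
  "(real, 'h, 'm) module_scheme \<Rightarrow> ('h \<Rightarrow> 'h \<Rightarrow> real) \<Rightarrow> 'h \<Rightarrow> 'h \<Rightarrow> real" where
  "hilbert_dist V ip x y =
     (if x \<in> carrier V \<and> y \<in> carrier V then sqrt (ip (x \<ominus>\<^bsub>V\<^esub> y) (x \<ominus>\<^bsub>V\<^esub> y)) else 0)"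

locale real_inner_product_space = Module.module real_ring V
  for V :: "(real, 'h, 'm) module_scheme" (structure) +
  fixes ip :: "'h \<Rightarrow> 'h \<Rightarrow> real"
  assumes ip_commute: "\<lbrakk>x \<in> carrier V; y \<in> carrier V\<rbrakk> \<Longrightarrow> ip x y = ip y x"
    and ip_add_left: "\<lbrakk>x \<in> carrier V; y \<in> carrier V; z \<in> carrier V\<rbrakk>
      \<Longrightarrow> ip (x \<oplus> y) z = ip x z + ip y z"
    and ip_smult_left: "\<lbrakk>x \<in> carrier V; y \<in> carrier V\<rbrakk> \<Longrightarrow> ip (r \<odot> x) y = r * ip x y"
    and ip_nonneg: "x \<in> carrier V \<Longrightarrow> 0 \<le> ip x x"
    and ip_definite: "\<lbrakk>x \<in> carrier V; ip x x = 0\<rbrakk> \<Longrightarrow> x = \<zero>"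
begin

lemma ip_add_right: "\<lbrakk>x \<in> carrier V; y \<in> carrier V; z \<in> carrier V\<rbrakk>
    \<Longrightarrow> ip z (x \<oplus> y) = ip z x + ip z y"
  by (metis ip_add_left ip_commute M.add.m_closed)

lemma ip_smult_right: "\<lbrakk>x \<in> carrier V; y \<in> carrier V\<rbrakk> \<Longrightarrow> ip y (r \<odot> x) = r * ip y x"
  by (metis ip_smult_left ip_commute smult_closed UNIV_I real_ring_def partial_object.select_convs(1))

lemma smult_carrier: "x \<in> carrier V \<Longrightarrow> r \<odot> x \<in> carrier V"
  by (simp add: real_ring_def smult_closed)

lemma minus_eq_smult: "x \<in> carrier V \<Longrightarrow> \<ominus> x = (- 1) \<odot> x"
proof -
  assume x: "x \<in> carrier V"
  have r: "\<ominus>\<^bsub>real_ring\<^esub> \<one>\<^bsub>real_ring\<^esub> = - 1"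
    by (rule R.minus_equality) (simp_all add: real_ring_def)
  show ?thesis
    using smult_l_minus[of "\<one>\<^bsub>real_ring\<^esub>" x] x r by simp
qed

lemma ip_zero: "ip \<zero> \<zero> = 0"
  using ip_add_left[of \<zero> \<zero> \<zero>] by simp

lemma ip_square_add: "\<lbrakk>x \<in> carrier V; y \<in> carrier V\<rbrakk>
    \<Longrightarrow> ip (x \<oplus> r \<odot> y) (x \<oplus> r \<odot> y) = ip x x + 2 * r * ip x y + r\<^sup>2 * ip y y"
  by (simp add: ip_add_left ip_add_right ip_smult_left ip_smult_right smult_carrier
      ip_commute[of y x] power2_eq_square algebra_simps)

lemma ip_Cauchy_Schwarz:
  assumes "x \<in> carrier V" "y \<in> carrier V"
  shows "ip x y \<le> sqrt (ip x x) * sqrt (ip y y)"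
proof -
  have *: "0 \<le> ip x x + 2 * r * ip x y + r\<^sup>2 * ip y y" for r
    using ip_square_add[OF assms, of r] ip_nonneg[of "x \<oplus> r \<odot> y"] assms smult_carrier by simp
  have "(ip x y)\<^sup>2 \<le> ip x x * ip y y"
  proof (cases "ip y y = 0")
    case True
    then have "y = \<zero>" using ip_definite assms by blast
    then have "ip x y = 0"
      using ip_add_right[of \<zero> \<zero> x] assms by simp
    then show ?thesis using True by simp
  next
    case False
    then have pos: "ip y y > 0" using ip_nonneg assms by (metis order_le_less)
    have "0 \<le> ip x x - (ip x y)\<^sup>2 / ip y y"
      using *[of "- (ip x y / ip y y)"] pos by (simp add: power2_eq_square field_simps)
    then show ?thesis using pos by (simp add: field_simps)
  qed
  then show ?thesis
    using real_le_rsqrt[of "ip x y" "ip x x * ip y y"] by (simp add: real_sqrt_mult)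
qed

lemma Metric_space_hilbert_dist: "Metric_space (carrier V) (hilbert_dist V ip)"
proof
  have mc: "x \<ominus> y \<in> carrier V" if "x \<in> carrier V" "y \<in> carrier V" for x y
    using that by (rule M.minus_closed)
  show "0 \<le> hilbert_dist V ip x y" for x y
    using mc ip_nonneg by (simp add: hilbert_dist_def)
  show "hilbert_dist V ip x y = hilbert_dist V ip y x" for x y
  proof (cases "x \<in> carrier V \<and> y \<in> carrier V")
    case True
    then have "y \<ominus> x = \<ominus> (x \<ominus> y)"
      by (simp add: M.minus_eq M.minus_add M.a_comm)
    also have "\<dots> = (- 1) \<odot> (x \<ominus> y)" using True mc minus_eq_smult by blast
    finally show ?thesis
      using True mc by (simp add: hilbert_dist_def ip_smult_left ip_smult_right smult_carrier)
  qed (auto simp: hilbert_dist_def)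
  show "(hilbert_dist V ip x y = 0) = (x = y)" if "x \<in> carrier V" "y \<in> carrier V" for x y
  proof
    assume "hilbert_dist V ip x y = 0"
    then have "x \<ominus> y = \<zero>"
      using that mc[of x y] ip_definite[of "x \<ominus> y"] by (simp add: hilbert_dist_def)
    then show "x = y"
      using that M.add.inv_solve_right'[of \<zero> x y] by (simp add: M.minus_eq)
  next
    assume "x = y"
    then show "hilbert_dist V ip x y = 0"
      using that ip_zero by (simp add: hilbert_dist_def M.minus_eq M.r_neg)
  qed
  show "hilbert_dist V ip x z \<le> hilbert_dist V ip x y + hilbert_dist V ip y z"
    if xyz: "x \<in> carrier V" "y \<in> carrier V" "z \<in> carrier V" for x y z
  proof -
    let ?a = "x \<ominus> y" and ?b = "y \<ominus> z"
    have ab: "?a \<in> carrier V" "?b \<in> carrier V" using xyz mc by auto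
    have e: "x \<ominus> z = ?a \<oplus> ?b"
      using xyz by (simp add: M.minus_eq M.a_assoc M.r_neg1)
    have "ip (?a \<oplus> ?b) (?a \<oplus> ?b) = ip ?a ?a + 2 * ip ?a ?b + ip ?b ?b"
      using ab by (simp add: ip_add_left ip_add_right ip_commute[of ?b ?a])
    also have "\<dots> \<le> (sqrt (ip ?a ?a) + sqrt (ip ?b ?b))\<^sup>2"
      using ip_Cauchy_Schwarz[OF ab] ip_nonneg[OF ab(1)] ip_nonneg[OF ab(2)]
      by (simp add: power2_sum)
    finally show ?thesis
      using xyz ab ip_nonneg by (simp add: hilbert_dist_def e real_le_lsqrt)
  qed
qed

end

locale real_hilbert_space = real_inner_product_space +
  assumes complete: "Metric_space.mcomplete (carrier V) (hilbert_dist V ip)"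

text \<open>Hilbert spaces are real, with points in the type \<open>'g \<Rightarrow> real\<close>, where
  \<open>'g\<close> is the type of the group elements. The type is no restriction: the image of a map
  \<open>f\<close> from the group, or an orbit, lies in a closed subspace whose vectors are determined by
  their inner products with the vectors indexed by the group, and that subspace can replace the
  whole space. See \<open>coarsely_embeds_in_hilbertI\<close> and \<open>haagerupI\<close> for
  Hilbert spaces of any type.\<close>

definition coarsely_embeds_in_hilbert :: "('g, 'm) monoid_scheme \<Rightarrow> 'g topology \<Rightarrow> bool" where
  "coarsely_embeds_in_hilbert G T \<longleftrightarrow>
     (\<exists>(V :: (real, 'g \<Rightarrow> real) module) ip f. real_hilbert_space V ip \<and>
        coarse_embedding (carrier G) (group_controlled G T)
          (carrier V) (metric_controlled (carrier V) (hilbert_dist V ip)) f)"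

text \<open>A net \<open>g\<^sub>i\<close> eventually leaves every bounded set; nets are rendered by filters.\<close>

definition haagerup :: "('g, 'm) monoid_scheme \<Rightarrow> 'g topology \<Rightarrow> bool" where
  "haagerup G T \<longleftrightarrow>
     (\<exists>(V :: (real, 'g \<Rightarrow> real) module) ip \<phi>. real_hilbert_space V ip \<and>
        group_action G (carrier V) \<phi> \<and>
        (\<forall>g\<in>carrier G. \<forall>x\<in>carrier V. \<forall>y\<in>carrier V.
           hilbert_dist V ip (\<phi> g x) (\<phi> g y) = hilbert_dist V ip x y) \<and>
        (\<forall>g\<in>carrier G. \<forall>x\<in>carrier V. \<forall>y\<in>carrier V. \<forall>t.
           \<phi> g ((1 - t) \<odot>\<^bsub>V\<^esub> x \<oplus>\<^bsub>V\<^esub> t \<odot>\<^bsub>V\<^esub> y) = (1 - t) \<odot>\<^bsub>V\<^esub> \<phi> g x \<oplus>\<^bsub>V\<^esub> t \<odot>\<^bsub>V\<^esub> \<phi> g y) \<and>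
        continuous_map (prod_topology T (Metric_space.mtopology (carrier V) (hilbert_dist V ip)))
          (Metric_space.mtopology (carrier V) (hilbert_dist V ip)) (\<lambda>(g, x). \<phi> g x) \<and>
        (\<exists>\<xi>\<in>carrier V. \<forall>F. (\<forall>\<^sub>F g in F. g \<in> carrier G) \<and>
             (\<forall>B. group_bounded G T B \<longrightarrow> (\<forall>\<^sub>F g in F. g \<notin> B)) \<longrightarrow>
           filterlim (\<lambda>g. sqrt (ip (\<phi> g \<xi>) (\<phi> g \<xi>))) at_top F))"

lemma hilbert_subspace_copy:
  fixes W :: "'h::{real_inner, complete_space} set" and \<iota> :: "'h \<Rightarrow> 'k"
  assumes W: "subspace W" "closed W" and inj: "inj_on \<iota> W"
  obtains V :: "(real, 'k) module" and ip
  where "real_hilbert_space V ip" "carrier V = \<iota> ` W"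
    "\<And>x y. x \<in> W \<Longrightarrow> y \<in> W \<Longrightarrow> \<iota> x \<oplus>\<^bsub>V\<^esub> \<iota> y = \<iota> (x + y)"
    "\<And>r x. x \<in> W \<Longrightarrow> r \<odot>\<^bsub>V\<^esub> \<iota> x = \<iota> (r *\<^sub>R x)"
    "\<And>x y. x \<in> W \<Longrightarrow> y \<in> W \<Longrightarrow> ip (\<iota> x) (\<iota> y) = x \<bullet> y"
    "\<And>x y. x \<in> W \<Longrightarrow> y \<in> W \<Longrightarrow> hilbert_dist V ip (\<iota> x) (\<iota> y) = dist x y"
proof -
  define \<kappa> where "\<kappa> = inv_into W \<iota>"
  have \<kappa>[simp]: "\<kappa> (\<iota> x) = x" if "x \<in> W" for x
    using that inj by (simp add: \<kappa>_def)
  note sub[simp] = subspace_add[OF W(1)] subspace_scale[OF W(1)] subspace_0[OF W(1)]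
    subspace_diff[OF W(1)] subspace_neg[OF W(1)]
  define V :: "(real, 'k) module" where
    "V = \<lparr>carrier = \<iota> ` W, mult = undefined, one = undefined, zero = \<iota> 0,
          add = (\<lambda>x y. \<iota> (\<kappa> x + \<kappa> y)), smult = (\<lambda>r x. \<iota> (r *\<^sub>R \<kappa> x))\<rparr>"
  define ip where "ip x y = \<kappa> x \<bullet> \<kappa> y" for x y
  have Vs[simp]: "carrier V = \<iota> ` W" "zero V = \<iota> 0" "add V x y = \<iota> (\<kappa> x + \<kappa> y)"
    "smult V r x = \<iota> (r *\<^sub>R \<kappa> x)" for x y r
    by (simp_all add: V_def)
  have Rs[simp]: "carrier real_ring = UNIV" "mult real_ring = (*)" "one real_ring = 1"
    "add real_ring = (+)" "zero real_ring = 0"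
    by (simp_all add: real_ring_def)
  have R: "cring real_ring"
  proof (rule cringI)
    show "abelian_group real_ring"
    proof (rule abelian_groupI)
      show "\<exists>y\<in>carrier real_ring. y \<oplus>\<^bsub>real_ring\<^esub> x = \<zero>\<^bsub>real_ring\<^esub>" for x
        by (intro bexI[of _ "- x"]) simp_all
    qed (simp_all add: algebra_simps)
    show "comm_monoid real_ring"
      by (rule comm_monoidI) (simp_all add: algebra_simps)
  qed (simp add: algebra_simps)
  have A: "abelian_group V"
  proof (rule abelian_groupI)
    fix x assume "x \<in> carrier V"
    then obtain w where "w \<in> W" "x = \<iota> w" by auto
    then show "\<exists>y\<in>carrier V. y \<oplus>\<^bsub>V\<^esub> x = \<zero>\<^bsub>V\<^esub>"
      by (intro bexI[of _ "\<iota> (- w)"]) auto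
  qed (auto simp: algebra_simps)
  have M: "Module.module real_ring V"
    by (rule moduleI[OF R A]) (auto simp: algebra_simps)
  interpret V: real_inner_product_space V ip
    by (intro real_inner_product_space.intro M real_inner_product_space_axioms.intro)
      (auto simp: ip_def inner_add_left inner_commute inner_add_right)
  have neg: "\<ominus>\<^bsub>V\<^esub> \<iota> x = \<iota> (- x)" if "x \<in> W" for x
    using V.minus_eq_smult[of "\<iota> x"] that by simp
  have hd: "hilbert_dist V ip (\<iota> x) (\<iota> y) = dist x y" if "x \<in> W" "y \<in> W" for x y
    using that by (simp add: hilbert_dist_def a_minus_def neg ip_def dist_norm norm_eq_sqrt_inner)
  interpret MS: Metric_space "\<iota> ` W" "hilbert_dist V ip"
    using V.Metric_space_hilbert_dist by simp
  have "MS.mcomplete"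
    unfolding MS.mcomplete_def
  proof (intro allI impI)
    fix \<sigma> assume "MS.MCauchy \<sigma>"
    then have r: "range \<sigma> \<subseteq> \<iota> ` W"
      and c: "\<And>e. e > 0 \<Longrightarrow> \<exists>N. \<forall>n n'. N \<le> n \<longrightarrow> N \<le> n' \<longrightarrow> hilbert_dist V ip (\<sigma> n) (\<sigma> n') < e"
      by (auto simp: MS.MCauchy_def)
    then have "\<forall>n. \<exists>w\<in>W. \<sigma> n = \<iota> w" by (auto simp: image_iff subset_iff)
    then obtain w where w: "\<And>n. w n \<in> W" "\<And>n. \<sigma> n = \<iota> (w n)" by metis
    have "Cauchy w"
    proof (rule CauchyI')
      fix e :: real assume "e > 0"
      then obtain N where "\<And>n n'. N \<le> n \<Longrightarrow> N \<le> n' \<Longrightarrow> hilbert_dist V ip (\<sigma> n) (\<sigma> n') < e"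
        using c by blast
      then have "dist (w m) (w n) < e" if "N \<le> m" "m < n" for m n
        using that hd[OF w(1) w(1), of m n] w(2) by (metis order.strict_implies_order order.trans)
      then show "\<exists>M. \<forall>m\<ge>M. \<forall>n>m. dist (w m) (w n) < e" by blast
    qed
    then obtain l where l: "w \<longlonglongrightarrow> l" using Cauchy_convergent convergent_def by blast
    then have "l \<in> W" using W(2) w(1) closed_sequentially by blast
    moreover have "limitin MS.mtopology \<sigma> (\<iota> l) sequentially"
      unfolding MS.limit_metric_sequentially
      using l \<open>l \<in> W\<close> by (auto simp: w hd lim_sequentially)
    ultimately show "\<exists>x. limitin MS.mtopology \<sigma> x sequentially" by blast
  qed
  then have "real_hilbert_space V ip"
    by (intro real_hilbert_space.intro V.real_inner_product_space_axioms
        real_hilbert_space_axioms.intro) simp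
  then show ?thesis
    by (rule that) (simp_all add: hd ip_def)
qed

lemma orthogonal_comp_iff: "x \<in> orthogonal_comp S \<longleftrightarrow> (\<forall>s\<in>S. s \<bullet> x = 0)"
  by (simp add: orthogonal_comp_def orthogonal_def)

lemma closed_orthogonal_comp: "closed (orthogonal_comp S)"
proof -
  have "orthogonal_comp S = (\<Inter>s\<in>S. {x. s \<bullet> x = 0})"
    by (auto simp: orthogonal_comp_iff)
  moreover have "closed {x. s \<bullet> x = 0}" for s :: 'a
    by (intro closed_Collect_eq continuous_intros)
  ultimately show ?thesis by auto
qed

lemma inj_on_orthogonal_coordinates:
  "inj_on (\<lambda>x g. f g \<bullet> x) (orthogonal_comp (orthogonal_comp (range f)))"
proof (rule inj_onI)
  let ?W = "orthogonal_comp (orthogonal_comp (range f))"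
  fix x y assume xy: "x \<in> ?W" "y \<in> ?W" "(\<lambda>g. f g \<bullet> x) = (\<lambda>g. f g \<bullet> y)"
  then have "x - y \<in> ?W" by (simp add: subspace_diff subspace_orthogonal_comp)
  moreover have "x - y \<in> orthogonal_comp (range f)"
    using xy(3) by (auto simp: orthogonal_comp_iff inner_diff_right dest: fun_cong)
  ultimately have "(x - y) \<bullet> (x - y) = 0"
    unfolding orthogonal_comp_iff[of _ "orthogonal_comp _"] by blast
  then show "x = y" by simp
qed

lemma range_subset_orthogonal_comp_comp: "f g \<in> orthogonal_comp (orthogonal_comp (range f))"
  by (auto simp: orthogonal_comp_iff inner_commute)

lemma coarsely_embeds_in_hilbertI:
  fixes f :: "'g \<Rightarrow> 'h::{real_inner, complete_space}"
  assumes "coarse_embedding (carrier G) (group_controlled G T) UNIV (metric_controlled UNIV dist) f"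
  shows "coarsely_embeds_in_hilbert G T"
proof -
  let ?W = "orthogonal_comp (orthogonal_comp (range f))"
  define \<iota> where "\<iota> x g = f g \<bullet> x" for x g
  have inj: "inj_on \<iota> ?W"
    using inj_on_orthogonal_coordinates[of f] by (simp add: \<iota>_def[abs_def])
  obtain V :: "(real, 'g \<Rightarrow> real) module" and ip where V: "real_hilbert_space V ip"
    "carrier V = \<iota> ` ?W"
    "\<And>x y. x \<in> ?W \<Longrightarrow> y \<in> ?W \<Longrightarrow> hilbert_dist V ip (\<iota> x) (\<iota> y) = dist x y"
    using hilbert_subspace_copy[OF subspace_orthogonal_comp closed_orthogonal_comp inj] by metis
  have fW: "f g \<in> ?W" for g by (rule range_subset_orthogonal_comp_comp)
  have "coarse_embedding (carrier G) (group_controlled G T)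
          (carrier V) (metric_controlled (carrier V) (hilbert_dist V ip)) (\<iota> \<circ> f)"
    unfolding coarse_embedding_def
  proof (intro conjI allI impI)
    show "(\<iota> \<circ> f) ` carrier G \<subseteq> carrier V" using fW by (auto simp: V(2))
  next
    fix E assume "group_controlled G T E"
    then have "metric_controlled UNIV dist (map_prod f f ` E)"
      using assms by (auto simp: coarse_embedding_def)
    then obtain C where C: "\<forall>(x, y)\<in>map_prod f f ` E. dist x y \<le> C"
      by (auto simp: metric_controlled_def)
    then have "\<forall>(x, y)\<in>map_prod (\<iota> \<circ> f) (\<iota> \<circ> f) ` E. hilbert_dist V ip x y \<le> C"
      using V(3)[OF fW fW] by fastforce
    moreover have "map_prod (\<iota> \<circ> f) (\<iota> \<circ> f) ` E \<subseteq> carrier V \<times> carrier V"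
      using fW by (auto simp: V(2))
    ultimately show "metric_controlled (carrier V) (hilbert_dist V ip) (map_prod (\<iota> \<circ> f) (\<iota> \<circ> f) ` E)"
      unfolding metric_controlled_def by blast
  next
    fix E assume "metric_controlled (carrier V) (hilbert_dist V ip) E"
    then obtain C where C: "\<forall>(x, y)\<in>E. hilbert_dist V ip x y \<le> C"
      by (auto simp: metric_controlled_def)
    let ?E = "{(f g, f h) | g h. (\<iota> (f g), \<iota> (f h)) \<in> E}"
    have "metric_controlled UNIV dist ?E"
      unfolding metric_controlled_def
    proof (intro conjI exI)
      show "\<forall>(x, y)\<in>?E. dist x y \<le> C"
        using C V(3)[OF fW fW] by fastforce
    qed simp
    then have "group_controlled G T (map_prod f f -` ?E \<inter> carrier G \<times> carrier G)"
      using assms by (auto simp: coarse_embedding_def)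
    moreover have "map_prod f f -` ?E = map_prod (\<iota> \<circ> f) (\<iota> \<circ> f) -` E"
    proof (rule Set.set_eqI, rule iffI)
      fix p assume "p \<in> map_prod f f -` ?E"
      then obtain a b g h where "p = (a, b)" "f a = f g" "f b = f h" "(\<iota> (f g), \<iota> (f h)) \<in> E"
        by (cases p) auto
      then show "p \<in> map_prod (\<iota> \<circ> f) (\<iota> \<circ> f) -` E" by simp
    next
      fix p assume "p \<in> map_prod (\<iota> \<circ> f) (\<iota> \<circ> f) -` E"
      then show "p \<in> map_prod f f -` ?E" by (cases p) auto
    qed
    ultimately show "group_controlled G T (map_prod (\<iota> \<circ> f) (\<iota> \<circ> f) -` E \<inter> carrier G \<times> carrier G)"
      by simp
  qed
  then show ?thesis
    using V(1) unfolding coarsely_embeds_in_hilbert_def by blast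
qed

lemma haagerupI:
  fixes \<phi> :: "'g \<Rightarrow> 'h::{real_inner, complete_space} \<Rightarrow> 'h"
  assumes act: "group_action G UNIV \<phi>"
    and iso: "\<And>g x y. g \<in> carrier G \<Longrightarrow> dist (\<phi> g x) (\<phi> g y) = dist x y"
    and affine: "\<And>g x y t. g \<in> carrier G \<Longrightarrow>
      \<phi> g ((1 - t) *\<^sub>R x + t *\<^sub>R y) = (1 - t) *\<^sub>R \<phi> g x + t *\<^sub>R \<phi> g y"
    and cont: "continuous_map (prod_topology T euclidean) euclidean (\<lambda>(g, x). \<phi> g x)"
    and T: "topspace T = carrier G"
    and proper: "\<And>F. \<forall>\<^sub>F g in F. g \<in> carrier G \<Longrightarrow>
      (\<And>B. group_bounded G T B \<Longrightarrow> \<forall>\<^sub>F g in F. g \<notin> B) \<Longrightarrow> filterlim (\<lambda>g. norm (\<phi> g \<xi>)) at_top F"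
  shows "haagerup G T"
proof -
  interpret group_action G UNIV \<phi> by (rule act)
  interpret G: group G using group_hom group_hom.axioms(1) by blast
  define b where "b g = (if g \<in> carrier G then \<phi> g 0 else 0)" for g
  let ?W = "orthogonal_comp (orthogonal_comp (range b))"
  have bW: "b g \<in> ?W" for g by (rule range_subset_orthogonal_comp_comp)
  have sW: "subspace ?W" by (rule subspace_orthogonal_comp)
  define \<pi> where "\<pi> g x = \<phi> g x - b g" for g x
  have comp: "\<phi> (g \<otimes>\<^bsub>G\<^esub> h) x = \<phi> g (\<phi> h x)" if "g \<in> carrier G" "h \<in> carrier G" for g h x
    using composition_rule[of x g h] that by simp
  have one: "\<phi> \<one>\<^bsub>G\<^esub> x = x" for x
    using id_eq_one by (metis UNIV_I restrict_apply')
  have orth: "orthogonal_transformation (\<pi> g)" if g: "g \<in> carrier G" for g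
  proof -
    have aff: "\<pi> g ((1 - t) *\<^sub>R x + t *\<^sub>R y) = (1 - t) *\<^sub>R \<pi> g x + t *\<^sub>R \<pi> g y" for x y t
      unfolding \<pi>_def affine[OF g] by (simp add: scaleR_diff_right scaleR_diff_left)
    have zero: "\<pi> g 0 = 0" using g by (simp add: \<pi>_def b_def)
    have sc: "\<pi> g (t *\<^sub>R y) = t *\<^sub>R \<pi> g y" for t y
      using aff[of t 0 y] zero by simp
    have ad: "\<pi> g (x + y) = \<pi> g x + \<pi> g y" for x y
      using aff[of "1/2" "2 *\<^sub>R x" "2 *\<^sub>R y"] by (simp add: sc)
    have "norm (\<pi> g x) = norm x" for x
      using iso[OF g, of x 0] g by (simp add: \<pi>_def b_def dist_norm)
    then show ?thesis
      using sc ad by (simp add: orthogonal_transformation linear_iff)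
  qed
  have \<pi>b: "\<pi> g (b h) = b (g \<otimes>\<^bsub>G\<^esub> h) - b g" if "g \<in> carrier G" "h \<in> carrier G" for g h
    using that comp[of g h 0] by (simp add: \<pi>_def b_def)
  have \<pi>inv: "\<pi> g x \<bullet> y = x \<bullet> \<pi> (inv\<^bsub>G\<^esub> g) y" if g: "g \<in> carrier G" for g x y
  proof -
    have i: "inv\<^bsub>G\<^esub> g \<in> carrier G" using g by simp
    have "\<pi> g (\<pi> (inv\<^bsub>G\<^esub> g) y) = y"
    proof -
      have "\<phi> g (\<phi> (inv\<^bsub>G\<^esub> g) z) = z" for z
        using comp[OF g i, of z] g one by simp
      moreover have "\<pi> g (u - v) = \<pi> g u - \<pi> g v" for u v
        using orth[OF g] by (simp add: linear_diff orthogonal_transformation_linear)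
      ultimately show ?thesis
        using g i by (simp add: \<pi>_def[of "inv\<^bsub>G\<^esub> g"]) (simp add: \<pi>_def b_def)
    qed
    then show ?thesis
      using orth[OF g] unfolding orthogonal_transformation_def by metis
  qed
  have perp: "\<pi> g y \<in> orthogonal_comp (range b)"
    if g: "g \<in> carrier G" and y: "y \<in> orthogonal_comp (range b)" for g y
  proof -
    have by0: "b h \<bullet> y = 0" for h using y by (auto simp: orthogonal_comp_iff)
    have "b h \<bullet> \<pi> g y = 0" for h
    proof (cases "h \<in> carrier G")
      case True
      have i: "inv\<^bsub>G\<^esub> g \<in> carrier G" using g by simp
      have "b h \<bullet> \<pi> g y = \<pi> (inv\<^bsub>G\<^esub> g) (b h) \<bullet> y"
        using \<pi>inv[OF i, of "b h" y] g by simp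
      then show ?thesis using \<pi>b[OF i True] by0 by (simp add: inner_diff_left)
    qed (simp add: b_def)
    then show ?thesis by (auto simp: orthogonal_comp_iff)
  qed
  have \<phi>W: "\<phi> g x \<in> ?W" if g: "g \<in> carrier G" and x: "x \<in> ?W" for g x
  proof -
    have "\<pi> g x \<in> ?W"
      unfolding orthogonal_comp_iff[of _ "orthogonal_comp _"]
    proof
      fix y assume y: "y \<in> orthogonal_comp (range b)"
      have "\<pi> (inv\<^bsub>G\<^esub> g) y \<in> orthogonal_comp (range b)" using g y perp by simp
      then have "\<pi> (inv\<^bsub>G\<^esub> g) y \<bullet> x = 0"
        using x unfolding orthogonal_comp_iff[of _ "orthogonal_comp _"] by blast
      then show "y \<bullet> \<pi> g x = 0" using \<pi>inv[OF g, of x y] by (simp add: inner_commute)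
    qed
    then show ?thesis using subspace_add[OF sW _ bW[of g]] by (fastforce simp: \<pi>_def)
  qed
  define \<iota> where "\<iota> x g = b g \<bullet> x" for x g
  have inj: "inj_on \<iota> ?W"
    using inj_on_orthogonal_coordinates[of b] by (simp add: \<iota>_def[abs_def])
  obtain V :: "(real, 'g \<Rightarrow> real) module" and ip where V: "real_hilbert_space V ip"
    "carrier V = \<iota> ` ?W"
    "\<And>x y. x \<in> ?W \<Longrightarrow> y \<in> ?W \<Longrightarrow> \<iota> x \<oplus>\<^bsub>V\<^esub> \<iota> y = \<iota> (x + y)"
    "\<And>r x. x \<in> ?W \<Longrightarrow> r \<odot>\<^bsub>V\<^esub> \<iota> x = \<iota> (r *\<^sub>R x)"
    "\<And>x y. x \<in> ?W \<Longrightarrow> y \<in> ?W \<Longrightarrow> ip (\<iota> x) (\<iota> y) = x \<bullet> y"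
    "\<And>x y. x \<in> ?W \<Longrightarrow> y \<in> ?W \<Longrightarrow> hilbert_dist V ip (\<iota> x) (\<iota> y) = dist x y"
    by (rule hilbert_subspace_copy[OF subspace_orthogonal_comp closed_orthogonal_comp inj])
      (rule that; assumption)
  interpret V: real_hilbert_space V ip by (rule V(1))
  interpret MS: Metric_space "carrier V" "hilbert_dist V ip" by (rule V.Metric_space_hilbert_dist)
  define \<kappa> where "\<kappa> = inv_into ?W \<iota>"
  have \<kappa>: "\<kappa> (\<iota> x) = x" if "x \<in> ?W" for x
    using that inj by (simp add: \<kappa>_def)
  define \<psi> where "\<psi> g = (\<lambda>v\<in>carrier V. \<iota> (\<phi> g (\<kappa> v)))" for g
  have \<psi>: "\<psi> g (\<iota> x) = \<iota> (\<phi> g x)" if "x \<in> ?W" for g x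
    using that by (simp add: \<psi>_def V(2) \<kappa>)
  have \<psi>inv: "\<psi> (inv\<^bsub>G\<^esub> g) (\<psi> g v) = v" "\<psi> g (\<psi> (inv\<^bsub>G\<^esub> g) v) = v" "\<psi> g v \<in> carrier V"
    if g: "g \<in> carrier G" and v: "v \<in> carrier V" for g v
  proof -
    obtain x where x: "x \<in> ?W" "v = \<iota> x" using v V(2) by auto
    have i: "inv\<^bsub>G\<^esub> g \<in> carrier G" using g by simp
    show "\<psi> (inv\<^bsub>G\<^esub> g) (\<psi> g v) = v" "\<psi> g (\<psi> (inv\<^bsub>G\<^esub> g) v) = v" "\<psi> g v \<in> carrier V"
      using x g i \<phi>W by (simp_all add: \<psi> comp[symmetric] one V(2))
  qed
  have Bij: "\<psi> g \<in> Bij (carrier V)" if g: "g \<in> carrier G" for g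
  proof -
    have "bij_betw (\<psi> g) (carrier V) (carrier V)"
      by (rule bij_betwI[where g = "\<psi> (inv\<^bsub>G\<^esub> g)"]) (use g \<psi>inv in auto)
    then show ?thesis by (simp add: Bij_def \<psi>_def)
  qed
  have "group_action G (carrier V) \<psi>"
  proof (intro group_action.intro group_hom.intro group_hom_axioms.intro G.is_group group_BijGroup homI)
    fix g h assume g: "g \<in> carrier G" and h: "h \<in> carrier G"
    show "\<psi> g \<in> carrier (BijGroup (carrier V))" using Bij[OF g] by (simp add: BijGroup_def)
    have "\<psi> (g \<otimes>\<^bsub>G\<^esub> h) = compose (carrier V) (\<psi> g) (\<psi> h)"
    proof
      fix v
      show "\<psi> (g \<otimes>\<^bsub>G\<^esub> h) v = compose (carrier V) (\<psi> g) (\<psi> h) v"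
      proof (cases "v \<in> carrier V")
        case True
        then obtain x where "x \<in> ?W" "v = \<iota> x" using V(2) by auto
        then show ?thesis using True g h \<phi>W by (simp add: compose_def \<psi> comp)
      qed (simp add: \<psi>_def compose_def)
    qed
    then show "\<psi> (g \<otimes>\<^bsub>G\<^esub> h) = \<psi> g \<otimes>\<^bsub>BijGroup (carrier V)\<^esub> \<psi> h"
      using Bij g h by (simp add: BijGroup_def)
  qed
  moreover have "hilbert_dist V ip (\<psi> g u) (\<psi> g v) = hilbert_dist V ip u v"
    if "g \<in> carrier G" "u \<in> carrier V" "v \<in> carrier V" for g u v
    using that \<phi>W by (auto simp: V(2) \<psi> V(6) iso)
  moreover have "\<psi> g ((1 - t) \<odot>\<^bsub>V\<^esub> u \<oplus>\<^bsub>V\<^esub> t \<odot>\<^bsub>V\<^esub> v) = (1 - t) \<odot>\<^bsub>V\<^esub> \<psi> g u \<oplus>\<^bsub>V\<^esub> t \<odot>\<^bsub>V\<^esub> \<psi> g v"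
    if "g \<in> carrier G" "u \<in> carrier V" "v \<in> carrier V" for g u v t
    using that \<phi>W subspace_scale[OF sW] subspace_add[OF sW]
    by (auto simp: V(2) \<psi> V(3,4) affine)
  moreover have "continuous_map (prod_topology T MS.mtopology) MS.mtopology (\<lambda>(g, x). \<psi> g x)"
  proof -
    have k: "continuous_map MS.mtopology euclidean \<kappa>"
      unfolding mtopology_is_euclidean[symmetric]
      by (subst MS.metric_continuous_map[OF Met_TC.Metric_space_axioms])
        (auto simp: V(2) \<kappa> V(6))
    have kW: "\<kappa> v \<in> ?W" if "v \<in> carrier V" for v
      using that by (auto simp: V(2) \<kappa>)
    have i: "continuous_map (subtopology euclidean ?W) MS.mtopology \<iota>"
    proof -
      interpret S: Submetric UNIV dist ?W by unfold_locales simp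
      have "S.sub.mtopology = subtopology euclidean ?W"
        using S.mtopology_submetric by simp
      then show ?thesis
        using S.sub.metric_continuous_map[OF MS.Metric_space_axioms, of \<iota>]
        by (auto simp: V(2) V(6))
    qed
    have "continuous_map (prod_topology T MS.mtopology) (prod_topology T euclidean)
            (\<lambda>(g, v). (g, \<kappa> v))"
      using continuous_map_prod_top[of T MS.mtopology T euclidean id \<kappa>] k
      by (auto simp: )
    from continuous_map_compose[OF this cont]
    have "continuous_map (prod_topology T MS.mtopology) euclidean (\<lambda>(g, v). \<phi> g (\<kappa> v))"
      by (simp add: o_def case_prod_unfold)
    then have "continuous_map (prod_topology T MS.mtopology) (subtopology euclidean ?W) (\<lambda>(g, v). \<phi> g (\<kappa> v))"
      using \<phi>W kW by (auto simp: continuous_map_in_subtopology T)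
    from continuous_map_compose[OF this i] show ?thesis
      by (rule continuous_map_eq) (auto simp: \<psi>_def)
  qed
  moreover have "\<exists>\<zeta>\<in>carrier V. \<forall>F. (\<forall>\<^sub>F g in F. g \<in> carrier G) \<and>
             (\<forall>B. group_bounded G T B \<longrightarrow> (\<forall>\<^sub>F g in F. g \<notin> B)) \<longrightarrow>
           filterlim (\<lambda>g. sqrt (ip (\<psi> g \<zeta>) (\<psi> g \<zeta>))) at_top F"
  proof (intro bexI[of _ "\<iota> 0"] allI impI)
    have z: "0 \<in> ?W" by (rule subspace_0[OF sW])
    show "\<iota> 0 \<in> carrier V" using z by (simp add: V(2))
    fix F assume F: "(\<forall>\<^sub>F g in F. g \<in> carrier G) \<and>
             (\<forall>B. group_bounded G T B \<longrightarrow> (\<forall>\<^sub>F g in F. g \<notin> B))"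
    then have lim: "filterlim (\<lambda>g. norm (\<phi> g \<xi>)) at_top F"
      by (intro proper) auto
    have "filterlim (\<lambda>g. - norm \<xi> + norm (\<phi> g \<xi>)) at_top F"
      by (rule filterlim_tendsto_add_at_top[OF tendsto_const lim])
    moreover have "\<forall>\<^sub>F g in F. - norm \<xi> + norm (\<phi> g \<xi>) \<le> sqrt (ip (\<psi> g (\<iota> 0)) (\<psi> g (\<iota> 0)))"
    proof -
      have "- norm \<xi> + norm (\<phi> g \<xi>) \<le> sqrt (ip (\<psi> g (\<iota> 0)) (\<psi> g (\<iota> 0)))" if g: "g \<in> carrier G" for g
      proof -
        have "norm (\<phi> g \<xi>) \<le> norm (\<phi> g 0) + dist (\<phi> g \<xi>) (\<phi> g 0)"
          unfolding dist_norm by (rule norm_triangle_sub)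
        then show ?thesis
          using z \<phi>W[OF g z] by (simp add: \<psi> V(5) iso[OF g] norm_eq_sqrt_inner)
      qed
      with F show ?thesis by (auto elim: eventually_mono)
    qed
    ultimately show "filterlim (\<lambda>g. sqrt (ip (\<psi> g (\<iota> 0)) (\<psi> g (\<iota> 0)))) at_top F"
      by (rule filterlim_at_top_mono)
  qed
  ultimately show ?thesis
    unfolding haagerup_def using V(1) by blast
qed


section \<open>Total disconnectedness\<close>

definition totally_disconnected :: "'x::topological_space set \<Rightarrow> bool" where
  "totally_disconnected S \<longleftrightarrow> (\<forall>C. C \<subseteq> S \<and> connected C \<longrightarrow> (\<exists>x. C \<subseteq> {x}))"

end

theory Submission
  imports Defs
begin

text \<open>If \<open>X\<close> is totally disconnected, a clopen set separates the points where a unitary \<open>u\<close> has large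
  real part from those where it has small real part, so two branches of the logarithm give
  \<open>u = exp (i h)\<close> with \<open>\<parallel>h\<parallel> \<le> 2\<pi>\<close>. Both unitary groups are then bounded, that is, coarsely
  equivalent to a point.

  Otherwise \<open>X\<close> has a nontrivial connected subset \<open>C\<close>, and a Urysohn function supplies disjointly
  supported bumps \<open>g k\<close> with peaks \<open>\<xi> k\<close> on \<open>C\<close> that all vanish at a point \<open>\<xi>\<^sub>0\<close> of \<open>C\<close>. On \<open>C\<close> a logarithm is unique up
  to a constant, so \<open>c \<mapsto> exp (i (\<Sum>k. c k * g k))\<close> embeds the finitely supported sequences with the
  supremum norm into the unitary groups, up to a factor of 4. To see this in the group of all
  unitaries, the homomorphism \<open>exp (i h) \<mapsto> (h (\<xi> k) - h \<xi>\<^sub>0)\<^sub>k\<close> is extended from the subgroup of exponentials to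
  a homomorphism into the bounded sequences, which induces a continuous left-invariant
  pseudometric. Universality follows from Aharoni's theorem. Finitely supported sequences do not
  embed coarsely into a Hilbert space, because Hilbert spaces satisfy the metric cotype 2
  inequality on discrete tori; and the orbit map of a proper affine isometric action would be a
  coarse embedding.\<close>

section \<open>Exponentials and the exponential length\<close>

text \<open>Boundedness in the full unitary group is tested by pseudometrics on the whole group, and
  a unitary need not have a logarithm; coordinates known only on exponentials would therefore prove
  nothing there. Their extension comes from Zorn's lemma, with no regard to topology. It is
  continuous all the same: a unitary near the identity is the exponential of a small function, and
  on exponentials the coordinates are Lipschitz in the logarithm. The obstruction in Hilbert space
  compares two motions on a discrete torus with \<open>n\<close> circular factors: one step in every
  direction at once, and \<open>2 * m\<close> steps in a single direction. With
  \<open>n = m\<^sup>2\<close> the second displacement is at most a fixed multiple of the first,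
  uniformly in \<open>m\<close>, although it joins antipodes of a circle of radius \<open>m\<close>.
  Only squared distances between finitely many points enter, so the inequality is proved for real
  functions and summed over coordinates.\<close>

lemma norm_cis_diff_le: "cmod (cis s - cis t) \<le> \<bar>s - t\<bar>"
proof -
  have "cis s - cis t = cis t * (cis (s - t) - 1)"
    by (simp add: cis_mult right_diff_distrib)
  then have "cmod (cis s - cis t) = 2 * \<bar>sin ((s - t) / 2)\<bar>"
    using dist_exp_i_1[of "s - t"] by (simp add: norm_mult cis_conv_exp)
  also have "\<dots> \<le> \<bar>s - t\<bar>"
    using abs_sin_x_le_abs_x[of "(s - t) / 2"] by simp
  finally show ?thesis .
qed

context
  includes bcontfun.lifting
begin

lift_definition cis_bcontfun :: "('x::topological_space \<Rightarrow>\<^sub>C real) \<Rightarrow> ('x \<Rightarrow>\<^sub>C complex)" is "\<lambda>h x. cis (h x)"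
  by (auto simp: bcontfun_def bounded_iff intro!: continuous_intros)

lift_definition of_real_bcontfun :: "('x::topological_space \<Rightarrow>\<^sub>C real) \<Rightarrow> ('x \<Rightarrow>\<^sub>C complex)"
  is "\<lambda>h x. of_real (h x)"
  by (auto simp: bcontfun_def bounded_iff intro!: continuous_intros)

lift_definition Re_bcontfun :: "('x::topological_space \<Rightarrow>\<^sub>C complex) \<Rightarrow> ('x \<Rightarrow>\<^sub>C real)" is "\<lambda>h x. Re (h x)"
  by (auto simp: bcontfun_def bounded_iff intro!: continuous_intros) (meson abs_Re_le_cmod order_trans)

end

lemmas [simp] = cis_bcontfun.rep_eq of_real_bcontfun.rep_eq Re_bcontfun.rep_eq const_bcontfun.rep_eq

lemma norm_le_bcontfun_iff:
  fixes f :: "'x::topological_space \<Rightarrow>\<^sub>C 'b::real_normed_vector"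
  shows "norm f \<le> b \<longleftrightarrow> (\<forall>x. norm (f x) \<le> b)"
  using norm_bounded[of f] norm_bound[of f b] order_trans by blast

lemma cis_bcontfun_add: "cis_bcontfun (g + h) = cis_bcontfun g * cis_bcontfun h"
  and cis_bcontfun_0 [simp]: "cis_bcontfun 0 = 1"
  and adjoint_cis_bcontfun: "adjoint_bcontfun (cis_bcontfun h) = cis_bcontfun (- h)"
  by (auto intro!: bcontfun_eqI simp: cis_mult cis_cnj)

lemma norm_cis_bcontfun_diff_le: "norm (cis_bcontfun g - cis_bcontfun h) \<le> norm (g - h)"
proof -
  have "norm (cis_bcontfun g x - cis_bcontfun h x) \<le> norm (g - h)" for x
    using norm_cis_diff_le[of "g x" "h x"] norm_bounded[of "g - h" x] by simp
  then show ?thesis by (simp add: norm_le_bcontfun_iff)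
qed

lemma apply_bcontfun_power: "apply_bcontfun (a ^ n) x = apply_bcontfun a x ^ n"
  for a :: "'x::topological_space \<Rightarrow>\<^sub>C complex"
  by (induction n) auto

text \<open>Evaluation at a point is bounded, linear and multiplicative, so it passes through the
  exponential series.\<close>

lemma apply_bcontfun_exp: "apply_bcontfun (exp a) x = exp (apply_bcontfun a x)"
  for a :: "'x::topological_space \<Rightarrow>\<^sub>C complex"
proof -
  have bl: "bounded_linear (\<lambda>f. apply_bcontfun f x :: complex)"
    by (rule bounded_linear_intro[where K = 1]) (auto intro: norm_bounded)
  have "(\<lambda>n. apply_bcontfun (a ^ n /\<^sub>R fact n) x) sums apply_bcontfun (exp a) x"
    by (rule bounded_linear.sums[OF bl exp_converges])
  moreover have "(\<lambda>n. apply_bcontfun (a ^ n /\<^sub>R fact n) x) sums exp (apply_bcontfun a x)"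
    using exp_converges[of "apply_bcontfun a x"] by (simp add: apply_bcontfun_power)
  ultimately show ?thesis by (rule sums_unique2)
qed

lemma selfadjoint_of_real_bcontfun: "selfadjoint (of_real_bcontfun h)"
  by (auto simp: selfadjoint_def intro!: bcontfun_eqI)

lemma exp_of_real_bcontfun: "exp (const_bcontfun \<i> * of_real_bcontfun h) = cis_bcontfun h"
  by (auto intro!: bcontfun_eqI simp: apply_bcontfun_exp cis_conv_exp)

lemma selfadjoint_imp_of_real_Re: "selfadjoint a \<Longrightarrow> of_real_bcontfun (Re_bcontfun a) = a"
  unfolding selfadjoint_def
  by (intro bcontfun_eqI) (metis Re_bcontfun.rep_eq adjoint_bcontfun.rep_eq of_real_Re
      of_real_bcontfun.rep_eq Reals_cnj_iff)

lemma norm_of_real_bcontfun [simp]: "norm (of_real_bcontfun h) = norm h"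
proof (rule antisym)
  show "norm (of_real_bcontfun h) \<le> norm h"
    using norm_bounded[of h] by (simp add: norm_le_bcontfun_iff)
  have "norm (h x) \<le> norm (of_real_bcontfun h)" for x
    using norm_bounded[of "of_real_bcontfun h" x] by simp
  then show "norm h \<le> norm (of_real_bcontfun h)"
    by (simp add: norm_le_bcontfun_iff)
qed

text \<open>As \<open>C(X)\<close> is commutative, a product of exponentials is a single exponential.\<close>

lemma cel_eq: "cel u = Inf {norm h | h. u = cis_bcontfun h}"
proof -
  let ?A = "{sum_list (map norm as) | as. (\<forall>a\<in>set as. selfadjoint a) \<and>
     u = prod_list (map (\<lambda>a. exp (const_bcontfun \<i> * a)) as)}"
  let ?B = "{norm h | h. u = cis_bcontfun h}"
  have B: "?B \<subseteq> ?A"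
  proof clarify
    fix h :: "'a \<Rightarrow>\<^sub>C real" assume "u = cis_bcontfun h"
    then show "\<exists>as. norm h = sum_list (map norm as) \<and> (\<forall>a\<in>set as. selfadjoint a) \<and>
        cis_bcontfun h = prod_list (map (\<lambda>a. exp (const_bcontfun \<i> * a)) as)"
      by (intro exI[of _ "[of_real_bcontfun h]"])
        (simp add: selfadjoint_of_real_bcontfun exp_of_real_bcontfun)
  qed
  have A: "\<exists>b\<in>?B. b \<le> a" if a: "a \<in> ?A" for a
  proof -
    from a obtain as where as: "a = sum_list (map norm as)" "\<forall>a\<in>set as. selfadjoint a"
      "u = prod_list (map (\<lambda>a. exp (const_bcontfun \<i> * a)) as)" by blast
    from as(2) have "prod_list (map (\<lambda>a. exp (const_bcontfun \<i> * a)) as)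
        = cis_bcontfun (sum_list (map Re_bcontfun as)) \<and>
        norm (sum_list (map Re_bcontfun as)) \<le> sum_list (map norm as)"
    proof (induction as)
      case (Cons b as)
      then have b: "of_real_bcontfun (Re_bcontfun b) = b"
        by (simp add: selfadjoint_imp_of_real_Re)
      then have "norm (Re_bcontfun b) = norm b"
        by (metis norm_of_real_bcontfun)
      then have "norm (Re_bcontfun b + sum_list (map Re_bcontfun as)) \<le> norm b + sum_list (map norm as)"
        using Cons by (simp add: norm_triangle_le)
      with Cons b exp_of_real_bcontfun[of "Re_bcontfun b"] show ?case
        by (simp add: cis_bcontfun_add)
    qed simp
    with as show ?thesis by blast
  qed
  have bdd: "bdd_below ?A" "bdd_below ?B"
    by (auto intro!: bdd_belowI[of _ 0] sum_list_nonneg)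
  \<comment> \<open>For an element without a logarithm both sets are empty, and both infima are the
    same unspecified value \<open>Inf {}\<close>.\<close>
  show ?thesis
  proof (cases "?B = {}")
    case True
    then have "?A = {}" using A by blast
    then show ?thesis unfolding cel_def by (simp only: True)
  next
    case False
    then have ne: "?A \<noteq> {}" using B by blast
    have "Inf ?A \<le> Inf ?B" by (rule cInf_superset_mono[OF False bdd(1) B])
    moreover have "Inf ?B \<le> Inf ?A"
    proof (rule cInf_greatest[OF ne])
      fix a assume "a \<in> ?A"
      then obtain b where "b \<in> ?B" "b \<le> a" using A by blast
      then show "Inf ?B \<le> a" using cInf_lower[OF _ bdd(2)] by (meson order_trans)
    qed
    ultimately show ?thesis unfolding cel_def by (rule antisym)
  qed
qed

lemma cel_cis_bcontfun_le: "cel (cis_bcontfun h) \<le> norm h"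
  unfolding cel_eq by (rule cInf_lower) (auto intro: bdd_belowI[of _ 0])

lemma le_cel_cis_bcontfun:
  assumes "\<And>g. cis_bcontfun g = cis_bcontfun h \<Longrightarrow> c \<le> norm g"
  shows "c \<le> cel (cis_bcontfun h)"
  unfolding cel_eq by (rule cInf_greatest) (use assms in \<open>auto dest: sym\<close>)

text \<open>Allows both groups to be treated at once. What matters about a member is that it is a
  group under the operations of the full unitary group and contains all exponentials.\<close>

definition unitary_groups :: "('x::topological_space \<Rightarrow>\<^sub>C complex) monoid set" where
  "unitary_groups = {unitary_group0, unitary_group}"

lemma unitary_groupsD:
  assumes "G \<in> unitary_groups"
  shows "Group.group G" "carrier G \<subseteq> carrier unitary_group" "mult G = (*)" "one G = 1"
  using assms group_unitary_group group_unitary_group0 connected_component_subset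
  by (auto simp: unitary_groups_def unitary_group0_def) (auto simp: unitary_group_def)

lemma in_unitary_group_iff: "u \<in> carrier unitary_group \<longleftrightarrow> (\<forall>x. norm (apply_bcontfun u x) = 1)"
proof -
  have "cnj z * z = 1 \<longleftrightarrow> norm z = 1" for z
    by (metis complex_norm_square mult.commute norm_ge_zero of_real_1 of_real_eq_iff
        power2_eq_1_iff abs_of_nonneg abs_1 real_sqrt_abs real_sqrt_one)
  moreover have "f = g \<longleftrightarrow> (\<forall>x. apply_bcontfun f x = apply_bcontfun g x)" for f g :: "'a \<Rightarrow>\<^sub>C complex"
    by (metis bcontfun_eqI)
  ultimately show ?thesis
    by (simp add: unitary_group_def mult.commute)
qed

lemma inv_unitary_groups:
  assumes "G \<in> unitary_groups" "u \<in> carrier G"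
  shows "inv\<^bsub>G\<^esub> u = adjoint_bcontfun u"
proof -
  interpret G: group G by (rule unitary_groupsD[OF assms(1)])
  interpret U: group unitary_group by (rule group_unitary_group)
  let ?v = "inv\<^bsub>G\<^esub> u"
  note * = unitary_groupsD[OF assms(1)]
  have v: "?v \<in> carrier G" using assms by simp
  have "?v * u = 1"
    using G.l_inv[OF assms(2)] *(3,4) by simp
  then have "inv\<^bsub>unitary_group\<^esub> u = ?v"
    using v assms *(2) by (intro U.inv_equality) (auto simp: unitary_group_def)
  then show ?thesis using inv_unitary_group[of u] assms(2) *(2) by auto
qed

text \<open>The path \<open>t \<mapsto> cis_bcontfun (t *\<^sub>R h)\<close> joins the identity to
  the given exponential within the unitaries, so exponentials lie in the identity component.\<close>

lemma cis_bcontfun_in_unitary_groups: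
  assumes "G \<in> unitary_groups"
  shows "cis_bcontfun h \<in> carrier G"
proof -
  have U: "cis_bcontfun g \<in> carrier unitary_group" for g :: "'a \<Rightarrow>\<^sub>C real"
    by (simp add: in_unitary_group_iff)
  have "continuous_on {0..1} (\<lambda>t. cis_bcontfun (t *\<^sub>R h))"
  proof (rule continuous_on_subset[OF _ subset_UNIV])
    have "(norm h)-lipschitz_on UNIV (\<lambda>t. cis_bcontfun (t *\<^sub>R h))"
    proof (rule lipschitz_onI)
      fix s t :: real
      have "dist (cis_bcontfun (s *\<^sub>R h)) (cis_bcontfun (t *\<^sub>R h)) \<le> norm ((s - t) *\<^sub>R h)"
        using norm_cis_bcontfun_diff_le[of "s *\<^sub>R h" "t *\<^sub>R h"]
        by (simp add: dist_norm scaleR_left_diff_distrib)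
      then show "dist (cis_bcontfun (s *\<^sub>R h)) (cis_bcontfun (t *\<^sub>R h)) \<le> norm h * dist s t"
        by (simp add: dist_norm mult.commute)
    qed simp
    then show "continuous_on UNIV (\<lambda>t. cis_bcontfun (t *\<^sub>R h))"
      by (rule lipschitz_on_continuous_on)
  qed
  then have "connected ((\<lambda>t. cis_bcontfun (t *\<^sub>R h)) ` {0..1})"
    by (intro connected_continuous_image) auto
  moreover have "1 \<in> (\<lambda>t. cis_bcontfun (t *\<^sub>R h)) ` {0..1}"
    by (rule image_eqI[of _ _ 0]) auto
  moreover have "cis_bcontfun h \<in> (\<lambda>t. cis_bcontfun (t *\<^sub>R h)) ` {0..1}"
    by (rule image_eqI[of _ _ 1]) auto
  ultimately have "cis_bcontfun h \<in> connected_component_set (carrier unitary_group) 1"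
    using U unfolding mem_Collect_eq connected_component_def by (metis image_subsetI)
  then show ?thesis using assms U by (auto simp: unitary_groups_def unitary_group0_def)
qed

lemma inv_mult_cis_bcontfun:
  assumes "G \<in> unitary_groups"
  shows "inv\<^bsub>G\<^esub> (cis_bcontfun g) \<otimes>\<^bsub>G\<^esub> cis_bcontfun h = cis_bcontfun (h - g)"
  using assms cis_bcontfun_in_unitary_groups[OF assms]
  by (simp add: inv_unitary_groups unitary_groupsD adjoint_cis_bcontfun flip: cis_bcontfun_add)

lemma cel_dist_cis_bcontfun: "cel_dist (cis_bcontfun g) (cis_bcontfun h) = cel (cis_bcontfun (h - g))"
  by (simp add: cel_dist_def inv_mult_cis_bcontfun unitary_groups_def)

section \<open>Bounded sets in the unitary groups\<close>

text \<open>Translates the continuity demanded in \<open>group_bounded\<close> into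
  \<open>continuous_on\<close> over \<open>carrier G \<times> carrier G\<close>.\<close>

lemma prod_norm_topology:
  "prod_topology (norm_topology G) (norm_topology G) = top_of_set (carrier G \<times> carrier G)"
proof -
  have "prod_topology euclidean euclidean = (euclidean :: ('a \<times> 'a) topology)"
    unfolding topology_eq
  proof
    fix S :: "('a \<times> 'a) set"
    have "open S \<longleftrightarrow> (\<forall>a b. (a, b) \<in> S \<longrightarrow> (\<exists>A B. open A \<and> open B \<and> a \<in> A \<and> b \<in> B \<and> A \<times> B \<subseteq> S))"
      unfolding open_prod_def by (simp add: Ball_def split_paired_All)
    then show "openin (prod_topology euclidean euclidean) S \<longleftrightarrow> openin euclidean S"
      by (simp add: openin_prod_topology_alt)
  qed
  then show ?thesis by (simp add: norm_topology_def flip: subtopology_Times)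
qed

lemma pseudometric_le_power:
  assumes d: "left_invariant_pseudometric G d" and "Group.group G" "w \<in> carrier G" "d \<one>\<^bsub>G\<^esub> w \<le> 1"
  shows "d \<one>\<^bsub>G\<^esub> (w [^]\<^bsub>G\<^esub> (n::nat)) \<le> n"
proof (induction n)
  case 0
  interpret group G by fact
  show ?case using d by (simp add: left_invariant_pseudometric_def)
next
  case (Suc n)
  interpret group G by fact
  let ?v = "w [^]\<^bsub>G\<^esub> n"
  have v: "?v \<in> carrier G" using assms by simp
  have "d \<one>\<^bsub>G\<^esub> (w \<otimes>\<^bsub>G\<^esub> ?v) \<le> d \<one>\<^bsub>G\<^esub> w + d w (w \<otimes>\<^bsub>G\<^esub> ?v)"
    using d assms(3) v unfolding left_invariant_pseudometric_def by (meson m_closed one_closed)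
  also have "d w (w \<otimes>\<^bsub>G\<^esub> ?v) = d \<one>\<^bsub>G\<^esub> ?v"
    using d assms(3) v unfolding left_invariant_pseudometric_def by (metis one_closed r_one)
  finally show ?case using Suc assms(4) nat_pow_Suc2[OF assms(3), of n] by simp
qed

text \<open>Continuity of \<open>d\<close> at the identity makes exponentials of functions of norm
  below some \<open>\<delta>\<close> lie within distance 1. With \<open>n > R / \<delta>\<close>,
  every \<open>cis_bcontfun h\<close> in the set is the \<open>n\<close>-th power of such an
  element, and left invariance gives distance at most \<open>n\<close>; this \<open>n\<close> does
  not depend on \<open>h\<close>.\<close>

lemma group_bounded_cis_bcontfun:
  assumes G: "G \<in> unitary_groups"
  shows "group_bounded G (norm_topology G) {cis_bcontfun h | h. norm h \<le> R}"
  unfolding group_bounded_def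
proof (intro conjI allI impI)
  show "{cis_bcontfun h | h. norm h \<le> R} \<subseteq> carrier G"
    using cis_bcontfun_in_unitary_groups[OF G] by blast
next
  fix d :: "('a \<Rightarrow>\<^sub>C complex) \<Rightarrow> ('a \<Rightarrow>\<^sub>C complex) \<Rightarrow> real"
  assume "left_invariant_pseudometric G d \<and>
    continuous_map (prod_topology (norm_topology G) (norm_topology G)) euclideanreal (\<lambda>(x, y). d x y)"
  then have d: "left_invariant_pseudometric G d"
    and cont: "continuous_on (carrier G \<times> carrier G) (\<lambda>(x, y). d x y)"
    by (auto simp: prod_norm_topology)
  note GD = unitary_groupsD[OF G] and cisG = cis_bcontfun_in_unitary_groups[OF G]
  have one: "1 \<in> carrier G" using cisG[of 0] by simp
  then have "d 1 1 = 0" using d by (simp add: left_invariant_pseudometric_def)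
  then obtain \<delta> where \<delta>: "\<delta> > 0"
    "\<And>p. p \<in> carrier G \<times> carrier G \<Longrightarrow> dist p (1, 1) < \<delta> \<Longrightarrow> dist (case p of (x, y) \<Rightarrow> d x y) 0 < 1"
    using cont one unfolding continuous_on_iff
    by (metis (no_types, lifting) SigmaI case_prod_conv zero_less_one)
  have small: "d 1 u \<le> 1" if "u \<in> carrier G" "norm (u - 1) < \<delta>" for u
    using \<delta>(2)[of "(1, u)"] that one by (simp add: dist_norm norm_Pair norm_minus_commute)
  obtain n :: nat where n: "real n > max R 0 / \<delta>" using reals_Archimedean2 by blast
  then have n0: "n > 0" using \<delta>(1) by (cases n) (auto simp: field_simps max_def split: if_splits)
  have bound: "d 1 (cis_bcontfun h) \<le> n" if h: "norm h \<le> R" for h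
  proof -
    let ?w = "cis_bcontfun (h /\<^sub>R n)"
    have "norm (?w - 1) \<le> norm (h /\<^sub>R n)"
      using norm_cis_bcontfun_diff_le[of "h /\<^sub>R n" 0] by simp
    also have "\<dots> \<le> max R 0 / n" using h n0 by (simp add: field_simps)
    also have "\<dots> < \<delta>" using n n0 \<delta>(1) by (simp add: field_simps)
    finally have "d \<one>\<^bsub>G\<^esub> ?w \<le> 1" using small cisG GD(4) by simp
    from pseudometric_le_power[OF d GD(1) cisG this, of n]
    have "d 1 (?w [^]\<^bsub>G\<^esub> n) \<le> n" by (simp add: GD(4))
    moreover have "?w [^]\<^bsub>G\<^esub> k = cis_bcontfun ((real k / n) *\<^sub>R h)" for k :: nat
      by (induction k) (simp_all add: GD nat_pow_def divide_inverse add.commute scaleR_add_left distrib_right flip: cis_bcontfun_add)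
    ultimately show ?thesis using n0 by simp
  qed
  have "d u v \<le> 2 * n" if uv: "u \<in> {cis_bcontfun h | h. norm h \<le> R}" "v \<in> {cis_bcontfun h | h. norm h \<le> R}" for u v
  proof -
    have "u \<in> carrier G" "v \<in> carrier G" "d 1 u \<le> n" "d 1 v \<le> n" using uv bound cisG by auto
    moreover from this have "d u v \<le> d 1 u + d 1 v" using d one unfolding left_invariant_pseudometric_def by metis
    ultimately show ?thesis by simp
  qed
  then show "\<exists>C. \<forall>x\<in>{cis_bcontfun h | h. norm h \<le> R}. \<forall>y\<in>{cis_bcontfun h | h. norm h \<le> R}. d x y \<le> C"
    by blast
qed

section \<open>Logarithms over totally disconnected compact spaces\<close>

lemma Hausdorff_space_euclidean_t2: "Hausdorff_space (euclidean :: 'x::t2_space topology)"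
  unfolding Hausdorff_space_def
proof (intro allI impI)
  fix x y :: 'x assume "x \<in> topspace euclidean \<and> y \<in> topspace euclidean \<and> x \<noteq> y"
  then obtain U V where "open U" "open V" "x \<in> U" "y \<in> V" "U \<inter> V = {}"
    using hausdorff[of x y] by blast
  then show "\<exists>U V. openin euclidean U \<and> openin euclidean V \<and> x \<in> U \<and> y \<in> V \<and> disjnt U V"
    unfolding disjnt_def open_openin[symmetric] by blast
qed

text \<open>The connected components are points, and in a compact Hausdorff space a component can be
  separated from a disjoint closed set by a clopen one. Compactness of \<open>S\<close> passes from
  its points to \<open>S\<close> itself.\<close>

lemma totally_disconnected_clopen_separation:
  fixes S T :: "'x::t2_space set"
  assumes X: "compact (UNIV :: 'x set)" and td: "totally_disconnected (UNIV :: 'x set)"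
    and "closed S" "closed T" "S \<inter> T = {}"
  obtains U where "open U" "closed U" "S \<subseteq> U" "T \<inter> U = {}"
proof -
  let ?X = "euclidean :: 'x topology"
  have c: "compact_space ?X" using X by (simp add: compact_space_def)
  have lc: "locally_compact_space ?X" using c compact_imp_locally_compact_space by blast
  have h: "Hausdorff_space ?X" by (rule Hausdorff_space_euclidean_t2)
  have cpt: "compactin ?X A" if "closed A" for A
    using that X compact_Int_closed[of UNIV A] by simp
  have comp: "connected_component_of_set ?X x = {x}" for x
  proof -
    have "connected (connected_component_of_set ?X x)"
      using connectedin_connected_component_of[of ?X x] by (simp only: connectedin_iff_connected)
    then obtain y where "connected_component_of_set ?X x \<subseteq> {y}"
      using td unfolding totally_disconnected_def by blast
    moreover have "x \<in> connected_component_of_set ?X x" by (simp add: connected_component_of_refl)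
    ultimately show ?thesis by blast
  qed
  have pt: "separated_between ?X {x} T" if "x \<in> S" for x
  proof (rule separated_between_compact_connected_component[OF lc h])
    show "{x} \<in> connected_components_of ?X"
      unfolding connected_components_of_def using comp by (metis UNIV_I image_eqI topspace_euclidean)
    show "disjnt {x} T" using that assms by (auto simp: disjnt_def)
  qed (use assms in auto)
  have "separated_between ?X S T"
    using separated_between_pointwise_left[OF cpt[OF assms(3)], of T] pt by simp
  then show ?thesis
    unfolding separated_between using that by auto
qed

lemma totally_disconnected_imp_cis:
  fixes u :: "'x::t2_space \<Rightarrow>\<^sub>C complex"
  assumes X: "compact (UNIV :: 'x set)" and td: "totally_disconnected (UNIV :: 'x set)"
    and u: "u \<in> carrier unitary_group"
  obtains h where "u = cis_bcontfun h" "norm h \<le> 2 * pi"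
proof -
  \<comment> \<open>The strip of real parts strictly between \<open>-1/2\<close> and
    \<open>1/2\<close> is where both branches of the logarithm are continuous, so \<open>U\<close>
    may divide it arbitrarily.\<close>
  let ?S = "{x. Re (u x) \<ge> 1/2}" and ?T = "{x. Re (u x) \<le> - (1/2)}"
  have "closed ?S" "closed ?T"
    by (intro closed_Collect_le continuous_intros continuous_on_apply_bcontfun)+
  then obtain U where U: "open U" "closed U" "?S \<subseteq> U" "?T \<inter> U = {}"
    by (rule totally_disconnected_clopen_separation[OF X td]) auto
  have n: "norm (u x) = 1" for x using u by (simp add: in_unitary_group_iff)
  \<comment> \<open>Off \<open>U\<close> the value \<open>- u x\<close> avoids the negative axis,
    and the summand \<open>pi\<close> undoes the sign. The branches take values in
    \<open>[- pi, pi]\<close> and \<open>[0, 2 * pi]\<close>, whence the bound.\<close>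
  define h where "h x = (if x \<in> U then Im (Ln (u x)) else pi + Im (Ln (- u x)))" for x
  have c1: "continuous_on U (\<lambda>x. Im (Ln (u x)))"
  proof (intro continuous_intros continuous_on_apply_bcontfun)
    fix x assume "x \<in> U"
    then have "\<not> Re (u x) \<le> - (1/2)" using U(4) by blast
    then show "u x \<notin> \<real>\<^sub>\<le>\<^sub>0" using n[of x] by (auto simp: complex_nonpos_Reals_iff cmod_def power2_eq_1_iff)
  qed
  have c2: "continuous_on (- U) (\<lambda>x. pi + Im (Ln (- u x)))"
  proof (intro continuous_intros continuous_on_apply_bcontfun)
    fix x assume "x \<in> - U"
    then have *: "\<not> Re (u x) \<ge> (1/2)" using U(3) by blast
    show "- u x \<notin> \<real>\<^sub>\<le>\<^sub>0"
    proof
      assume "- u x \<in> \<real>\<^sub>\<le>\<^sub>0"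
      then have "Im (u x) = 0" "Re (u x) \<ge> 0" by (auto simp: complex_nonpos_Reals_iff)
      then show False using n[of x] * by (simp add: cmod_def power2_eq_1_iff)
    qed
  qed
  have "continuous_on (U \<union> - U) h"
    unfolding h_def[abs_def]
    by (rule continuous_on_cases) (use U c1 c2 in \<open>auto simp: closed_Compl\<close>)
  then have "continuous_on UNIV h" by simp
  moreover have bd: "norm (h x) \<le> 2 * pi" for x
  proof -
    have "u x \<noteq> 0" using n[of x] by auto
    then show ?thesis
      using mpi_less_Im_Ln[of "u x"] Im_Ln_le_pi[of "u x"] mpi_less_Im_Ln[of "- u x"] Im_Ln_le_pi[of "- u x"]
        pi_gt_zero by (simp add: h_def abs_if)
  qed
  ultimately have "h \<in> bcontfun" by (rule bcontfun_normI)
  then obtain h' where h': "h = apply_bcontfun h'" by (metis bcontfunE)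
  have cisLn: "cis (Im (Ln z)) = z" if "norm z = 1" for z
  proof -
    have "z \<noteq> 0" using that by auto
    then have "z = exp (Ln z)" by simp
    also have "\<dots> = exp (Re (Ln z)) * cis (Im (Ln z))" by (rule exp_eq_polar)
    finally show ?thesis using that \<open>z \<noteq> 0\<close> by (simp add: Re_Ln)
  qed
  have "cis (h x) = u x" for x
    using cisLn[of "u x"] cisLn[of "- u x"] n[of x] by (simp add: h_def flip: cis_mult)
  then have "u = cis_bcontfun h'" by (intro bcontfun_eqI) (simp flip: h')
  moreover have "norm h' \<le> 2 * pi" using bd by (simp add: norm_le_bcontfun_iff h')
  ultimately show thesis by (rule that)
qed

section \<open>Extension of homomorphisms into real vector spaces\<close>

text \<open>The graph of a homomorphism from a subgroup. As a set of pairs it is ordered by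
  inclusion, ready for Zorn's lemma; single-valuedness is reduced to the last clause, the value at
  the identity.\<close>

definition partial_hom :: "('g, 'm) monoid_scheme \<Rightarrow> ('g \<times> 'w::real_vector) set \<Rightarrow> bool" where
  "partial_hom G R \<longleftrightarrow> R \<subseteq> carrier G \<times> UNIV \<and> (\<one>\<^bsub>G\<^esub>, 0) \<in> R \<and>
     (\<forall>x v y w. (x, v) \<in> R \<longrightarrow> (y, w) \<in> R \<longrightarrow> (x \<otimes>\<^bsub>G\<^esub> y, v + w) \<in> R) \<and>
     (\<forall>x v. (x, v) \<in> R \<longrightarrow> (inv\<^bsub>G\<^esub> x, - v) \<in> R) \<and>
     (\<forall>v. (\<one>\<^bsub>G\<^esub>, v) \<in> R \<longrightarrow> v = 0)"

lemma (in group) partial_homD: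
  assumes "partial_hom G R"
  shows "(x, v) \<in> R \<Longrightarrow> x \<in> carrier G"
    and "(\<one>, 0) \<in> R"
    and "(x, v) \<in> R \<Longrightarrow> (y, w) \<in> R \<Longrightarrow> (x \<otimes> y, v + w) \<in> R"
    and "(x, v) \<in> R \<Longrightarrow> (inv x, - v) \<in> R"
    and "(\<one>, v) \<in> R \<Longrightarrow> v = 0"
  using assms unfolding partial_hom_def by blast+

lemma (in group) partial_hom_unique:
  assumes "partial_hom G R" "(x, v) \<in> R" "(x, w) \<in> R"
  shows "v = w"
proof -
  note R = partial_homD[OF assms(1)]
  have "(x \<otimes> inv x, v + - w) \<in> R" by (intro R assms)
  then show ?thesis using R(1)[OF assms(2)] R(5)[of "v - w"] by simp
qed

lemma (in group) partial_hom_int_pow: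
  assumes "partial_hom G R" "(x, v) \<in> R"
  shows "(x [^] (k::int), of_int k *\<^sub>R v) \<in> R"
proof -
  note R = partial_homD[OF assms(1)]
  note x = R(1)[OF assms(2)]
  have nat: "(x [^] int n, of_nat n *\<^sub>R v) \<in> R" for n
  proof (induction n)
    case (Suc n)
    have "x [^] int (Suc n) = x [^] int n \<otimes> x" by (simp only: int_pow_int nat_pow_Suc)
    with R(3)[OF Suc assms(2)] show ?case by (simp add: scaleR_add_left add.commute)
  qed (use R(2) in simp)
  show ?thesis
  proof (cases k)
    case (nonneg n)
    then show ?thesis using nat[of n] by simp
  next
    case (neg n)
    have "of_int k *\<^sub>R v = - (of_nat (Suc n) *\<^sub>R v)" by (simp add: neg algebra_simps)
    then show ?thesis
      using R(4)[OF nat[of "Suc n"]] int_pow_neg[OF x, of "int (Suc n)"] by (simp only: neg)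
  qed
qed

text \<open>The value \<open>w\<close> of the new element \<open>g\<close> must agree with what is
  already prescribed on powers of \<open>g\<close>. If a power with exponent
  \<open>n \<noteq> 0\<close> has the value \<open>v0\<close>, then \<open>w\<close> is
  \<open>v0\<close> divided by \<open>n\<close>, and this is where divisibility enters; otherwise
  nothing is prescribed and 0 will do.\<close>

lemma (in comm_group) partial_hom_extend:
  fixes R :: "('a \<times> 'w::real_vector) set"
  assumes R: "partial_hom G R" and g: "g \<in> carrier G"
  obtains R' w where "partial_hom G R'" "R \<subseteq> R'" "(g, w) \<in> R'"
proof -
  note D = partial_homD[OF R]
  note pow = partial_hom_int_pow[OF R]
  obtain w where w: "\<And>k v. (g [^] (k::int), v) \<in> R \<Longrightarrow> v = of_int k *\<^sub>R w"
  proof (cases "\<exists>n v. n \<noteq> (0::int) \<and> (g [^] n, v) \<in> R")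
    case True
    then obtain n :: int and v0 where n: "n \<noteq> 0" "(g [^] n, v0) \<in> R" by blast
    show ?thesis
    proof (rule that)
      fix k :: int and v
      assume k: "(g [^] k, v) \<in> R"
      have "of_int n *\<^sub>R v = of_int k *\<^sub>R v0"
        using partial_hom_unique[OF R] pow[OF k, of n] pow[OF n(2), of k] g
        by (simp add: int_pow_pow mult.commute)
      then have "v = inverse (of_int n) *\<^sub>R (of_int k *\<^sub>R v0)"
        using n(1) by (metis of_int_eq_0_iff scaleR_left_imp_eq scaleR_scaleR right_inverse scaleR_one)
      then show "v = of_int k *\<^sub>R (inverse (of_int n) *\<^sub>R v0)" by (simp add: mult.commute)
    qed
  next
    case False
    then have "k = 0" if "(g [^] k, v) \<in> R" for k :: int and v using that by blast
    then show ?thesis using D(5) that[of 0] by (metis int_pow_0 scaleR_zero_right)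
  qed
  define R' where "R' = {(x \<otimes> g [^] (k::int), v + of_int k *\<^sub>R w) | x v k. (x, v) \<in> R}"
  have "partial_hom G R'"
    unfolding partial_hom_def
  proof (intro conjI allI impI)
    show "R' \<subseteq> carrier G \<times> UNIV" using D(1) g by (auto simp: R'_def)
    show "(\<one>, 0) \<in> R'" unfolding R'_def using D(2) by (auto intro!: exI[of _ "0::int"] exI[of _ \<one>])
  next
    fix x v y u assume "(x, v) \<in> R'" "(y, u) \<in> R'"
    then obtain x' v' k y' u' l where *: "(x', v') \<in> R" "(y', u') \<in> R"
      "x = x' \<otimes> g [^] (k::int)" "v = v' + of_int k *\<^sub>R w" "y = y' \<otimes> g [^] (l::int)" "u = u' + of_int l *\<^sub>R w"
      unfolding R'_def by blast
    have "x \<otimes> y = (x' \<otimes> y') \<otimes> g [^] (k + l)"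
      using D(1) * g by (simp add: int_pow_mult m_ac)
    moreover have "v + u = (v' + u') + of_int (k + l) *\<^sub>R w"
      using * by (simp add: scaleR_add_left)
    ultimately show "(x \<otimes> y, v + u) \<in> R'" unfolding R'_def using D(3)[OF *(1,2)] by blast
  next
    fix x v assume "(x, v) \<in> R'"
    then obtain x' v' k where *: "(x', v') \<in> R" "x = x' \<otimes> g [^] (k::int)" "v = v' + of_int k *\<^sub>R w"
      unfolding R'_def by blast
    have "inv x = inv x' \<otimes> g [^] (- k)"
      using D(1)[OF *(1)] * g by (simp add: int_pow_neg inv_mult)
    moreover have "- v = - v' + of_int (- k) *\<^sub>R w" using * by simp
    ultimately show "(inv x, - v) \<in> R'" unfolding R'_def using D(4)[OF *(1)] by blast
  next
    fix v assume "(\<one>, v) \<in> R'"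
    then obtain x' v' k where *: "(x', v') \<in> R" "\<one> = x' \<otimes> g [^] (k::int)" "v = v' + of_int k *\<^sub>R w"
      unfolding R'_def by blast
    note x' = D(1)[OF *(1)]
    \<comment> \<open>A relation between the old domain and the powers of \<open>g\<close> puts a
      power of \<open>g\<close> into the old domain, where \<open>w\<close> already gives the right
      value.\<close>
    have "inv (g [^] k) = x'" using *(2) x' g by (intro inv_equality) auto
    then have "x' = g [^] (- k)" using g by (simp add: int_pow_neg)
    then show "v = 0" using w[of "- k" v'] * by simp
  qed
  moreover have "R \<subseteq> R'"
  proof
    fix p assume "p \<in> R"
    then show "p \<in> R'" using D(1)
      unfolding R'_def by (cases p) (auto intro!: exI[of _ "0::int"] exI[of _ "fst p"])
  qed
  moreover have "(g, w) \<in> R'"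
    unfolding R'_def using D(2) g by (auto intro!: exI[of _ "1::int"] exI[of _ \<one>] exI[of _ "0::'w"])
  ultimately show thesis by (rule that)
qed

text \<open>Real vector spaces are divisible, hence injective as abelian groups.\<close>

lemma (in comm_group) extend_hom_to_real_vector:
  fixes r\<^sub>0 :: "'a \<Rightarrow> 'w::real_vector"
  assumes H: "subgroup H G" and r0: "\<And>x y. x \<in> H \<Longrightarrow> y \<in> H \<Longrightarrow> r\<^sub>0 (x \<otimes> y) = r\<^sub>0 x + r\<^sub>0 y"
  obtains r where "\<And>x y. x \<in> carrier G \<Longrightarrow> y \<in> carrier G \<Longrightarrow> r (x \<otimes> y) = r x + r y"
    and "\<And>x. x \<in> H \<Longrightarrow> r x = r\<^sub>0 x"
proof -
  define R0 where "R0 = {(x, r\<^sub>0 x) | x. x \<in> H}"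
  define \<A> where "\<A> = {R. partial_hom G R \<and> R0 \<subseteq> R}"
  interpret H: subgroup H G by (rule H)
  have one0: "r\<^sub>0 \<one> = 0" using r0[of \<one> \<one>] by simp
  have inv0: "r\<^sub>0 (inv x) = - r\<^sub>0 x" if "x \<in> H" for x
    using r0[of x "inv x"] that one0 H.mem_carrier[OF that] by (simp add: eq_neg_iff_add_eq_0 add.commute)
  have "R0 \<in> \<A>"
    unfolding \<A>_def partial_hom_def R0_def using one0 inv0 r0 H.mem_carrier by auto
  have "\<exists>M\<in>\<A>. \<forall>X\<in>\<A>. M \<subseteq> X \<longrightarrow> X = M"
  proof (rule subset_Zorn_nonempty)
    show "\<A> \<noteq> {}" using \<open>R0 \<in> \<A>\<close> by blast
  next
    fix \<C> assume \<C>: "\<C> \<noteq> {}" "subset.chain \<A> \<C>"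
    then have sub: "\<And>X. X \<in> \<C> \<Longrightarrow> partial_hom G X \<and> R0 \<subseteq> X"
      and lin: "\<And>X Y. X \<in> \<C> \<Longrightarrow> Y \<in> \<C> \<Longrightarrow> X \<subseteq> Y \<or> Y \<subseteq> X"
      unfolding subset.chain_def \<A>_def by blast+
    have "partial_hom G (\<Union>\<C>)"
      unfolding partial_hom_def
    proof (intro conjI allI impI)
      show "\<Union>\<C> \<subseteq> carrier G \<times> UNIV" using sub by (auto dest: partial_homD(1))
      show "(\<one>, 0) \<in> \<Union>\<C>" using sub \<C>(1) partial_homD(2) by blast
    next
      fix x v y w assume "(x, v) \<in> \<Union>\<C>" "(y, w) \<in> \<Union>\<C>"
      then obtain X Y where XY: "X \<in> \<C>" "Y \<in> \<C>" "(x, v) \<in> X" "(y, w) \<in> Y" by blast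
      then obtain Z where "Z \<in> \<C>" "(x, v) \<in> Z" "(y, w) \<in> Z" using lin[OF XY(1,2)] by blast
      then show "(x \<otimes> y, v + w) \<in> \<Union>\<C>" using sub partial_homD(3) by blast
    next
      fix x v assume "(x, v) \<in> \<Union>\<C>"
      then show "(inv x, - v) \<in> \<Union>\<C>" using sub partial_homD(4) by blast
    next
      fix v assume "(\<one>, v) \<in> \<Union>\<C>"
      then show "v = 0" using sub partial_homD(5) by blast
    qed
    then show "\<Union>\<C> \<in> \<A>" using sub \<C>(1) by (auto simp: \<A>_def)
  qed
  then obtain M where "M \<in> \<A>" and max\<A>: "\<forall>X\<in>\<A>. M \<subseteq> X \<longrightarrow> X = M" by (elim bexE)
  then have M: "partial_hom G M" "R0 \<subseteq> M" by (simp_all add: \<A>_def)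
  have max: "X = M" if "partial_hom G X" "M \<subseteq> X" for X
    using max\<A> that M(2) by (simp add: \<A>_def)
  have total: "\<exists>w. (x, w) \<in> M" if x: "x \<in> carrier G" for x
  proof -
    obtain R' w where R': "partial_hom G R'" "M \<subseteq> R'" "(x, w) \<in> R'"
      using partial_hom_extend[OF M(1) x] by metis
    then show ?thesis using max[OF R'(1,2)] by blast
  qed
  define r where "r x = (THE w. (x, w) \<in> M)" for x
  have rI: "r x = w" if "(x, w) \<in> M" for x w
    unfolding r_def using that partial_hom_unique[OF M(1)] by blast
  show thesis
  proof (rule that)
    fix x y assume xy: "x \<in> carrier G" "y \<in> carrier G"
    then obtain v w where "(x, v) \<in> M" "(y, w) \<in> M" using total by blast
    then show "r (x \<otimes> y) = r x + r y"
      using rI partial_homD(3)[OF M(1)] by metis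
  next
    fix x assume "x \<in> H"
    then show "r x = r\<^sub>0 x" using M(2) by (intro rI) (auto simp: R0_def)
  qed
qed

section \<open>A cotype inequality\<close>

text \<open>With \<open>S\<close> inverse to \<open>T\<close>, a self-adjoint contraction on the
  real functions over a finite set permuted by both.\<close>

definition avg :: "('a \<Rightarrow> 'a) \<Rightarrow> ('a \<Rightarrow> 'a) \<Rightarrow> ('a \<Rightarrow> real) \<Rightarrow> 'a \<Rightarrow> real" where
  "avg T S f x = (f (T x) + f (S x)) / 2"

definition sqnorm :: "'a set \<Rightarrow> ('a \<Rightarrow> real) \<Rightarrow> real" where
  "sqnorm \<Omega> f = (\<Sum>x\<in>\<Omega>. (f x)\<^sup>2)"

lemma sqnorm_compose_bij: "bij_betw T \<Omega> \<Omega> \<Longrightarrow> sqnorm \<Omega> (\<lambda>x. f (T x)) = sqnorm \<Omega> f"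
  unfolding sqnorm_def by (rule sum.reindex_bij_betw)

lemma square_add3_le: "(a + b + c)\<^sup>2 \<le> 3 * (a\<^sup>2 + b\<^sup>2 + c\<^sup>2)" for a b c :: real
proof -
  have "3 * (a\<^sup>2 + b\<^sup>2 + c\<^sup>2) - (a + b + c)\<^sup>2 = (a - b)\<^sup>2 + (b - c)\<^sup>2 + (a - c)\<^sup>2"
    by (simp add: power2_eq_square algebra_simps)
  then show ?thesis by (smt (verit) zero_le_power2)
qed

text \<open>The intended model is a discrete torus: \<open>T j\<close> is one step in direction
  \<open>j\<close>, \<open>S j\<close> the step back, and \<open>n\<close> the number of directions
  in play.\<close>

locale commuting_bijections =
  fixes \<Omega> :: "'a set" and T S :: "nat \<Rightarrow> 'a \<Rightarrow> 'a" and n :: nat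
  assumes fin: "finite \<Omega>"
    and T_in: "\<And>j x. x \<in> \<Omega> \<Longrightarrow> T j x \<in> \<Omega>" and S_in: "\<And>j x. x \<in> \<Omega> \<Longrightarrow> S j x \<in> \<Omega>"
    and TS: "\<And>j x. x \<in> \<Omega> \<Longrightarrow> T j (S j x) = x" and ST: "\<And>j x. x \<in> \<Omega> \<Longrightarrow> S j (T j x) = x"
    and TT: "\<And>i j x. x \<in> \<Omega> \<Longrightarrow> T i (T j x) = T j (T i x)"
begin

lemma bij_T: "bij_betw (T j) \<Omega> \<Omega>"
  by (rule bij_betwI[where g = "S j"]) (auto simp: T_in S_in TS ST)

lemma bij_S: "bij_betw (S j) \<Omega> \<Omega>"
  by (rule bij_betwI[where g = "T j"]) (auto simp: T_in S_in TS ST)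

lemma TSc: "x \<in> \<Omega> \<Longrightarrow> T i (S j x) = S j (T i x)"
  by (metis S_in ST T_in TS TT)

fun P :: "nat \<Rightarrow> ('a \<Rightarrow> real) \<Rightarrow> 'a \<Rightarrow> real" where
  "P 0 f = f"
| "P (Suc k) f = avg (T k) (S k) (P k f)"

text \<open>All \<open>2 ^ k\<close> choices of one step forward or back in each of the directions
  below \<open>k\<close>; \<open>P k\<close> is the mean over them.\<close>

fun walks :: "nat \<Rightarrow> ('a \<Rightarrow> 'a) list" where
  "walks 0 = [id]"
| "walks (Suc k) = map (\<lambda>w. w \<circ> T k) (walks k) @ map (\<lambda>w. w \<circ> S k) (walks k)"

lemma length_walks: "length (walks k) = 2 ^ k"
  by (induction k) auto

lemma walks_bij: "w \<in> set (walks k) \<Longrightarrow> bij_betw w \<Omega> \<Omega>"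
proof (induction k arbitrary: w)
  case (Suc k)
  then show ?case by (auto intro: bij_betw_trans bij_T bij_S)
qed auto

lemma P_eq: "P k f x = (\<Sum>w\<leftarrow>walks k. f (w x)) / 2 ^ k"
  by (induction k arbitrary: x) (simp_all add: avg_def o_def field_simps)

definition energy :: "('a \<Rightarrow> real) \<Rightarrow> real" where
  "energy f = (\<Sum>w\<leftarrow>walks n. sqnorm \<Omega> (\<lambda>x. f (w x) - f x)) / 2 ^ n"

text \<open>The parallelogram identity for the forward and backward shifts of \<open>P k f\<close>,
  which have equal norm because the shifts permute \<open>\<Omega>\<close>. The loss of norm under
  an average is thus exactly a quarter of the squared increment over a double step, which makes the
  later sum telescope.\<close>

lemma sqnorm_P_eq: "sqnorm \<Omega> (P (Suc k) f) = sqnorm \<Omega> (P k f) - sqnorm \<Omega> (\<lambda>x. P k f (T k (T k x)) - P k f x) / 4"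
proof -
  let ?g = "P k f"
  have "sqnorm \<Omega> (P (Suc k) f) + sqnorm \<Omega> (\<lambda>x. ?g (T k x) - ?g (S k x)) / 4
      = (sqnorm \<Omega> (\<lambda>x. ?g (T k x)) + sqnorm \<Omega> (\<lambda>x. ?g (S k x))) / 2"
    unfolding sqnorm_def
    by (simp add: avg_def sum.distrib[symmetric] sum_divide_distrib)
      (rule sum.cong, simp_all add: power2_eq_square field_simps)
  also have "\<dots> = sqnorm \<Omega> ?g"
    by (simp add: sqnorm_compose_bij[OF bij_T] sqnorm_compose_bij[OF bij_S])
  also have "sqnorm \<Omega> (\<lambda>x. ?g (T k x) - ?g (S k x)) = sqnorm \<Omega> (\<lambda>x. ?g (T k (T k x)) - ?g x)"
    using sqnorm_compose_bij[OF bij_T[of k], of "\<lambda>x. ?g (T k x) - ?g (S k x)"]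
    by (simp add: sqnorm_def ST)
  finally show ?thesis by simp
qed

lemma sqnorm_avg_le: "sqnorm \<Omega> (avg (T k) (S k) g) \<le> sqnorm \<Omega> g"
proof -
  have "sqnorm \<Omega> (avg (T k) (S k) g) \<le> (sqnorm \<Omega> (\<lambda>x. g (T k x)) + sqnorm \<Omega> (\<lambda>x. g (S k x))) / 2"
    unfolding sqnorm_def avg_def sum.distrib[symmetric] sum_divide_distrib
  proof (rule sum_mono)
    fix x
    have "((g (T k x))\<^sup>2 + (g (S k x))\<^sup>2) / 2 - ((g (T k x) + g (S k x)) / 2)\<^sup>2 = ((g (T k x) - g (S k x)) / 2)\<^sup>2"
      by (simp add: power2_eq_square field_simps)
    then show "((g (T k x) + g (S k x)) / 2)\<^sup>2 \<le> ((g (T k x))\<^sup>2 + (g (S k x))\<^sup>2) / 2"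
      by (smt (verit) zero_le_power2)
  qed
  then show ?thesis by (simp add: sqnorm_compose_bij[OF bij_T] sqnorm_compose_bij[OF bij_S])
qed

text \<open>A further average commutes with the double step and contracts the norm.\<close>

lemma sqnorm_P_shift_le:
  assumes "k \<le> l"
  shows "sqnorm \<Omega> (\<lambda>x. P l f (T j (T j x)) - P l f x) \<le> sqnorm \<Omega> (\<lambda>x. P k f (T j (T j x)) - P k f x)"
  using assms
proof (induction rule: dec_induct)
  case (step l)
  have "sqnorm \<Omega> (\<lambda>x. P (Suc l) f (T j (T j x)) - P (Suc l) f x)
      = sqnorm \<Omega> (avg (T l) (S l) (\<lambda>x. P l f (T j (T j x)) - P l f x))"
    unfolding sqnorm_def
  proof (intro sum.cong refl arg_cong[where f = "\<lambda>z::real. z\<^sup>2"])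
    fix x assume "x \<in> \<Omega>"
    then show "P (Suc l) f (T j (T j x)) - P (Suc l) f x = avg (T l) (S l) (\<lambda>x. P l f (T j (T j x)) - P l f x) x"
      by (simp add: avg_def TT[of _ l] TSc[symmetric] T_in S_in field_simps)
  qed
  also have "\<dots> \<le> sqnorm \<Omega> (\<lambda>x. P l f (T j (T j x)) - P l f x)" by (rule sqnorm_avg_le)
  finally show ?case using step.IH by simp
qed simp

text \<open>In the term for direction \<open>j\<close> the full product \<open>P n f\<close> is
  traded for the partial product \<open>P j f\<close>; the term then becomes four times the loss of
  norm at stage \<open>j\<close>.\<close>

lemma sum_sqnorm_P_shift_le:
  "(\<Sum>j<n. sqnorm \<Omega> (\<lambda>x. P n f (T j (T j x)) - P n f x)) \<le> 4 * (sqnorm \<Omega> f - sqnorm \<Omega> (P n f))"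
proof -
  have "(\<Sum>j<n. sqnorm \<Omega> (\<lambda>x. P n f (T j (T j x)) - P n f x))
      \<le> (\<Sum>j<n. sqnorm \<Omega> (\<lambda>x. P j f (T j (T j x)) - P j f x))"
    by (intro sum_mono sqnorm_P_shift_le) auto
  also have "\<dots> = (\<Sum>j<n. 4 * sqnorm \<Omega> (P j f) - 4 * sqnorm \<Omega> (P (Suc j) f))"
    by (intro sum.cong refl) (simp add: sqnorm_P_eq del: P.simps)
  also have "\<dots> = 4 * (sqnorm \<Omega> f - sqnorm \<Omega> (P n f))"
    using sum_lessThan_telescope'[of "\<lambda>j. 4 * sqnorm \<Omega> (P j f)" n] by simp
  finally show ?thesis .
qed

text \<open>\<open>P n f\<close> is a mean over walks, so this is Jensen's inequality for the
  square.\<close>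

lemma sqnorm_diff_P_le: "sqnorm \<Omega> (\<lambda>x. f x - P n f x) \<le> energy f"
proof -
  let ?W = "walks n" and ?N = "2 ^ n :: real"
  have len: "real (length ?W) = ?N" by (simp add: length_walks)
  have jensen: "(f x - P n f x)\<^sup>2 \<le> (\<Sum>w\<leftarrow>?W. (f (w x) - f x)\<^sup>2) / ?N" for x
  proof -
    have J: "(\<Sum>w\<leftarrow>W. a w)\<^sup>2 \<le> real (length W) * (\<Sum>w\<leftarrow>W. (a w)\<^sup>2)" for W :: "('a \<Rightarrow> 'a) list" and a
      using sum_squared_le_sum_of_squares[of "\<lambda>i. a (W ! i)" "{..<length W}"]
      by (simp add: sum_list_sum_nth atLeast0LessThan mult.commute)
    have "f x - P n f x = - (\<Sum>w\<leftarrow>?W. f (w x) - f x) / ?N"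
      using len by (simp add: P_eq sum_list_subtractf sum_list_const_mult sum_list_triv field_simps)
    then have "(f x - P n f x)\<^sup>2 = (\<Sum>w\<leftarrow>?W. f (w x) - f x)\<^sup>2 / ?N\<^sup>2"
      by (simp add: power_divide)
    also have "\<dots> \<le> (?N * (\<Sum>w\<leftarrow>?W. (f (w x) - f x)\<^sup>2)) / ?N\<^sup>2"
      using J[of "\<lambda>w. f (w x) - f x" ?W] len by (simp add: divide_right_mono)
    also have "\<dots> = (\<Sum>w\<leftarrow>?W. (f (w x) - f x)\<^sup>2) / ?N" by (simp add: power2_eq_square)
    finally show ?thesis .
  qed
  have swap: "(\<Sum>x\<in>\<Omega>. \<Sum>w\<leftarrow>W. b w x) = (\<Sum>w\<leftarrow>W. \<Sum>x\<in>\<Omega>. b w x)" for W :: "('a \<Rightarrow> 'a) list" and b :: "_ \<Rightarrow> _ \<Rightarrow> real"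
    by (induction W) (simp_all add: sum.distrib)
  have "sqnorm \<Omega> (\<lambda>x. f x - P n f x) \<le> (\<Sum>x\<in>\<Omega>. (\<Sum>w\<leftarrow>?W. (f (w x) - f x)\<^sup>2) / ?N)"
    unfolding sqnorm_def by (intro sum_mono jensen)
  also have "\<dots> = energy f"
    by (simp add: energy_def sqnorm_def swap flip: sum_divide_distrib)
  finally show ?thesis .
qed

text \<open>Walks preserve \<open>sqnorm\<close>, so \<open>energy f\<close> is twice
  \<open>sqnorm \<Omega> f\<close> minus twice the inner product of \<open>f\<close> and
  \<open>P n f\<close>. Nonnegativity of the squared norm of \<open>f - P n f\<close> bounds that
  inner product.\<close>

lemma sqnorm_minus_sqnorm_P_le: "sqnorm \<Omega> f - sqnorm \<Omega> (P n f) \<le> energy f"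
proof -
  let ?W = "walks n" and ?N = "2 ^ n :: real"
  have len: "real (length ?W) = ?N" by (simp add: length_walks)
  have swap: "(\<Sum>x\<in>\<Omega>. \<Sum>w\<leftarrow>W. b w x) = (\<Sum>w\<leftarrow>W. \<Sum>x\<in>\<Omega>. b w x)" for W :: "('a \<Rightarrow> 'a) list" and b :: "_ \<Rightarrow> _ \<Rightarrow> real"
    by (induction W) (simp_all add: sum.distrib)
  have w: "sqnorm \<Omega> (\<lambda>x. f (w x) - f x) = 2 * sqnorm \<Omega> f - 2 * (\<Sum>x\<in>\<Omega>. f x * f (w x))" if "w \<in> set ?W" for w
  proof -
    have "sqnorm \<Omega> (\<lambda>x. f (w x) - f x) = sqnorm \<Omega> (\<lambda>x. f (w x)) + sqnorm \<Omega> f - 2 * (\<Sum>x\<in>\<Omega>. f x * f (w x))"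
      unfolding sqnorm_def by (simp add: power2_diff sum.distrib sum_subtractf sum_distrib_left algebra_simps)
    then show ?thesis by (simp add: sqnorm_compose_bij[OF walks_bij[OF that]])
  qed
  have "(\<Sum>w\<leftarrow>?W. sqnorm \<Omega> (\<lambda>x. f (w x) - f x)) = (\<Sum>w\<leftarrow>?W. 2 * sqnorm \<Omega> f - 2 * (\<Sum>x\<in>\<Omega>. f x * f (w x)))"
    using w by (simp cong: map_cong)
  also have "\<dots> = ?N * (2 * sqnorm \<Omega> f) - 2 * (\<Sum>w\<leftarrow>?W. \<Sum>x\<in>\<Omega>. f x * f (w x))"
    using len by (simp add: sum_list_subtractf sum_list_const_mult sum_list_triv)
  also have "(\<Sum>w\<leftarrow>?W. \<Sum>x\<in>\<Omega>. f x * f (w x)) = ?N * (\<Sum>x\<in>\<Omega>. f x * P n f x)"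
    by (simp add: swap[symmetric] P_eq sum_list_const_mult sum_distrib_left)
  finally have E: "energy f = 2 * sqnorm \<Omega> f - 2 * (\<Sum>x\<in>\<Omega>. f x * P n f x)"
    by (simp add: energy_def field_simps)
  have "0 \<le> (\<Sum>x\<in>\<Omega>. (f x - P n f x)\<^sup>2)" by (simp add: sum_nonneg)
  also have "\<dots> = sqnorm \<Omega> f + sqnorm \<Omega> (P n f) - 2 * (\<Sum>x\<in>\<Omega>. f x * P n f x)"
    unfolding sqnorm_def by (simp add: power2_diff sum.distrib sum_subtractf sum_distrib_left algebra_simps)
  finally show ?thesis using E by simp
qed

text \<open>The path consists of \<open>m\<close> double steps whose increments all have the same
  norm; Cauchy-Schwarz supplies one factor \<open>m\<close> and their number the other.\<close>

lemma sqnorm_funpow_le: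
  "sqnorm \<Omega> (\<lambda>x. g (((T j) ^^ (2 * m)) x) - g x) \<le> (real m)\<^sup>2 * sqnorm \<Omega> (\<lambda>x. g (T j (T j x)) - g x)"
proof -
  let ?U = "\<lambda>x. T j (T j x)"
  have U: "((T j) ^^ (2 * i)) x = (?U ^^ i) x" for i x
    by (induction i arbitrary: x) (simp_all add: funpow_swap1)
  have bij: "bij_betw (?U ^^ i) \<Omega> \<Omega>" for i
  proof (induction i)
    case (Suc i)
    have "bij_betw ?U \<Omega> \<Omega>" using bij_betw_trans[OF bij_T bij_T, of j j] by (simp add: o_def)
    from bij_betw_trans[OF Suc this] show ?case by (simp add: o_def)
  qed (simp add: bij_betw_def)
  have "(g ((?U ^^ m) x) - g x)\<^sup>2 \<le> real m * (\<Sum>i<m. (g ((?U ^^ Suc i) x) - g ((?U ^^ i) x))\<^sup>2)" for x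
    using sum_squared_le_sum_of_squares[of "\<lambda>i. g ((?U ^^ Suc i) x) - g ((?U ^^ i) x)" "{..<m}"]
      sum_lessThan_telescope[of "\<lambda>i. g ((?U ^^ i) x)" m] by (simp add: mult.commute)
  then have "sqnorm \<Omega> (\<lambda>x. g ((?U ^^ m) x) - g x)
      \<le> (\<Sum>x\<in>\<Omega>. real m * (\<Sum>i<m. (g ((?U ^^ Suc i) x) - g ((?U ^^ i) x))\<^sup>2))"
    unfolding sqnorm_def by (intro sum_mono) auto
  also have "\<dots> = real m * (\<Sum>i<m. sqnorm \<Omega> (\<lambda>x. g (?U ((?U ^^ i) x)) - g ((?U ^^ i) x)))"
    unfolding sqnorm_def sum_distrib_left[symmetric] by (subst sum.swap) simp
  also have "\<dots> = real m * (\<Sum>i<m. sqnorm \<Omega> (\<lambda>x. g (?U x) - g x))"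
    using sqnorm_compose_bij[OF bij, of "\<lambda>x. g (?U x) - g x"] by simp
  finally show ?thesis by (simp add: U power2_eq_square)
qed

text \<open>A discrete form of the metric cotype inequality of Mendel and Naor for exponent 2. The
  operators \<open>1 - P\<^sub>j\<^sup>2\<close> telescope along the partial products of the averages \<open>P\<^sub>j\<close>, which replaces
  the Fourier transform on the torus.\<close>

lemma cotype_inequality:
  "(\<Sum>j<n. sqnorm \<Omega> (\<lambda>x. f (((T j) ^^ (2 * m)) x) - f x)) \<le> (6 * real n + 12 * (real m)\<^sup>2) * energy f"
proof -
  let ?g = "P n f"
  let ?V = "\<lambda>j x. ((T j) ^^ (2 * m)) x"
  have bijV: "bij_betw (?V j) \<Omega> \<Omega>" for j
  proof -
    have "bij_betw (T j ^^ i) \<Omega> \<Omega>" for i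
    proof (induction i)
      case (Suc i)
      from bij_betw_trans[OF this bij_T] show ?case by (simp add: o_def)
    qed (simp add: bij_betw_def)
    then show ?thesis .
  qed
  \<comment> \<open>Replacing \<open>f\<close> by its average at either end of the path costs at
    most \<open>energy f\<close>; with the factor 3 from squaring a sum of three terms, the two ends
    together give 6.\<close>
  have "sqnorm \<Omega> (\<lambda>x. f (?V j x) - f x)
      \<le> 6 * energy f + 3 * (real m)\<^sup>2 * sqnorm \<Omega> (\<lambda>x. ?g (T j (T j x)) - ?g x)" for j
  proof -
    have "(f (?V j x) - f x)\<^sup>2 \<le> 3 * ((f (?V j x) - ?g (?V j x))\<^sup>2 + (?g (?V j x) - ?g x)\<^sup>2 + (f x - ?g x)\<^sup>2)" for x
      using square_add3_le[of "f (?V j x) - ?g (?V j x)" "?g (?V j x) - ?g x" "?g x - f x"]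
      by (simp add: power2_commute)
    then have "sqnorm \<Omega> (\<lambda>x. f (?V j x) - f x) \<le> 3 * (sqnorm \<Omega> (\<lambda>x. f (?V j x) - ?g (?V j x))
       + sqnorm \<Omega> (\<lambda>x. ?g (?V j x) - ?g x) + sqnorm \<Omega> (\<lambda>x. f x - ?g x))"
      unfolding sqnorm_def sum.distrib[symmetric] sum_distrib_left by (intro sum_mono) auto
    also have "sqnorm \<Omega> (\<lambda>x. f (?V j x) - ?g (?V j x)) = sqnorm \<Omega> (\<lambda>x. f x - ?g x)"
      using sqnorm_compose_bij[OF bijV, of "\<lambda>x. f x - ?g x" j] .
    finally show ?thesis
      using sqnorm_diff_P_le[of f] mult_left_mono[OF sqnorm_funpow_le[of ?g m j], of 3] by simp
  qed
  then have "(\<Sum>j<n. sqnorm \<Omega> (\<lambda>x. f (?V j x) - f x))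
      \<le> (\<Sum>j<n. 6 * energy f + 3 * (real m)\<^sup>2 * sqnorm \<Omega> (\<lambda>x. ?g (T j (T j x)) - ?g x))"
    by (intro sum_mono)
  also have "\<dots> = 6 * real n * energy f + 3 * (real m)\<^sup>2 * (\<Sum>j<n. sqnorm \<Omega> (\<lambda>x. ?g (T j (T j x)) - ?g x))"
    by (simp add: sum.distrib sum_distrib_left)
  also have "\<dots> \<le> 6 * real n * energy f + 3 * (real m)\<^sup>2 * (4 * energy f)"
    using sum_sqnorm_P_shift_le[of f] sqnorm_minus_sqnorm_P_le[of f]
    by (intro add_left_mono mult_left_mono) auto
  finally show ?thesis by (simp add: algebra_simps)
qed

end

section \<open>Hilbert spaces\<close>

text \<open>A Cholesky decomposition: split off the normalised row of one point and factor the Schur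
  complement on the rest. It will turn vector-valued maps into finitely many real functions.\<close>

lemma psd_kernel_factorization:
  fixes k :: "'a \<Rightarrow> 'a \<Rightarrow> real"
  assumes "finite \<Omega>" and "\<And>x y. x \<in> \<Omega> \<Longrightarrow> y \<in> \<Omega> \<Longrightarrow> k x y = k y x"
    and "\<And>c. 0 \<le> (\<Sum>x\<in>\<Omega>. \<Sum>y\<in>\<Omega>. c x * c y * k x y)"
  shows "\<exists>gs. \<forall>x\<in>\<Omega>. \<forall>y\<in>\<Omega>. k x y = (\<Sum>g\<leftarrow>gs. g x * g y)"
  using assms
proof (induction \<Omega> arbitrary: k rule: finite_induct)
  case empty
  then show ?case by simp
next
  case (insert a \<Omega>)
  note sym = insert.prems(1)
  have expand: "(\<Sum>x\<in>insert a \<Omega>. \<Sum>y\<in>insert a \<Omega>. c x * c y * k x y) =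
      (c a)\<^sup>2 * k a a + 2 * c a * (\<Sum>y\<in>\<Omega>. c y * k a y) + (\<Sum>x\<in>\<Omega>. \<Sum>y\<in>\<Omega>. c x * c y * k x y)" for c
  proof -
    have "(\<Sum>x\<in>\<Omega>. c x * c a * k x a) = c a * (\<Sum>y\<in>\<Omega>. c y * k a y)"
      unfolding sum_distrib_left by (rule sum.cong) (use sym in auto)
    moreover have "(\<Sum>y\<in>\<Omega>. c a * c y * k a y) = c a * (\<Sum>y\<in>\<Omega>. c y * k a y)"
      by (simp add: sum_distrib_left mult.assoc)
    ultimately show ?thesis
      using insert.hyps by (simp add: sum.distrib power2_eq_square)
  qed
  have upd: "(\<Sum>y\<in>\<Omega>. (c(a := t)) y * h y) = (\<Sum>y\<in>\<Omega>. c y * h y)"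
    "(\<Sum>x\<in>\<Omega>. \<Sum>y\<in>\<Omega>. (c(a := t)) x * (c(a := t)) y * k x y) = (\<Sum>x\<in>\<Omega>. \<Sum>y\<in>\<Omega>. c x * c y * k x y)" for c t h
    using insert.hyps by (auto intro!: sum.cong)
  have psd: "0 \<le> t\<^sup>2 * k a a + 2 * t * (\<Sum>y\<in>\<Omega>. c y * k a y) + (\<Sum>x\<in>\<Omega>. \<Sum>y\<in>\<Omega>. c x * c y * k x y)" for c t
    using insert.prems(2)[of "c(a := t)"] unfolding expand upd by simp
  have kaa: "0 \<le> k a a" using psd[of 1 "\<lambda>_. 0"] by simp
  have zero: "(\<Sum>y\<in>\<Omega>. c y * k a y) = 0" if 0: "k a a = 0" for c
  proof (rule ccontr)
    let ?S = "\<Sum>y\<in>\<Omega>. c y * k a y" and ?Q = "\<Sum>x\<in>\<Omega>. \<Sum>y\<in>\<Omega>. c x * c y * k x y"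
    assume S: "?S \<noteq> 0"
    \<comment> \<open>With \<open>k a a = 0\<close> the form is affine in \<open>t\<close>; this
      \<open>t\<close> would give it the value \<open>-1\<close>.\<close>
    have "0 \<le> 2 * (- (?Q + 1) / (2 * ?S)) * ?S + ?Q"
      using psd[of "- (?Q + 1) / (2 * ?S)" c] 0 by simp
    moreover have "2 * (- (?Q + 1) / (2 * ?S)) * ?S = - (?Q + 1)" using S by simp
    ultimately show False by linarith
  qed
  have kzero: "k a x = 0" if "k a a = 0" "x \<in> \<Omega>" for x
  proof -
    have "(\<Sum>y\<in>\<Omega>. of_bool (y = x) * k a y) = (\<Sum>y\<in>\<Omega>. if y = x then k a y else 0)"
      by (intro sum.cong) auto
    then show ?thesis using zero[OF that(1), of "\<lambda>y. of_bool (y = x)"] that(2) insert.hyps(1) by simp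
  qed
  \<comment> \<open>If \<open>k a a = 0\<close>, division by zero makes \<open>g0\<close> vanish,
    which is correct because the row of \<open>a\<close> then vanishes by
    \<open>kzero\<close>.\<close>
  define g0 where "g0 x = k a x / sqrt (k a a)" for x
  have g0: "g0 x * g0 y = k a x * k a y / k a a" for x y
    using kaa by (simp add: g0_def)
  have "\<exists>gs. \<forall>x\<in>\<Omega>. \<forall>y\<in>\<Omega>. k x y - g0 x * g0 y = (\<Sum>g\<leftarrow>gs. g x * g y)"
  proof (rule insert.IH)
    show "k x y - g0 x * g0 y = k y x - g0 y * g0 x" if "x \<in> \<Omega>" "y \<in> \<Omega>" for x y
      using sym that by simp
    fix c
    let ?S = "\<Sum>y\<in>\<Omega>. c y * k a y" and ?Q = "\<Sum>x\<in>\<Omega>. \<Sum>y\<in>\<Omega>. c x * c y * k x y"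
    have "(\<Sum>x\<in>\<Omega>. \<Sum>y\<in>\<Omega>. c x * c y * (k x y - g0 x * g0 y)) = ?Q - ?S * ?S / k a a"
      unfolding g0 sum_product sum_divide_distrib sum_subtractf[symmetric]
      by (intro sum.cong refl) (simp add: algebra_simps)
    moreover have "0 \<le> ?Q - ?S * ?S / k a a"
    proof (cases "k a a = 0")
      case True
      then show ?thesis using psd[of 0 c] by simp
    next
      case False
      \<comment> \<open>The quadratic in \<open>t\<close> is evaluated at its minimum.\<close>
      then show ?thesis using psd[of "- ?S / k a a" c] by (simp add: power2_eq_square field_simps)
    qed
    ultimately show "0 \<le> (\<Sum>x\<in>\<Omega>. \<Sum>y\<in>\<Omega>. c x * c y * (k x y - g0 x * g0 y))" by simp
  qed
  then obtain gs where gs: "\<And>x y. x \<in> \<Omega> \<Longrightarrow> y \<in> \<Omega> \<Longrightarrow> k x y - g0 x * g0 y = (\<Sum>g\<leftarrow>gs. g x * g y)"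
    by blast
  have row: "k a y = g0 a * g0 y" if "y \<in> insert a \<Omega>" for y
    using that kzero by (auto simp: g0)
  \<comment> \<open>The row of \<open>a\<close> is accounted for by \<open>g0\<close> alone, so the
    other factors are set to 0 at \<open>a\<close>.\<close>
  let ?gs = "g0 # map (\<lambda>g. g(a := 0)) gs"
  have "k x y = (\<Sum>g\<leftarrow>?gs. g x * g y)" if "x \<in> insert a \<Omega>" "y \<in> insert a \<Omega>" for x y
  proof (cases "x = a \<or> y = a")
    case True
    then have "(\<Sum>g\<leftarrow>gs. (g(a := 0)) x * (g(a := 0)) y) = 0" by auto
    moreover have "k x y = g0 x * g0 y"
      using True that row sym by (metis insertI1 mult.commute)
    ultimately show ?thesis by (simp add: o_def)
  next
    case False
    then show ?thesis using gs[of x y] that by (simp add: o_def)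
  qed
  then show ?case by blast
qed

section \<open>Finite subsets of Hilbert spaces in real coordinates\<close>

context real_inner_product_space
begin

lemma hilbert_dist_square:
  assumes "x \<in> carrier V" "y \<in> carrier V"
  shows "(hilbert_dist V ip x y)\<^sup>2 = ip x x + ip y y - 2 * ip x y"
proof -
  have "x \<ominus> y = x \<oplus> (- 1) \<odot> y"
    using minus_eq_smult[OF assms(2)] by (simp add: a_minus_def)
  then show ?thesis
    using ip_square_add[OF assms, of "- 1"] ip_nonneg[of "x \<ominus> y"] assms M.minus_closed[of x y]
    by (simp add: hilbert_dist_def)
qed

lemma linear_combination:
  assumes "finite \<Omega>" "\<And>x. x \<in> \<Omega> \<Longrightarrow> f x \<in> carrier V"
  shows "\<exists>v\<in>carrier V. \<forall>w\<in>carrier V. ip v w = (\<Sum>x\<in>\<Omega>. c x * ip (f x) w)"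
  using assms
proof (induction \<Omega> rule: finite_induct)
  case empty
  have "ip \<zero> w = 0" if "w \<in> carrier V" for w
    using ip_add_left[of \<zero> \<zero> w] that by simp
  then show ?case by auto
next
  case (insert a \<Omega>)
  then obtain v where v: "v \<in> carrier V" "\<And>w. w \<in> carrier V \<Longrightarrow> ip v w = (\<Sum>x\<in>\<Omega>. c x * ip (f x) w)"
    by auto
  have fa: "f a \<in> carrier V" using insert by simp
  show ?case
  proof (intro bexI ballI)
    fix w assume w: "w \<in> carrier V"
    show "ip (c a \<odot> f a \<oplus> v) w = (\<Sum>x\<in>insert a \<Omega>. c x * ip (f x) w)"
      using w v fa insert.hyps by (simp add: ip_add_left ip_smult_left smult_carrier)
  qed (use v fa smult_carrier in simp)
qed

text \<open>The Gram matrix of the points is positive semidefinite, and the factors of its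
  decomposition serve as Euclidean coordinates.\<close>

lemma finite_isometric_coordinates:
  assumes fin: "finite \<Omega>" and f: "\<And>x. x \<in> \<Omega> \<Longrightarrow> f x \<in> carrier V"
  obtains gs where "\<And>x y. x \<in> \<Omega> \<Longrightarrow> y \<in> \<Omega> \<Longrightarrow> (hilbert_dist V ip (f x) (f y))\<^sup>2 = (\<Sum>g\<leftarrow>gs. (g x - g y)\<^sup>2)"
proof -
  have "\<exists>gs. \<forall>x\<in>\<Omega>. \<forall>y\<in>\<Omega>. ip (f x) (f y) = (\<Sum>g\<leftarrow>gs. g x * g y)"
  proof (rule psd_kernel_factorization[OF fin])
    show "ip (f x) (f y) = ip (f y) (f x)" if "x \<in> \<Omega>" "y \<in> \<Omega>" for x y
      using that f ip_commute by blast
    fix c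
    have "\<exists>v\<in>carrier V. \<forall>w\<in>carrier V. ip v w = (\<Sum>x\<in>\<Omega>. c x * ip (f x) w)"
      by (rule linear_combination[OF fin f])
    then obtain v where v: "v \<in> carrier V" "\<And>w. w \<in> carrier V \<Longrightarrow> ip v w = (\<Sum>x\<in>\<Omega>. c x * ip (f x) w)"
      by (elim bexE) simp
    have "ip v v = (\<Sum>x\<in>\<Omega>. c x * ip v (f x))"
      unfolding v(2)[OF v(1)] using f v(1) ip_commute by (intro sum.cong) auto
    also have "\<dots> = (\<Sum>x\<in>\<Omega>. \<Sum>y\<in>\<Omega>. c x * c y * ip (f x) (f y))"
      using f v(2) ip_commute by (intro sum.cong refl) (auto simp: sum_distrib_left intro!: sum.cong)
    finally show "0 \<le> (\<Sum>x\<in>\<Omega>. \<Sum>y\<in>\<Omega>. c x * c y * ip (f x) (f y))"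
      using ip_nonneg[OF v(1)] by simp
  qed
  then obtain gs where gs: "\<And>x y. x \<in> \<Omega> \<Longrightarrow> y \<in> \<Omega> \<Longrightarrow> ip (f x) (f y) = (\<Sum>g\<leftarrow>gs. g x * g y)"
    by blast
  have "(\<Sum>g\<leftarrow>gs. (g x - g y)\<^sup>2) = (\<Sum>g\<leftarrow>gs. g x * g x) + (\<Sum>g\<leftarrow>gs. g y * g y) - 2 * (\<Sum>g\<leftarrow>gs. g x * g y)" for x y
    by (induction gs) (auto simp: power2_eq_square algebra_simps)
  then have "(hilbert_dist V ip (f x) (f y))\<^sup>2 = (\<Sum>g\<leftarrow>gs. (g x - g y)\<^sup>2)" if "x \<in> \<Omega>" "y \<in> \<Omega>" for x y
    using hilbert_dist_square[OF f f] gs that by simp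
  then show thesis by (rule that)
qed

end

text \<open>Both sides of \<open>cotype_inequality\<close> are sums of squares, so adding it over
  the coordinates gives the inequality for \<open>f\<close>. If every long displacement exceeded the
  bound, then so would their average over all directions and points.\<close>

lemma (in commuting_bijections) hilbert_cotype:
  assumes V: "real_inner_product_space V ip" and f: "\<And>x. x \<in> \<Omega> \<Longrightarrow> f x \<in> carrier V"
    and A: "\<And>w x. w \<in> set (walks n) \<Longrightarrow> x \<in> \<Omega> \<Longrightarrow> hilbert_dist V ip (f (w x)) (f x) \<le> A"
    and ne: "\<Omega> \<noteq> {}" and n: "n > 0" and "A \<ge> 0"
  shows "\<exists>j<n. \<exists>x\<in>\<Omega>. (hilbert_dist V ip (f (((T j) ^^ (2 * m)) x)) (f x))\<^sup>2 \<le> (6 + 12 * (real m)\<^sup>2 / n) * A\<^sup>2"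
proof (rule ccontr)
  interpret V: real_inner_product_space V ip by (rule V)
  interpret MS: Metric_space "carrier V" "hilbert_dist V ip" by (rule V.Metric_space_hilbert_dist)
  let ?d = "\<lambda>x y. hilbert_dist V ip (f x) (f y)" and ?B = "(6 + 12 * (real m)\<^sup>2 / n) * A\<^sup>2"
  let ?T = "\<lambda>j x. ((T j) ^^ (2 * m)) x"
  assume "\<not> ?thesis"
  then have big: "?B < (?d (?T j x) x)\<^sup>2" if "j < n" "x \<in> \<Omega>" for j x
    using that by (meson not_le)
  obtain gs where gs: "\<And>x y. x \<in> \<Omega> \<Longrightarrow> y \<in> \<Omega> \<Longrightarrow> (?d x y)\<^sup>2 = (\<Sum>g\<leftarrow>gs. (g x - g y)\<^sup>2)"
    by (rule V.finite_isometric_coordinates[OF fin f]) (assumption, rule that, blast)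
  have Tin: "(T j ^^ i) x \<in> \<Omega>" if "x \<in> \<Omega>" for i j x
    using that by (induction i) (auto simp: T_in)
  have win: "w x \<in> \<Omega>" if "w \<in> set (walks n)" "x \<in> \<Omega>" for w x
    using walks_bij[OF that(1)] that(2) by (auto dest: bij_betwE)
  have swap: "(\<Sum>x\<in>I. \<Sum>g\<leftarrow>gs. b g x) = (\<Sum>g\<leftarrow>gs. \<Sum>x\<in>I. b g x)" for I :: "'z set" and gs :: "'y list" and b :: "'y \<Rightarrow> 'z \<Rightarrow> real"
    by (induction gs) (simp_all add: sum.distrib)
  have swap': "(\<Sum>w\<leftarrow>ws. \<Sum>g\<leftarrow>gs. b g w) = (\<Sum>g\<leftarrow>gs. \<Sum>w\<leftarrow>ws. b g w)" for ws :: "'z list" and gs :: "'y list" and b :: "'y \<Rightarrow> 'z \<Rightarrow> real"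
    by (induction gs) (simp_all add: sum_list_addf)
  have "real n * (real (card \<Omega>) * ?B) = (\<Sum>j<n. \<Sum>x\<in>\<Omega>. ?B)" by simp
  also have "\<dots> < (\<Sum>j<n. \<Sum>x\<in>\<Omega>. (?d (?T j x) x)\<^sup>2)"
    using big ne n fin by (intro sum_strict_mono) auto
  also have "\<dots> = (\<Sum>j<n. \<Sum>x\<in>\<Omega>. \<Sum>g\<leftarrow>gs. (g (?T j x) - g x)\<^sup>2)"
    using gs Tin by (intro sum.cong refl) auto
  also have "\<dots> = (\<Sum>g\<leftarrow>gs. \<Sum>j<n. sqnorm \<Omega> (\<lambda>x. g (?T j x) - g x))"
    by (simp add: swap sqnorm_def)
  also have "\<dots> \<le> (\<Sum>g\<leftarrow>gs. (6 * real n + 12 * (real m)\<^sup>2) * energy g)"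
    by (intro sum_list_mono cotype_inequality)
  also have "\<dots> = (6 * real n + 12 * (real m)\<^sup>2) * (\<Sum>g\<leftarrow>gs. energy g)"
    by (simp add: sum_list_const_mult)
  also have "(\<Sum>g\<leftarrow>gs. energy g) = (\<Sum>w\<leftarrow>walks n. \<Sum>x\<in>\<Omega>. \<Sum>g\<leftarrow>gs. (g (w x) - g x)\<^sup>2) / 2 ^ n"
  proof -
    have "(\<Sum>g\<leftarrow>gs. energy g) = (\<Sum>g\<leftarrow>gs. \<Sum>w\<leftarrow>walks n. \<Sum>x\<in>\<Omega>. (g (w x) - g x)\<^sup>2) / 2 ^ n"
      by (simp add: energy_def sqnorm_def divide_inverse sum_list_mult_const)
    also have "(\<Sum>g\<leftarrow>gs. \<Sum>w\<leftarrow>walks n. \<Sum>x\<in>\<Omega>. (g (w x) - g x)\<^sup>2)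
        = (\<Sum>w\<leftarrow>walks n. \<Sum>g\<leftarrow>gs. \<Sum>x\<in>\<Omega>. (g (w x) - g x)\<^sup>2)"
      by (rule swap'[symmetric])
    finally show ?thesis by (simp only: swap)
  qed
  also have "(\<Sum>w\<leftarrow>walks n. \<Sum>x\<in>\<Omega>. \<Sum>g\<leftarrow>gs. (g (w x) - g x)\<^sup>2) = (\<Sum>w\<leftarrow>walks n. \<Sum>x\<in>\<Omega>. (?d (w x) x)\<^sup>2)"
    using gs win by (intro arg_cong[where f = sum_list] map_cong refl sum.cong) auto
  also have "\<dots> \<le> (\<Sum>w\<leftarrow>walks n. \<Sum>x\<in>\<Omega>. A\<^sup>2)"
    using A by (intro sum_list_mono sum_mono power_mono) auto
  also have "\<dots> = 2 ^ n * (card \<Omega> * A\<^sup>2)"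
    by (simp add: sum_list_triv length_walks)
  finally have "real n * (real (card \<Omega>) * ?B) < (6 * real n + 12 * (real m)\<^sup>2) * (2 ^ n * (card \<Omega> * A\<^sup>2) / 2 ^ n)"
    by (simp add: mult_left_mono divide_right_mono)
  also have "\<dots> = real n * (real (card \<Omega>) * ?B)"
    using n by (simp add: field_simps)
  finally show False by simp
qed

section \<open>Discrete tori among the finitely supported sequences\<close>

definition finsupp :: "(nat \<Rightarrow> real) set" where
  "finsupp = {c. finite {k. c k \<noteq> 0}}"

text \<open>The product of \<open>n\<close> cyclic groups of order \<open>M\<close>, realised by
  roots of unity so that a point carries its position on each circle.\<close>

definition torus :: "nat \<Rightarrow> nat \<Rightarrow> (nat \<Rightarrow> complex) set" where
  "torus n M = PiE {..<n} (\<lambda>_. {z. z ^ M = 1})"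

text \<open>The identity for \<open>j \<ge> n\<close>, because \<open>commuting_bijections\<close>
  asks for a bijection of the torus at every index.\<close>

definition rotate_coord :: "nat \<Rightarrow> complex \<Rightarrow> nat \<Rightarrow> (nat \<Rightarrow> complex) \<Rightarrow> nat \<Rightarrow> complex" where
  "rotate_coord n \<zeta> j x = (if j < n then x(j := \<zeta> * x j) else x)"

lemma rotate_coord_torus: "\<zeta> ^ M = 1 \<Longrightarrow> x \<in> torus n M \<Longrightarrow> rotate_coord n \<zeta> j x \<in> torus n M"
  by (auto simp: torus_def rotate_coord_def PiE_iff extensional_def power_mult_distrib)

lemma rotate_coord_inverse:
  "\<zeta> * \<xi> = 1 \<Longrightarrow> rotate_coord n \<zeta> j (rotate_coord n \<xi> j x) = x"
  by (simp add: rotate_coord_def mult.assoc[symmetric])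

lemma rotate_coord_funpow:
  "j < n \<Longrightarrow> (rotate_coord n \<zeta> j ^^ i) x = x(j := \<zeta> ^ i * x j)"
  by (induction i) (simp_all add: rotate_coord_def mult.assoc)

lemma commuting_bijections_torus:
  assumes "\<zeta> ^ M = 1" "M > 0"
  shows "commuting_bijections (torus n M) (rotate_coord n \<zeta>) (rotate_coord n (inverse \<zeta>))"
proof
  have nz: "\<zeta> \<noteq> 0" using assms by (auto simp: power_0_left)
  have i: "inverse \<zeta> ^ M = 1" using assms by (simp add: power_inverse)
  show "finite (torus n M)"
    unfolding torus_def using assms by (intro finite_PiE) (auto simp: finite_roots_unity)
  show "rotate_coord n \<zeta> j x \<in> torus n M" "rotate_coord n (inverse \<zeta>) j x \<in> torus n M"
    if "x \<in> torus n M" for j x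
    using that assms i rotate_coord_torus by auto
  show "rotate_coord n \<zeta> j (rotate_coord n (inverse \<zeta>) j x) = x"
    "rotate_coord n (inverse \<zeta>) j (rotate_coord n \<zeta> j x) = x" for j x
    using nz by (simp_all add: rotate_coord_inverse)
  show "rotate_coord n \<zeta> i (rotate_coord n \<zeta> j x) = rotate_coord n \<zeta> j (rotate_coord n \<zeta> i x)" for i j x
    by (cases "i = j") (simp_all add: rotate_coord_def fun_upd_twist)
qed

lemma norm_torus: "x \<in> torus n M \<Longrightarrow> M > 0 \<Longrightarrow> i < n \<Longrightarrow> cmod (x i) = 1"
  unfolding torus_def by (metis (mono_tags, lifting) PiE_mem lessThan_iff mem_Collect_eq
      power_eq_1_iff not_gr_zero)

text \<open>A walk turns each coordinate at most once, by \<open>\<zeta>\<close> or its inverse. The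
  first conjunct carries the induction: the coordinate turned by the newest step is left alone by
  the rest of the walk.\<close>

lemma walks_torus_close:
  assumes z: "\<zeta> ^ M = 1" "M > 0" and w: "w \<in> set (commuting_bijections.walks (rotate_coord n \<zeta>) (rotate_coord n (inverse \<zeta>)) k)"
    and x: "x \<in> torus n M"
  shows "(\<forall>i\<ge>k. w x i = x i) \<and> (\<forall>i. cmod (w x i - x i) \<le> cmod (\<zeta> - 1))"
proof -
  interpret commuting_bijections "torus n M" "rotate_coord n \<zeta>" "rotate_coord n (inverse \<zeta>)" n
    by (rule commuting_bijections_torus[OF z])
  have n1: "cmod \<zeta> = 1" using z by (metis power_eq_1_iff not_gr_zero)
  have step: "(\<forall>i\<ge>Suc k. w (rotate_coord n \<xi> k x) i = x i) \<and>
      (\<forall>i. cmod (w (rotate_coord n \<xi> k x) i - x i) \<le> cmod (\<zeta> - 1))"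
    if IH: "\<And>x. x \<in> torus n M \<Longrightarrow> (\<forall>i\<ge>k. w x i = x i) \<and> (\<forall>i. cmod (w x i - x i) \<le> cmod (\<zeta> - 1))"
      and \<xi>: "\<xi> ^ M = 1" "cmod (\<xi> - 1) = cmod (\<zeta> - 1)" and x: "x \<in> torus n M" for w \<xi> k x
  proof -
    let ?y = "rotate_coord n \<xi> k x"
    have y: "?y \<in> torus n M" by (rule rotate_coord_torus[OF \<xi>(1) x])
    have yi: "?y i = x i" if "i \<noteq> k" for i using that by (simp add: rotate_coord_def)
    have yk: "cmod (?y k - x k) \<le> cmod (\<zeta> - 1)"
    proof (cases "k < n")
      case True
      have "?y k - x k = (\<xi> - 1) * x k" using True by (simp add: rotate_coord_def algebra_simps)
      then show ?thesis using norm_torus[OF x z(2) True] \<xi>(2) by (simp add: norm_mult)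
    qed (simp add: rotate_coord_def)
    have "cmod (w ?y i - x i) \<le> cmod (\<zeta> - 1)" for i
    proof (cases "i = k")
      case True
      then show ?thesis using IH[OF y] yk by simp
    next
      case False
      then show ?thesis using IH[OF y] yi[of i] by metis
    qed
    then show ?thesis using IH[OF y] yi by auto
  qed
  have inv1: "cmod (inverse \<zeta> - 1) = cmod (\<zeta> - 1)"
  proof -
    have "\<zeta> \<noteq> 0" using n1 by auto
    then have "inverse \<zeta> - 1 = - inverse \<zeta> * (\<zeta> - 1)" by (simp add: algebra_simps)
    then show ?thesis using n1 by (simp add: norm_mult norm_inverse)
  qed
  have i: "inverse \<zeta> ^ M = 1" using z by (simp add: power_inverse)
  from w x show ?thesis
  proof (induction k arbitrary: w x)
    case (Suc k)
    then obtain w' where w': "w' \<in> set (walks k)"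
      "w = w' \<circ> rotate_coord n \<zeta> k \<or> w = w' \<circ> rotate_coord n (inverse \<zeta>) k" by auto
    note IH = Suc.IH[OF w'(1)]
    from w'(2) show ?case
    proof
      assume "w = w' \<circ> rotate_coord n \<zeta> k"
      then show ?thesis using step[OF IH z(1) refl Suc.prems(2)] by simp
    next
      assume "w = w' \<circ> rotate_coord n (inverse \<zeta>) k"
      then show ?thesis using step[OF IH i inv1 Suc.prems(2)] by simp
    qed
  qed simp
qed

text \<open>The circle of radius \<open>m\<close> is placed in two coordinates, so that \<open>2m\<close> steps of length at
  most \<open>2\<close> reach the antipode.\<close>

lemma finsupp_not_coarsely_in_hilbert:
  assumes V: "real_inner_product_space V ip" and F: "\<And>c. c \<in> finsupp \<Longrightarrow> F c \<in> carrier V"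
    and A: "\<And>c c'. c \<in> finsupp \<Longrightarrow> c' \<in> finsupp \<Longrightarrow> (\<And>k. \<bar>c k - c' k\<bar> \<le> 2) \<Longrightarrow> hilbert_dist V ip (F c) (F c') \<le> A"
    and R: "\<And>c c' k. c \<in> finsupp \<Longrightarrow> c' \<in> finsupp \<Longrightarrow> hilbert_dist V ip (F c) (F c') \<le> 5 * A \<Longrightarrow> \<bar>c k - c' k\<bar> \<le> R"
  shows False
proof -
  interpret V: real_inner_product_space V ip by (rule V)
  interpret MS: Metric_space "carrier V" "hilbert_dist V ip" by (rule V.Metric_space_hilbert_dist)
  have A0: "0 \<le> A"
    by (rule order_trans[OF MS.nonneg A[of "\<lambda>_. 0" "\<lambda>_. 0"]]) (simp_all add: finsupp_def)
  obtain m :: nat where m: "real m > max R 1" using reals_Archimedean2 by blast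
  then have m0: "m > 0" by (cases m) auto
  \<comment> \<open>With \<open>n = m\<^sup>2\<close> the factor in \<open>hilbert_cotype\<close> is
    \<open>6 + 12 = 18\<close>, below 25, which accounts for \<open>5 * A\<close>. With
    \<open>M = 4 * m\<close>, \<open>2 * m\<close> steps make half a turn, and since
    \<open>pi < 4\<close> a step on the unit circle is at most \<open>2 / m\<close> long.\<close>
  define n M where "n = m\<^sup>2" and "M = 4 * m"
  define \<zeta> where "\<zeta> = cis (2 * pi / M)"
  have M0: "M > 0" and n0: "n > 0" using m0 by (auto simp: n_def M_def)
  have "\<zeta> ^ M = cis (real M * (2 * pi / real M))" unfolding \<zeta>_def by (rule Complex.DeMoivre)
  then have zM: "\<zeta> ^ M = 1" using M0 by simp
  have z2m: "\<zeta> ^ (2 * m) = - 1" using m0 by (simp add: \<zeta>_def Complex.DeMoivre M_def)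
  have z1: "cmod (\<zeta> - 1) \<le> 2 / m"
  proof -
    have "cmod (\<zeta> - 1) \<le> 2 * pi / M" using norm_cis_diff_le[of "2 * pi / M" 0] by (simp add: \<zeta>_def)
    also have "\<dots> \<le> 2 / m" using m0 pi_less_4 by (simp add: M_def field_simps)
    finally show ?thesis .
  qed
  interpret commuting_bijections "torus n M" "rotate_coord n \<zeta>" "rotate_coord n (inverse \<zeta>)" n
    by (rule commuting_bijections_torus[OF zM M0])
  define h :: "(nat \<Rightarrow> complex) \<Rightarrow> nat \<Rightarrow> real" where
    "h x k = (if k < 2 * n then m * (if even k then Re (x (k div 2)) else Im (x (k div 2))) else 0)" for x k
  have fin: "h x \<in> finsupp" for x
    unfolding finsupp_def by (simp, rule finite_subset[of _ "{..<2 * n}"]) (auto simp: h_def)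
  have "hilbert_dist V ip (F (h (w x))) (F (h x)) \<le> A" if "w \<in> set (walks n)" "x \<in> torus n M" for w x
  proof (rule A[OF fin fin])
    fix k
    let ?z = "w x (k div 2)" and ?y = "x (k div 2)"
    have "cmod (?z - ?y) \<le> 2 / m"
      using walks_torus_close[OF zM M0 that] z1 order_trans by blast
    then have *: "real m * cmod (?z - ?y) \<le> 2" using m0 by (simp add: field_simps)
    have "\<bar>h (w x) k - h x k\<bar> \<le> real m * cmod (?z - ?y)"
      using abs_Re_le_cmod[of "?z - ?y"] abs_Im_le_cmod[of "?z - ?y"]
      by (simp add: h_def abs_mult mult_left_mono flip: right_diff_distrib)
    with * show "\<bar>h (w x) k - h x k\<bar> \<le> 2" by linarith
  qed
  moreover have "(\<lambda>i\<in>{..<n}. 1) \<in> torus n M" by (simp add: torus_def)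
  ultimately obtain j x where jx: "j < n" "x \<in> torus n M" and
    d: "(hilbert_dist V ip (F (h (((rotate_coord n \<zeta> j) ^^ (2 * m)) x))) (F (h x)))\<^sup>2
          \<le> (6 + 12 * (real m)\<^sup>2 / real n) * A\<^sup>2"
    using hilbert_cotype[OF V, of "\<lambda>x. F (h x)" A m] F fin n0 A0 by blast
  let ?y = "x(j := - x j)"
  have "(rotate_coord n \<zeta> j ^^ (2 * m)) x = ?y"
    using rotate_coord_funpow[OF jx(1), where \<zeta> = \<zeta> and i = "2 * m" and x = x] z2m by simp
  moreover have "(6 + 12 * (real m)\<^sup>2 / real n) * A\<^sup>2 \<le> (5 * A)\<^sup>2"
    using m0 by (simp add: n_def power_mult_distrib)
  ultimately have "(hilbert_dist V ip (F (h ?y)) (F (h x)))\<^sup>2 \<le> (5 * A)\<^sup>2" using d by simp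
  then have "hilbert_dist V ip (F (h ?y)) (F (h x)) \<le> 5 * A"
    using A0 power2_le_imp_le[of _ "5 * A"] by simp
  note R' = R[OF fin fin this]
  have "2 * real m * \<bar>Re (x j)\<bar> \<le> R" using R'[of "2 * j"] jx(1) by (simp add: h_def abs_mult)
  moreover have "2 * real m * \<bar>Im (x j)\<bar> \<le> R" using R'[of "2 * j + 1"] jx(1) by (simp add: h_def abs_mult)
  \<comment> \<open>Antipodal points differ by \<open>2 * m\<close> times these two numbers, so
    adding the two bounds gives \<open>2 * m \<le> 2 * R\<close>, against the choice of
    \<open>m\<close>.\<close>
  moreover have "1 \<le> \<bar>Re (x j)\<bar> + \<bar>Im (x j)\<bar>"
    using cmod_le[of "x j"] norm_torus[OF jx(2) M0 jx(1)] by simp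
  then have "2 * real m * 1 \<le> 2 * real m * (\<bar>Re (x j)\<bar> + \<bar>Im (x j)\<bar>)"
    by (intro mult_left_mono) auto
  ultimately show False using m by (simp add: distrib_left)
qed

section \<open>Aharoni's embedding\<close>

context Metric_space
begin

text \<open>At scale \<open>r\<close>: the balls of radius \<open>r\<close> around an enumerated dense set \<open>q\<close>, made disjoint
  and kept away from the base point.\<close>

definition cell :: "(nat \<Rightarrow> 'a) \<Rightarrow> 'a \<Rightarrow> real \<Rightarrow> nat \<Rightarrow> 'a set" where
  "cell q p r n = {z \<in> M. d z (q n) < r \<and> (\<forall>i<n. r \<le> d z (q i)) \<and> 2 * r \<le> d z p}"

definition dist_set :: "'a set \<Rightarrow> 'a \<Rightarrow> real" where
  "dist_set B x = Inf (d x ` B)"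

text \<open>An empty cell is treated separately because \<open>Inf {}\<close> is
  unspecified.\<close>

definition tent :: "(nat \<Rightarrow> 'a) \<Rightarrow> 'a \<Rightarrow> real \<Rightarrow> nat \<Rightarrow> 'a \<Rightarrow> real" where
  "tent q p r n x = (if cell q p r n = {} then 0 else max 0 (r / 2 - dist_set (cell q p r n) x))"

lemma dist_set_le: "b \<in> B \<Longrightarrow> dist_set B x \<le> d x b"
  unfolding dist_set_def by (intro cInf_lower) (auto intro!: bdd_belowI[of _ 0])

lemma le_dist_set: "B \<noteq> {} \<Longrightarrow> (\<And>b. b \<in> B \<Longrightarrow> c \<le> d x b) \<Longrightarrow> c \<le> dist_set B x"
  unfolding dist_set_def by (intro cInf_greatest) auto

lemma dist_set_lipschitz:
  assumes "x \<in> M" "y \<in> M" "B \<subseteq> M" "B \<noteq> {}"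
  shows "dist_set B x \<le> dist_set B y + d x y"
proof -
  have "dist_set B x - d x y \<le> dist_set B y"
  proof (rule le_dist_set[OF assms(4)])
    fix b assume b: "b \<in> B"
    then have "dist_set B x \<le> d x b" by (rule dist_set_le)
    also have "\<dots> \<le> d x y + d y b" using triangle assms b by blast
    finally show "dist_set B x - d x y \<le> d y b" by simp
  qed
  then show ?thesis by simp
qed

lemma cell_subset: "cell q p r n \<subseteq> M"
  by (auto simp: cell_def)

lemma tent_lipschitz:
  assumes "x \<in> M" "y \<in> M"
  shows "\<bar>tent q p r n x - tent q p r n y\<bar> \<le> d x y"
proof (cases "cell q p r n = {}")
  case False
  then show ?thesis
    using dist_set_lipschitz[OF assms cell_subset False] dist_set_lipschitz[OF assms(2,1) cell_subset False]
      commute[of y x] by (auto simp: tent_def max_def abs_if)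
qed (simp add: tent_def)

lemma tent_eq_0I:
  assumes "\<And>b. b \<in> cell q p r n \<Longrightarrow> r / 2 \<le> d x b"
  shows "tent q p r n x = 0"
proof (cases "cell q p r n = {}")
  case False
  have "r / 2 \<le> dist_set (cell q p r n) x" by (rule le_dist_set[OF False assms])
  then show ?thesis by (simp add: tent_def max_def)
qed (simp add: tent_def)

lemma tent_eq_half:
  assumes "x \<in> cell q p r n" "0 \<le> r"
  shows "tent q p r n x = r / 2"
proof -
  have "x \<in> M" using assms cell_subset by blast
  then have "dist_set (cell q p r n) x \<le> 0" using dist_set_le[OF assms(1), of x] by simp
  moreover have "0 \<le> dist_set (cell q p r n) x" using assms(1) by (intro le_dist_set) auto
  ultimately show ?thesis using assms by (auto simp: tent_def)
qed

text \<open>Cells keep distance \<open>2 * r\<close> from \<open>p\<close>, hence distance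
  \<open>r\<close> from \<open>x\<close>.\<close>

lemma tent_eq_0_far:
  assumes "x \<in> M" "p \<in> M" "d x p \<le> r"
  shows "tent q p r n x = 0"
proof (rule tent_eq_0I)
  fix b assume b: "b \<in> cell q p r n"
  then have bM: "b \<in> M" using cell_subset by blast
  have "2 * r \<le> d b p" using b by (simp add: cell_def)
  also have "\<dots> \<le> d b x + d x p" using triangle bM assms by blast
  finally show "r / 2 \<le> d x b"
    using assms(3) commute[of b x] nonneg[of x p] by linarith
qed

lemma tent_eq_0_late:
  assumes "x \<in> M" "range q \<subseteq> M" "d x (q i) \<le> r / 2" "i < n"
  shows "tent q p r n x = 0"
proof (rule tent_eq_0I)
  fix b assume b: "b \<in> cell q p r n"
  then have bM: "b \<in> M" using cell_subset by blast
  have "r \<le> d b (q i)" using b assms(4) by (simp add: cell_def)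
  also have "\<dots> \<le> d b x + d x (q i)" using triangle bM assms by blast
  finally show "r / 2 \<le> d x b" using assms(3) commute[of b x] by linarith
qed

text \<open>Points of one cell are less than \<open>2 * r\<close> apart, and the tent reaches
  \<open>r / 2\<close> further.\<close>

lemma tent_eq_0_outside:
  assumes "x \<in> cell q p r n" "y \<in> M" "range q \<subseteq> M" "5 / 2 * r \<le> d x y"
  shows "tent q p r n y = 0"
proof (rule tent_eq_0I)
  fix b assume b: "b \<in> cell q p r n"
  then have M: "b \<in> M" "x \<in> M" "q n \<in> M" using cell_subset assms by blast+
  have "d x y \<le> d x b + d b y" using triangle M assms(2) by blast
  moreover have "d x b \<le> d x (q n) + d (q n) b" using triangle M by blast
  moreover have "d x (q n) < r" "d b (q n) < r" using b assms(1) by (auto simp: cell_def)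
  ultimately show "r / 2 \<le> d y b" using assms(4) commute[of y b] commute[of "q n" b] by linarith
qed

lemma in_some_cell:
  assumes "x \<in> M" "d x (q i) < r" "2 * r \<le> d x p"
  obtains n where "x \<in> cell q p r n"
proof -
  let ?n = "LEAST i. d x (q i) < r"
  have "d x (q ?n) < r" using assms(2) by (rule LeastI)
  moreover have "r \<le> d x (q i)" if "i < ?n" for i using not_less_Least[OF that] by simp
  ultimately have "x \<in> cell q p r ?n" using assms by (simp add: cell_def)
  then show thesis by (rule that)
qed

text \<open>The tents at scale \<open>2 ^ s\<close> separate pairs at distance about \<open>2 ^ (s + 2)\<close>. Since the cells stay away
  from the base point, a given point meets only finitely many scales, and since early balls are
  removed, only finitely many cells at each scale.\<close>

lemma aharoni_quasi_isometric:
  assumes sep: "separable_space mtopology"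
  obtains c :: "'a \<Rightarrow> nat \<Rightarrow> real" where "c ` M \<subseteq> finsupp"
    and "\<And>x y k. x \<in> M \<Longrightarrow> y \<in> M \<Longrightarrow> \<bar>c x k - c y k\<bar> \<le> d x y"
    and "\<And>x y. x \<in> M \<Longrightarrow> y \<in> M \<Longrightarrow> \<exists>k. d x y / 16 - 1 \<le> \<bar>c x k - c y k\<bar>"
proof (cases "M = {}")
  case True
  then show thesis using that[of "\<lambda>_ _. 0"] by auto
next
  case False
  then obtain p where p: "p \<in> M" by blast
  obtain Q where Q: "countable Q" "Q \<subseteq> M" "mtopology closure_of Q = M"
    using sep by (auto simp: separable_space_def)
  have "Q \<noteq> {}" using Q p by auto
  then obtain q :: "nat \<Rightarrow> 'a" where q: "range q = Q" using uncountable_def Q(1) by blast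
  have qM: "range q \<subseteq> M" using q Q(2) by simp
  have dense: "\<exists>i. d x (q i) < r" if xr: "x \<in> M" "r > 0" for x r
  proof -
    have "x \<in> mtopology closure_of Q" using Q(3) xr by simp
    then obtain y where "y \<in> Q" "y \<in> mball x r" using xr(2) unfolding metric_closure_of by blast
    then show ?thesis using q by auto
  qed
  \<comment> \<open>The pairing of natural numbers arranges scales and cells in a single
    sequence.\<close>
  define c where "c x k = (case prod_decode k of (s, n) \<Rightarrow> tent q p (2 ^ s) n x)" for x k
  show thesis
  proof (rule that[of c])
    show "c ` M \<subseteq> finsupp"
    proof clarify
      fix x assume x: "x \<in> M"
      obtain s0 where s0: "d x p \<le> 2 ^ s0" by (meson less_imp_le real_arch_pow one_less_numeral_iff semiring_norm(76))
      have "\<forall>s. \<exists>i. d x (q i) < 2 ^ s / 2" by (intro allI dense[OF x]) simp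
      then obtain i where i: "\<And>s. d x (q (i s)) < 2 ^ s / 2" by metis
      have "{k. c x k \<noteq> 0} \<subseteq> prod_encode ` (SIGMA s:{..<s0}. {..i s})"
      proof
        fix k assume "k \<in> {k. c x k \<noteq> 0}"
        then obtain s n where k: "k = prod_encode (s, n)" "tent q p (2 ^ s) n x \<noteq> 0"
          unfolding c_def by (metis (mono_tags, lifting) case_prod_conv mem_Collect_eq prod_decode_inverse surj_pair)
        have "s < s0"
        proof (rule ccontr)
          assume "\<not> s < s0"
          then have "(2::real) ^ s0 \<le> 2 ^ s" by (intro power_increasing) auto
          with s0 have "d x p \<le> 2 ^ s" by linarith
          then show False using tent_eq_0_far[OF x p, of "2 ^ s" q n] k(2) by simp
        qed
        moreover have "n \<le> i s"
          using tent_eq_0_late[OF x qM, of "i s" "2 ^ s" n] i[of s] k(2) by (meson less_imp_le not_le)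
        ultimately show "k \<in> prod_encode ` (SIGMA s:{..<s0}. {..i s})" using k(1) by blast
      qed
      then have "finite {k. c x k \<noteq> 0}" by (rule finite_subset) auto
      then show "c x \<in> finsupp" by (simp add: finsupp_def)
    qed
    show "\<bar>c x k - c y k\<bar> \<le> d x y" if "x \<in> M" "y \<in> M" for x y k
      using tent_lipschitz[OF that] by (simp add: c_def split: prod.split)
    have main: "\<exists>k. d x y / 16 - 1 \<le> \<bar>c x k - c y k\<bar>" if xy: "x \<in> M" "y \<in> M" "d x y \<le> 2 * d x p" for x y
    \<comment> \<open>Only scales at least 1 are present, so short distances are left to the
      additive constant; any index serves for them.\<close>
    proof (cases "d x y \<le> 16")
      case True
      then show ?thesis by (intro exI[of _ 0]) linarith
    next
      case False
      \<comment> \<open>The lower bound on \<open>d x y\<close> gives both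
        \<open>5/2 * 2 ^ s \<le> d x y\<close>, so that the tent of \<open>x\<close> vanishes at
        \<open>y\<close>, and \<open>2 * 2 ^ s \<le> d x p\<close>, so that \<open>x\<close> lies in
        a cell. The upper bound makes the height \<open>2 ^ s / 2\<close> exceed
        \<open>d x y / 16\<close>.\<close>
      obtain s :: nat where s: "2 ^ s \<le> d x y / 4" "d x y / 4 < 2 ^ Suc s"
      proof -
        have "\<exists>n. d x y / 4 < 2 ^ n" by (rule real_arch_pow) simp
        define t where "t = (LEAST n. d x y / 4 < (2::real) ^ n)"
        have t: "d x y / 4 < 2 ^ t" unfolding t_def by (rule LeastI_ex) fact
        then have "t \<noteq> 0" using False by (intro notI) simp
        then obtain s where "t = Suc s" using not0_implies_Suc by blast
        moreover from this have "\<not> d x y / 4 < 2 ^ s" using not_less_Least[of s "\<lambda>n. d x y / 4 < 2 ^ n"] unfolding t_def by (simp only: lessI not_False_eq_True)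
        ultimately show thesis using t that[of s] by simp
      qed
      let ?r = "2 ^ s :: real"
      obtain i where "d x (q i) < ?r" using dense[OF xy(1), of ?r] by auto
      moreover have "2 * ?r \<le> d x p" using s(1) xy(3) by simp
      ultimately obtain n where n: "x \<in> cell q p ?r n" using in_some_cell[OF xy(1)] by metis
      have "tent q p ?r n x = ?r / 2" using tent_eq_half[OF n] by simp
      moreover have "tent q p ?r n y = 0"
        using tent_eq_0_outside[OF n xy(2) qM] s(1) nonneg[of x y] by simp
      ultimately have "c x (prod_encode (s, n)) = ?r / 2" "c y (prod_encode (s, n)) = 0"
        by (simp_all only: c_def prod_encode_inverse case_prod_conv)
      then have "\<bar>c x (prod_encode (s, n)) - c y (prod_encode (s, n))\<bar> = ?r / 2"
        by (simp only: diff_zero abs_of_nonneg zero_le_divide_iff zero_le_power zero_le_numeral simp_thms)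
      moreover have "d x y / 16 - 1 \<le> ?r / 2" using s(2) by simp
      ultimately show ?thesis by metis
    qed
    show "\<exists>k. d x y / 16 - 1 \<le> \<bar>c x k - c y k\<bar>" if xy: "x \<in> M" "y \<in> M" for x y
    proof (cases "d x y \<le> 2 * d x p")
      case True
      then show ?thesis using main xy by blast
    next
      case False
      \<comment> \<open>If \<open>x\<close> is too close to the base point, the triangle inequality
        makes \<open>y\<close> far enough from it, and the roles are exchanged.\<close>
      then have "d y x \<le> 2 * d y p"
        using triangle[of x p y] xy p commute[of x y] commute[of p y] by simp
      from main[OF xy(2,1) this] show ?thesis by (simp add: commute abs_minus_commute)
    qed
  qed
qed

end

section \<open>Bumps and logarithms\<close>

text \<open>Tents of height 1 at \<open>1/m\<close>; for \<open>s > 0\<close> the support condition reads \<open>\<bar>1/s - m\<bar> < 1/2\<close>.\<close>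

definition bump :: "nat \<Rightarrow> real \<Rightarrow> real" where
  "bump m s = m * max 0 (s - 2 * \<bar>1 - m * s\<bar>)"

lemma bump_at: "m > 0 \<Longrightarrow> bump m (1 / m) = 1"
  by (simp add: bump_def)

lemma bump_0: "bump m 0 = 0"
  by (simp add: bump_def)

lemma bump_nonneg: "0 \<le> bump m s"
  by (simp add: bump_def)

text \<open>Where the bump is nonzero, \<open>2 * t - 2 < s \<le> t\<close> for
  \<open>t = m * s\<close>, so \<open>t < 2\<close>; and the bump is at most
  \<open>t\<close>.\<close>

lemma bump_le_2:
  assumes "m > 0"
  shows "bump m s \<le> 2"
proof -
  define t where "t = m * s"
  have *: "bump m s = m * max 0 (s - 2 * \<bar>1 - t\<bar>)" by (simp add: bump_def t_def)
  show ?thesis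
  proof (cases "s - 2 * \<bar>1 - t\<bar> \<le> 0")
    case False
    have m: "real m \<ge> 1" using assms by simp
    have "s > 2 * t - 2" "s > 0" using False by (smt (verit))+
    moreover from this have "1 * s \<le> t" unfolding t_def using m by (intro mult_right_mono) auto
    ultimately have "t \<le> 2" by linarith
    moreover have "m * (s - 2 * \<bar>1 - t\<bar>) \<le> t" unfolding t_def using m by (intro mult_left_mono) auto
    ultimately show ?thesis using False by (simp add: *)
  qed (simp add: *)
qed

lemma bump_disjoint:
  assumes "bump m s \<noteq> 0" "bump n s \<noteq> 0"
  shows "m = n"
proof -
  define t u where "t = m * s" and "u = n * s"
  have b: "s > 2 * \<bar>1 - t\<bar>" "s > 2 * \<bar>1 - u\<bar>"
    using assms by (simp_all add: t_def u_def bump_def max_def split: if_splits)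
  have s: "s > 0" "\<bar>t - u\<bar> < s" using b by (smt (verit))+
  have "\<bar>t - u\<bar> = \<bar>real m - real n\<bar> * s"
    using s(1) by (simp add: t_def u_def abs_mult flip: left_diff_distrib)
  with s have "\<bar>real m - real n\<bar> * s < 1 * s" by simp
  then have "\<bar>real m - real n\<bar> < 1" by (rule mult_right_less_imp_less) (use s in simp)
  then show ?thesis by linarith
qed

lemma continuous_on_bump: "continuous_on S (bump m)"
  unfolding bump_def[abs_def] by (intro continuous_intros)

section \<open>Existence and uniqueness of logarithms\<close>

lemma comm_group_unitary_group: "comm_group unitary_group"
  by (intro group.group_comm_groupI group_unitary_group)
    (auto simp: unitary_group_def intro!: bcontfun_eqI)

text \<open>The principal logarithm applies pointwise. The linear bound on \<open>h\<close> is what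
  later makes an algebraically constructed homomorphism continuous.\<close>

lemma near_one_imp_cis:
  fixes u :: "'x::topological_space \<Rightarrow>\<^sub>C complex"
  assumes u: "u \<in> carrier unitary_group" and near: "norm (u - 1) < 1 / 2"
  obtains h where "u = cis_bcontfun h" "norm h \<le> 2 * norm (u - 1)"
proof -
  have n: "norm (u x) = 1" for x using u by (simp add: in_unitary_group_iff)
  have d: "norm (u x - 1) \<le> norm (u - 1)" for x using norm_bounded[of "u - 1" x] by simp
  have L: "norm (Ln (u x)) \<le> 2 * norm (u - 1)" for x
    using norm_Ln_le[of "u x - 1"] d[of x] near by simp
  have c: "continuous_on UNIV (\<lambda>x. Im (Ln (u x)))"
  proof (intro continuous_intros continuous_on_apply_bcontfun)
    fix x
    have "\<bar>Re (u x - 1)\<bar> < 1 / 2" using abs_Re_le_cmod[of "u x - 1"] d[of x] near by linarith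
    then show "u x \<notin> \<real>\<^sub>\<le>\<^sub>0" by (auto simp: complex_nonpos_Reals_iff)
  qed
  have b: "norm (Im (Ln (u x))) \<le> 2 * norm (u - 1)" for x
    using abs_Im_le_cmod[of "Ln (u x)"] L[of x] by simp
  have "(\<lambda>x. Im (Ln (u x))) \<in> bcontfun" by (rule bcontfun_normI[OF c b])
  then obtain h where h: "(\<lambda>x. Im (Ln (u x))) = apply_bcontfun h" by (metis bcontfunE)
  have "cis (Im (Ln (u x))) = u x" for x
  proof -
    have nz: "u x \<noteq> 0" using n[of x] by auto
    then have "u x = of_real (exp (Re (Ln (u x)))) * cis (Im (Ln (u x)))" using exp_eq_polar[of "Ln (u x)"] by (simp add: exp_of_real)
    then show ?thesis using n[of x] nz by (simp add: Re_Ln)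
  qed
  then have "u = cis_bcontfun h" by (intro bcontfun_eqI) (simp add: fun_cong[OF h, symmetric])
  moreover have "norm h \<le> 2 * norm (u - 1)"
    using b by (simp add: norm_le_bcontfun_iff fun_cong[OF h, symmetric])
  ultimately show thesis by (rule that)
qed

text \<open>The difference of two logarithms divided by \<open>2 * pi\<close> is continuous with
  integer values, hence constant on a connected set.\<close>

lemma cis_bcontfun_eq_imp_diff_constant:
  assumes "cis_bcontfun g = cis_bcontfun h" "connected C" "x \<in> C" "y \<in> C"
  shows "g x - g y = h x - h y"
proof -
  let ?f = "\<lambda>z. (apply_bcontfun g z - apply_bcontfun h z) / (2 * pi)"
  have int: "?f z \<in> \<int>" for z
  proof -
    have "cis (g z) = cis (h z)" using assms(1) by (metis cis_bcontfun.rep_eq)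
    then have "cis (g z - h z) = 1" by (simp flip: cis_divide)
    then have "cos (g z - h z) = 1" by (simp add: complex_eq_iff)
    then obtain k where "g z - h z = of_int k * 2 * pi" by (auto simp: cos_one_2pi_int)
    then show ?thesis by simp
  qed
  have "continuous_on C ?f" by (intro continuous_intros continuous_on_apply_bcontfun) auto
  moreover have "\<exists>e>0. \<forall>z. z \<in> C \<and> ?f z \<noteq> ?f w \<longrightarrow> e \<le> norm (?f z - ?f w)" for w
  proof (intro exI[of _ 1] conjI allI impI)
    fix z assume "z \<in> C \<and> ?f z \<noteq> ?f w"
    then show "1 \<le> norm (?f z - ?f w)"
      using Ints_nonzero_abs_ge1[of "?f z - ?f w"] int by (simp add: Ints_diff)
  qed simp
  ultimately have "?f constant_on C"
    using continuous_discrete_range_constant[OF assms(2)] by blast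
  then have "?f x = ?f y" using assms(3,4) unfolding constant_on_def by metis
  then have "g x - h x = g y - h y" by (simp only: divide_cancel_right) simp
  then show ?thesis by linarith
qed

section \<open>The Haagerup property\<close>

lemma group_boundedD:
  assumes "group_bounded G T B" "left_invariant_pseudometric G d"
    "continuous_map (prod_topology T T) euclideanreal (\<lambda>(x, y). d x y)"
  obtains C where "\<And>x y. x \<in> B \<Longrightarrow> y \<in> B \<Longrightarrow> d x y \<le> C"
proof -
  have "left_invariant_pseudometric G d \<and>
      continuous_map (prod_topology T T) euclideanreal (\<lambda>(x, y). d x y) \<longrightarrow>
      (\<exists>C. \<forall>x\<in>B. \<forall>y\<in>B. d x y \<le> C)"
    using assms(1) unfolding group_bounded_def by (elim conjE) (erule spec)
  then obtain C where "\<forall>x\<in>B. \<forall>y\<in>B. d x y \<le> C" using assms(2,3) by blast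
  then show thesis by (intro that) auto
qed

lemma group_bounded_subset:
  assumes B: "group_bounded G T B" and "A \<subseteq> B"
  shows "group_bounded G T A"
  unfolding group_bounded_def
proof (intro conjI allI impI)
  show "A \<subseteq> carrier G" using assms by (auto simp: group_bounded_def)
  fix d assume d: "left_invariant_pseudometric G d \<and>
    continuous_map (prod_topology T T) euclideanreal (\<lambda>(x, y). d x y)"
  obtain C where "\<And>x y. x \<in> B \<Longrightarrow> y \<in> B \<Longrightarrow> d x y \<le> C"
    by (rule group_boundedD[OF B d[THEN conjunct1] d[THEN conjunct2]]) (rule that, assumption)
  then show "\<exists>C. \<forall>x\<in>A. \<forall>y\<in>A. d x y \<le> C" using assms(2) by (intro exI[of _ C]) auto
qed

text \<open>Makes the bounded sets directed, as the filter base in \<open>bounded_sublevel\<close>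
  requires, and allows the identity to be added to a bounded set.\<close>

lemma group_bounded_Un:
  assumes A: "group_bounded G T A" and B: "group_bounded G T B"
  shows "group_bounded G T (A \<union> B)"
  unfolding group_bounded_def
proof (intro conjI allI impI)
  show "A \<union> B \<subseteq> carrier G" using A B by (simp add: group_bounded_def)
  fix d assume d: "left_invariant_pseudometric G d \<and>
    continuous_map (prod_topology T T) euclideanreal (\<lambda>(x, y). d x y)"
  obtain C where C: "\<And>x y. x \<in> A \<Longrightarrow> y \<in> A \<Longrightarrow> d x y \<le> C"
    by (rule group_boundedD[OF A d[THEN conjunct1] d[THEN conjunct2]]) (rule that, assumption)
  obtain D where D: "\<And>x y. x \<in> B \<Longrightarrow> y \<in> B \<Longrightarrow> d x y \<le> D"
    by (rule group_boundedD[OF B d[THEN conjunct1] d[THEN conjunct2]]) (rule that, assumption)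
  have tri: "d x z \<le> d x y + d y z" and sym: "d x y = d y x" and nn: "0 \<le> d x y"
    if "x \<in> A \<union> B" "y \<in> A \<union> B" "z \<in> A \<union> B" for x y z
  proof -
    have "x \<in> carrier G" "y \<in> carrier G" "z \<in> carrier G"
      using that A B by (auto simp: group_bounded_def)
    then show "d x z \<le> d x y + d y z" "d x y = d y x" "0 \<le> d x y"
      using d by (auto simp: left_invariant_pseudometric_def)
  qed
  show "\<exists>C. \<forall>x\<in>A \<union> B. \<forall>y\<in>A \<union> B. d x y \<le> C"
  proof (cases "A = {} \<or> B = {}")
    case True
    then show ?thesis
    proof
      assume "A = {}"
      then show ?thesis using D by (intro exI[of _ D]) auto
    next
      assume "B = {}"
      then show ?thesis using C by (intro exI[of _ C]) auto
    qed
  next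
    case False
    then obtain a b where ab: "a \<in> A" "b \<in> B" by blast
    have m: "d x y \<le> C + d a b + D" if "x \<in> A" "y \<in> B" for x y
    proof -
      have "d x y \<le> d x a + d a y" "d a y \<le> d a b + d b y" using tri that ab by auto
      moreover have "d x a \<le> C" "d b y \<le> D" using C D that ab by auto
      ultimately show ?thesis by linarith
    qed
    have nnC: "0 \<le> C" "0 \<le> D" "0 \<le> d a b"
      using order_trans[OF nn C[OF ab(1) ab(1)]] order_trans[OF nn D[OF ab(2) ab(2)]] nn[of a b] ab by auto
    have "d x y \<le> C + d a b + D" if xy: "x \<in> A \<union> B" "y \<in> A \<union> B" for x y
    proof -
      consider "x \<in> A" "y \<in> A" | "x \<in> B" "y \<in> B" | "x \<in> A" "y \<in> B" | "x \<in> B" "y \<in> A"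
        using xy by auto
      then show ?thesis
      proof cases
        case 1
        then have "d x y \<le> C" by (rule C)
        then show ?thesis using nnC by linarith
      next
        case 2
        then have "d x y \<le> D" by (rule D)
        then show ?thesis using nnC by linarith
      next
        case 3
        then show ?thesis by (rule m)
      next
        case 4
        then show ?thesis using m[of y x] sym[of x y x] xy by auto
      qed
    qed
    then show ?thesis by (intro exI[of _ "C + d a b + D"]) auto
  qed
qed

lemma group_bounded_empty: "group_bounded G T {}"
  by (simp add: group_bounded_def)

text \<open>If the sublevel set were unbounded, its intersections with complements of bounded sets would
  generate a proper filter along which the orbit stays bounded.\<close>

lemma bounded_sublevel:
  fixes N :: "'g \<Rightarrow> real"
  assumes proper: "\<And>F. \<forall>\<^sub>F g in F. g \<in> carrier G \<Longrightarrow>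
      (\<And>B. group_bounded G T B \<Longrightarrow> \<forall>\<^sub>F g in F. g \<notin> B) \<Longrightarrow> filterlim N at_top F"
  shows "group_bounded G T {g \<in> carrier G. N g \<le> C}"
proof -
  let ?S = "{g \<in> carrier G. N g \<le> C}"
  let ?\<B> = "Collect (group_bounded G T)"
  define F where "F = (INF B\<in>?\<B>. principal (?S - B))"
  have ne: "?\<B> \<noteq> {}" using group_bounded_empty by blast
  have ev: "eventually P F \<longleftrightarrow> (\<exists>B\<in>?\<B>. eventually P (principal (?S - B)))" for P
    unfolding F_def
  proof (rule eventually_INF_base[OF ne])
    fix A B assume "A \<in> ?\<B>" "B \<in> ?\<B>"
    then show "\<exists>x\<in>?\<B>. principal (?S - x) \<le> inf (principal (?S - A)) (principal (?S - B))"
      by (intro bexI[of _ "A \<union> B"]) (auto simp: group_bounded_Un)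
  qed
  have "\<forall>\<^sub>F g in F. g \<in> ?S"
    unfolding ev using ne by (auto simp: eventually_principal)
  then have "\<forall>\<^sub>F g in F. g \<in> carrier G" and le: "\<forall>\<^sub>F g in F. N g \<le> C"
    by (auto elim: eventually_mono)
  moreover have "\<forall>\<^sub>F g in F. g \<notin> B" if "group_bounded G T B" for B
    unfolding ev using that by (auto simp: eventually_principal)
  ultimately have "filterlim N at_top F" using proper by blast
  then have "\<forall>\<^sub>F g in F. N g > C" by (simp add: filterlim_at_top_dense)
  with le have "\<forall>\<^sub>F g in F. False" by eventually_elim simp
  then obtain B where "group_bounded G T B" "?S - B = {}"
    unfolding ev by (auto simp: eventually_principal)
  then show ?thesis using group_bounded_subset by blast
qed

text \<open>Along the orbit map the Hilbert distance pulls back to a continuous left-invariant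
  pseudometric, so controlled sets go to controlled sets. Conversely, a bound on displacements
  bounds the norm of the orbit at \<open>inv x \<otimes> y\<close>, and properness turns norm bounds
  into bounded sets.\<close>

lemma haagerup_imp_coarsely_embeds:
  assumes haag: "haagerup G T" and G: "Group.group G" and T: "topspace T = carrier G"
  shows "coarsely_embeds_in_hilbert G T"
proof -
  interpret G: group G by (rule G)
  obtain V :: "(real, 'a \<Rightarrow> real) module" and ip \<phi> \<xi> where V: "real_hilbert_space V ip"
    and act: "group_action G (carrier V) \<phi>"
    and iso: "\<forall>g\<in>carrier G. \<forall>x\<in>carrier V. \<forall>y\<in>carrier V.
           hilbert_dist V ip (\<phi> g x) (\<phi> g y) = hilbert_dist V ip x y"
    and cont: "continuous_map (prod_topology T (Metric_space.mtopology (carrier V) (hilbert_dist V ip)))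
          (Metric_space.mtopology (carrier V) (hilbert_dist V ip)) (\<lambda>(g, x). \<phi> g x)"
    and \<xi>: "\<xi> \<in> carrier V"
    and proper: "\<forall>F. (\<forall>\<^sub>F g in F. g \<in> carrier G) \<and>
             (\<forall>B. group_bounded G T B \<longrightarrow> (\<forall>\<^sub>F g in F. g \<notin> B)) \<longrightarrow>
           filterlim (\<lambda>g. sqrt (ip (\<phi> g \<xi>) (\<phi> g \<xi>))) at_top F"
    using haag unfolding haagerup_def by (elim exE conjE bexE) (rule that; assumption)
  interpret V: real_hilbert_space V ip by (rule V)
  interpret MS: Metric_space "carrier V" "hilbert_dist V ip" by (rule V.Metric_space_hilbert_dist)
  interpret group_action G "carrier V" \<phi> by (rule act)
  let ?d = "hilbert_dist V ip"
  define p where "p g = \<phi> g \<xi>" for g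
  define D where "D g h = ?d (p g) (p h)" for g h
  have pV: "p g \<in> carrier V" if "g \<in> carrier G" for g
    unfolding p_def using element_image[OF that \<xi>] by blast
  have p_mult: "p (g \<otimes>\<^bsub>G\<^esub> h) = \<phi> g (p h)" if "g \<in> carrier G" "h \<in> carrier G" for g h
    unfolding p_def using composition_rule[OF \<xi> that] by simp
  have Dinv: "D (g \<otimes>\<^bsub>G\<^esub> x) (g \<otimes>\<^bsub>G\<^esub> y) = D x y" if "g \<in> carrier G" "x \<in> carrier G" "y \<in> carrier G" for g x y
    using that iso pV by (simp add: D_def p_mult)
  have lip: "left_invariant_pseudometric G D"
    unfolding left_invariant_pseudometric_def
    using Dinv MS.triangle pV by (auto simp: D_def MS.commute)
  have cp: "continuous_map T MS.mtopology p"
  proof -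
    have "continuous_map T (prod_topology T MS.mtopology) (\<lambda>g. (g, \<xi>))"
      by (intro continuous_map_pairedI) (auto simp: \<xi>)
    from continuous_map_compose[OF this cont] show ?thesis by (simp add: p_def[abs_def] o_def)
  qed
  have cD: "continuous_map (prod_topology T T) euclideanreal (\<lambda>(x, y). D x y)"
    using continuous_map_mdist[of "prod_topology T T" "metric (carrier V, ?d)" "p \<circ> fst" "p \<circ> snd"]
      continuous_map_compose[OF continuous_map_fst[of T T] cp] continuous_map_compose[OF continuous_map_snd[of T T] cp]
    by (simp add: D_def case_prod_unfold MS.mtopology_of)
  have one: "\<one>\<^bsub>G\<^esub> \<in> carrier G" by simp
  have Done: "D x y = D \<one>\<^bsub>G\<^esub> (inv\<^bsub>G\<^esub> x \<otimes>\<^bsub>G\<^esub> y)" if "x \<in> carrier G" "y \<in> carrier G" for x y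
    using Dinv[of "inv\<^bsub>G\<^esub> x" x y] that by simp
  have sub: "group_bounded G T {g \<in> carrier G. sqrt (ip (p g) (p g)) \<le> C}" for C
    unfolding p_def by (rule bounded_sublevel) (use proper in blast)
  have norm_le: "sqrt (ip v v) \<le> ?d w v + sqrt (ip w w)" if "v \<in> carrier V" "w \<in> carrier V" for v w
  proof -
    have m0: "\<ominus>\<^bsub>V\<^esub> \<zero>\<^bsub>V\<^esub> = \<zero>\<^bsub>V\<^esub>" by (rule V.M.minus_equality) simp_all
    have "u \<ominus>\<^bsub>V\<^esub> \<zero>\<^bsub>V\<^esub> = u" if "u \<in> carrier V" for u
      unfolding a_minus_def m0 by (rule V.M.r_zero[OF that])
    then have "?d v \<zero>\<^bsub>V\<^esub> = sqrt (ip v v)" "?d w \<zero>\<^bsub>V\<^esub> = sqrt (ip w w)"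
      using that by (simp_all add: hilbert_dist_def)
    then show ?thesis using MS.triangle[of v w "\<zero>\<^bsub>V\<^esub>"] MS.commute[of v w] that by simp
  qed
  have "coarse_embedding (carrier G) (group_controlled G T)
        (carrier V) (metric_controlled (carrier V) (hilbert_dist V ip)) p"
    unfolding coarse_embedding_def
  proof (intro conjI allI impI)
    show "p ` carrier G \<subseteq> carrier V" using pV by blast
  next
    fix E assume "group_controlled G T E"
    then have E: "E \<subseteq> carrier G \<times> carrier G" and
      b: "group_bounded G T {inv\<^bsub>G\<^esub> x \<otimes>\<^bsub>G\<^esub> y | x y. (x, y) \<in> E}" (is "group_bounded G T ?B")
      by (auto simp: group_controlled_def)
    \<comment> \<open>A bounded set bounds distances between its own elements, while distances from
      the identity are wanted; hence the identity is added.\<close>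
    have "group_bounded G T {\<one>\<^bsub>G\<^esub>}" by (auto simp: group_bounded_def)
    note b' = group_bounded_Un[OF this b]
    obtain C where C: "\<And>x y. x \<in> {\<one>\<^bsub>G\<^esub>} \<union> ?B \<Longrightarrow> y \<in> {\<one>\<^bsub>G\<^esub>} \<union> ?B \<Longrightarrow> D x y \<le> C"
      by (rule group_boundedD[OF b' lip cD]) (rule that, assumption)
    have "D x y \<le> C" if "(x, y) \<in> E" for x y
    proof -
      have "x \<in> carrier G" "y \<in> carrier G" using that E by auto
      then show ?thesis unfolding Done[OF \<open>x \<in> carrier G\<close> \<open>y \<in> carrier G\<close>] using that by (intro C) blast+
    qed
    then show "metric_controlled (carrier V) ?d (map_prod p p ` E)"
      unfolding metric_controlled_def using E pV by (intro conjI exI[of _ C]) (auto simp: D_def)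
  next
    fix E assume "metric_controlled (carrier V) ?d E"
    then obtain C where "\<forall>(x, y)\<in>E. ?d x y \<le> C" unfolding metric_controlled_def by blast
    then have C: "?d x y \<le> C" if "(x, y) \<in> E" for x y using that by auto
    let ?E = "map_prod p p -` E \<inter> carrier G \<times> carrier G"
    have "{inv\<^bsub>G\<^esub> x \<otimes>\<^bsub>G\<^esub> y | x y. (x, y) \<in> ?E}
        \<subseteq> {g \<in> carrier G. sqrt (ip (p g) (p g)) \<le> C + sqrt (ip (p \<one>\<^bsub>G\<^esub>) (p \<one>\<^bsub>G\<^esub>))}"
    proof clarsimp
      fix x y assume xy: "(p x, p y) \<in> E" "x \<in> carrier G" "y \<in> carrier G"
      have "D \<one>\<^bsub>G\<^esub> (inv\<^bsub>G\<^esub> x \<otimes>\<^bsub>G\<^esub> y) \<le> C" using Done[OF xy(2,3)] C[OF xy(1)] by (simp add: D_def)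
      then show "sqrt (ip (p (inv\<^bsub>G\<^esub> x \<otimes>\<^bsub>G\<^esub> y)) (p (inv\<^bsub>G\<^esub> x \<otimes>\<^bsub>G\<^esub> y))) \<le> C + sqrt (ip (p \<one>\<^bsub>G\<^esub>) (p \<one>\<^bsub>G\<^esub>))"
        using norm_le[OF pV pV, of "inv\<^bsub>G\<^esub> x \<otimes>\<^bsub>G\<^esub> y" "\<one>\<^bsub>G\<^esub>"] xy by (simp add: D_def)
    qed
    then show "group_controlled G T ?E"
      unfolding group_controlled_def using group_bounded_subset[OF sub] by blast
  qed
  then show ?thesis using V unfolding coarsely_embeds_in_hilbert_def by blast
qed

section \<open>The embedding of finitely supported sequences\<close>

text \<open>Subtracting the value at \<open>\<xi>\<^sub>0\<close> removes the additive constant left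
  free in a logarithm on \<open>C\<close>; the values at the peaks then return the
  coefficients.\<close>

locale bump_family =
  fixes C :: "'x::topological_space set" and \<xi>\<^sub>0 :: 'x and \<xi> :: "nat \<Rightarrow> 'x" and g :: "nat \<Rightarrow> 'x \<Rightarrow>\<^sub>C real"
  assumes conn: "connected C" and base: "\<xi>\<^sub>0 \<in> C" and peak: "\<xi> k \<in> C"
    and g_base: "g k \<xi>\<^sub>0 = 0" and g_peak: "g k (\<xi> l) = of_bool (k = l)"
    and g_bound: "\<bar>g k x\<bar> \<le> 2" and g_disjoint: "g k x \<noteq> 0 \<Longrightarrow> g l x \<noteq> 0 \<Longrightarrow> k = l"

text \<open>A Urysohn function separating two points of \<open>C\<close> takes every value
  \<open>1 / Suc k\<close> on \<open>C\<close> by connectedness; the bumps are composed with it. The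
  shift to \<open>Suc k\<close> avoids \<open>bump 0\<close>, which is identically 0.\<close>

lemma not_totally_disconnected_imp_bump_family:
  assumes X: "compact (UNIV :: 'x::t2_space set)" and ntd: "\<not> totally_disconnected (UNIV :: 'x::t2_space set)"
  obtains C :: "'x::t2_space set" and \<xi>\<^sub>0 \<xi> g where "bump_family C \<xi>\<^sub>0 \<xi> g"
proof -
  obtain C :: "'x::t2_space set" where C: "connected C" "\<And>x. \<not> C \<subseteq> {x}"
    using ntd unfolding totally_disconnected_def by blast
  then obtain p q where pq: "p \<in> C" "q \<in> C" "p \<noteq> q" by blast
  let ?X = "euclidean :: 'x::t2_space topology"
  have "normal_space ?X"
    using compact_Hausdorff_or_regular_imp_normal_space[of ?X] X
      Hausdorff_space_euclidean_t2[where ?'x = 'x]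
    by (simp add: compact_space_def)
  then obtain f where f: "continuous_map ?X euclideanreal f" "f ` {p} \<subseteq> {0::real}" "f ` {q} \<subseteq> {1}"
    by (rule Urysohn_lemma_alt[of ?X "{p}" "{q}" 0 1]) (use pq in \<open>auto simp: disjnt_def\<close>)
  have cf: "continuous_on UNIV f" using f(1) by simp
  have "connected (f ` C)" by (intro connected_continuous_image C continuous_on_subset[OF cf]) auto
  moreover have "0 \<in> f ` C" "1 \<in> f ` C" using f(2,3) pq by force+
  ultimately have "{0..1} \<subseteq> f ` C" by (rule connected_contains_Icc)
  moreover have "1 / real (Suc k) \<in> {0..1}" for k by simp
  ultimately have "1 / real (Suc k) \<in> f ` C" for k by blast
  then have "\<exists>x\<in>C. f x = 1 / real (Suc k)" for k by (metis imageE)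
  then obtain \<xi> where \<xi>: "\<And>k. \<xi> k \<in> C" "\<And>k. f (\<xi> k) = 1 / real (Suc k)" by metis
  have "(\<lambda>x. bump (Suc k) (f x)) \<in> bcontfun" for k
  proof (rule bcontfun_normI)
    show "continuous_on UNIV (\<lambda>x. bump (Suc k) (f x))"
      by (rule continuous_on_compose2[OF continuous_on_bump[of UNIV] cf]) auto
    show "norm (bump (Suc k) (f x)) \<le> 2" for x
      using bump_nonneg bump_le_2[of "Suc k" "f x"] by simp
  qed
  then have g: "apply_bcontfun (Bcontfun (\<lambda>x. bump (Suc k) (f x))) = (\<lambda>x. bump (Suc k) (f x))" for k
    by (rule Bcontfun_inverse)
  have "bump_family C p \<xi> (\<lambda>k. Bcontfun (\<lambda>x. bump (Suc k) (f x)))"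
  proof (unfold_locales, unfold g)
    show "bump (Suc k) (f p) = 0" for k using f(2) bump_0 by simp
    show "bump (Suc k) (f (\<xi> l)) = of_bool (k = l)" for k l
    proof (cases "k = l")
      case True
      then show ?thesis using bump_at[of "Suc k"] \<xi>(2)[of l] by simp
    next
      case False
      then show ?thesis using bump_disjoint[of "Suc k" "f (\<xi> l)" "Suc l"] bump_at[of "Suc l"] \<xi>(2)[of l] by force
    qed
    show "\<bar>bump (Suc k) (f x)\<bar> \<le> 2" for k x
      using bump_nonneg bump_le_2[of "Suc k" "f x"] by simp
    show "k = l" if "bump (Suc k) (f x) \<noteq> 0" "bump (Suc l) (f x) \<noteq> 0" for k l x
      using bump_disjoint[OF that] by simp
  qed (use C \<xi> pq in auto)
  then show thesis by (rule that)
qed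

context bump_family
begin

definition comb :: "(nat \<Rightarrow> real) \<Rightarrow> ('x \<Rightarrow>\<^sub>C real)" where
  "comb c = (\<Sum>k | c k \<noteq> 0. c k *\<^sub>R g k)"

definition emb :: "(nat \<Rightarrow> real) \<Rightarrow> ('x \<Rightarrow>\<^sub>C complex)" where
  "emb c = cis_bcontfun (comb c)"

lemma apply_sum_bcontfun: "apply_bcontfun (\<Sum>k\<in>K. f k) x = (\<Sum>k\<in>K. apply_bcontfun (f k) x)"
  for f :: "nat \<Rightarrow> 'x \<Rightarrow>\<^sub>C real"
  by (induction K rule: infinite_finite_induct) auto

lemma comb_apply:
  assumes "finite K" "\<And>k. c k \<noteq> 0 \<Longrightarrow> k \<in> K"
  shows "comb c x = (\<Sum>k\<in>K. c k * g k x)"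
  unfolding comb_def apply_sum_bcontfun
  by (simp, rule sum.mono_neutral_left) (use assms in auto)

lemma comb_diff:
  assumes "c \<in> finsupp" "c' \<in> finsupp"
  shows "comb c' - comb c = comb (\<lambda>k. c' k - c k)"
proof (rule bcontfun_eqI)
  fix x
  let ?K = "{k. c k \<noteq> 0} \<union> {k. c' k \<noteq> 0}"
  have "finite ?K" using assms by (simp add: finsupp_def)
  then show "apply_bcontfun (comb c' - comb c) x = apply_bcontfun (comb (\<lambda>k. c' k - c k)) x"
    using comb_apply[of ?K c x] comb_apply[of ?K c' x] comb_apply[of ?K "\<lambda>k. c' k - c k" x]
    by (simp add: sum_subtractf left_diff_distrib)
qed

lemma finsupp_diff: "c \<in> finsupp \<Longrightarrow> c' \<in> finsupp \<Longrightarrow> (\<lambda>k. c' k - c k) \<in> finsupp"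
  unfolding finsupp_def by (simp, rule finite_subset[of _ "{k. c k \<noteq> 0} \<union> {k. c' k \<noteq> 0}"]) auto

lemma comb_peak: "c \<in> finsupp \<Longrightarrow> comb c (\<xi> l) = c l"
  using comb_apply[of "{k. c k \<noteq> 0} \<union> {l}" c "\<xi> l"]
  by (simp add: finsupp_def g_peak of_bool_def if_distrib sum.delta cong: if_cong)

lemma comb_base: "comb c \<xi>\<^sub>0 = 0"
  by (simp add: comb_def apply_sum_bcontfun g_base)

text \<open>The supports are disjoint, so at each point at most one term survives and the bound is
  independent of the number of terms.\<close>

lemma norm_comb_le:
  assumes c: "c \<in> finsupp" and R: "\<And>k. \<bar>c k\<bar> \<le> R"
  shows "norm (comb c) \<le> 2 * R"
proof -
  have R0: "0 \<le> R" using R[of 0] by linarith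
  have fin: "finite {k. c k \<noteq> 0}" using c by (simp add: finsupp_def)
  have "\<bar>comb c x\<bar> \<le> 2 * R" for x
  proof (cases "\<exists>k. c k \<noteq> 0 \<and> g k x \<noteq> 0")
    case True
    then obtain k where k: "c k \<noteq> 0" "g k x \<noteq> 0" by blast
    have "comb c x = (\<Sum>l\<in>{k}. c l * g l x)"
      unfolding comb_apply[OF fin, of c x, simplified]
      by (rule sum.mono_neutral_right) (use fin k g_disjoint in auto)
    then have "\<bar>comb c x\<bar> = \<bar>c k\<bar> * \<bar>g k x\<bar>" by (simp add: abs_mult)
    also have "\<dots> \<le> R * 2" using R g_bound R0 by (intro mult_mono) auto
    finally show ?thesis by simp
  next
    case False
    then have "comb c x = 0"
      unfolding comb_apply[OF fin, of c x, simplified] by (intro sum.neutral) auto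
    then show ?thesis using R0 by simp
  qed
  then show ?thesis by (simp add: norm_le_bcontfun_iff)
qed

lemma inv_mult_emb:
  assumes "G \<in> unitary_groups" "c \<in> finsupp" "c' \<in> finsupp"
  shows "inv\<^bsub>G\<^esub> (emb c) \<otimes>\<^bsub>G\<^esub> emb c' = emb (\<lambda>k. c' k - c k)"
  using assms by (simp add: emb_def inv_mult_cis_bcontfun comb_diff)

lemma cel_dist_emb_le:
  assumes "c \<in> finsupp" "c' \<in> finsupp" "\<And>k. \<bar>c k - c' k\<bar> \<le> R"
  shows "cel_dist (emb c) (emb c') \<le> 2 * R"
proof -
  have "cel_dist (emb c) (emb c') \<le> norm (comb (\<lambda>k. c' k - c k))"
    using cel_cis_bcontfun_le by (simp add: emb_def cel_dist_cis_bcontfun comb_diff assms)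
  also have "\<dots> \<le> 2 * R"
    using assms by (intro norm_comb_le finsupp_diff) (simp_all add: abs_minus_commute)
  finally show ?thesis .
qed

text \<open>Every logarithm of the quotient has the same increment from \<open>\<xi>\<^sub>0\<close>
  to \<open>\<xi> k\<close>, and an increment is at most twice the norm.\<close>

lemma le_cel_dist_emb:
  assumes "c \<in> finsupp" "c' \<in> finsupp"
  shows "\<bar>c k - c' k\<bar> / 2 \<le> cel_dist (emb c) (emb c')"
proof -
  let ?h = "comb (\<lambda>k. c' k - c k)"
  have "\<bar>c k - c' k\<bar> / 2 \<le> norm h" if "cis_bcontfun h = cis_bcontfun ?h" for h
  proof -
    have "h (\<xi> k) - h \<xi>\<^sub>0 = c' k - c k"
      using cis_bcontfun_eq_imp_diff_constant[OF that conn peak base]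
        comb_peak[OF finsupp_diff[OF assms]] comb_base by simp
    moreover have "\<bar>h (\<xi> k)\<bar> \<le> norm h" "\<bar>h \<xi>\<^sub>0\<bar> \<le> norm h"
      using norm_bounded[of h] by auto
    moreover have "\<bar>h (\<xi> k) - h \<xi>\<^sub>0\<bar> \<le> \<bar>h (\<xi> k)\<bar> + \<bar>h \<xi>\<^sub>0\<bar>" by (rule abs_triangle_ineq4)
    ultimately have "\<bar>c' k - c k\<bar> \<le> 2 * norm h" by simp
    then show ?thesis by (simp add: abs_minus_commute)
  qed
  then show ?thesis
    unfolding emb_def cel_dist_cis_bcontfun comb_diff[OF assms] by (rule le_cel_cis_bcontfun)
qed

section \<open>Coordinates for arbitrary unitaries\<close>

context
  includes bcontfun.lifting
begin

text \<open>As \<open>nat\<close> is discrete, the target is the space of all bounded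
  sequences.\<close>

lift_definition coord :: "('x \<Rightarrow>\<^sub>C real) \<Rightarrow> (nat \<Rightarrow>\<^sub>C real)" is "\<lambda>h k. h (\<xi> k) - h \<xi>\<^sub>0"
proof -
  fix h :: "'x \<Rightarrow> real" assume "h \<in> bcontfun"
  then obtain b where b: "\<And>x. \<bar>h x\<bar> \<le> b" by (auto simp: bcontfun_def bounded_iff)
  show "(\<lambda>k. h (\<xi> k) - h \<xi>\<^sub>0) \<in> bcontfun"
  proof (rule bcontfun_normI)
    fix k
    show "norm (h (\<xi> k) - h \<xi>\<^sub>0) \<le> b + b" using b[of "\<xi> k"] b[of \<xi>\<^sub>0] by simp
  qed (simp add: continuous_on_open_vimage open_discrete)
qed

end

lemma coord_add: "coord (a + b) = coord a + coord b"
  by (rule bcontfun_eqI) (simp add: coord.rep_eq)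

lemma norm_coord_le: "norm (coord h) \<le> 2 * norm h"
proof -
  have "\<bar>h (\<xi> k) - h \<xi>\<^sub>0\<bar> \<le> 2 * norm h" for k
    using norm_bounded[of h "\<xi> k"] norm_bounded[of h \<xi>\<^sub>0] by simp
  then show ?thesis by (simp add: norm_le_bcontfun_iff coord.rep_eq)
qed

lemma coord_cong:
  assumes "cis_bcontfun a = cis_bcontfun b"
  shows "coord a = coord b"
proof (rule bcontfun_eqI)
  fix k
  show "coord a k = coord b k"
    unfolding coord.rep_eq by (rule cis_bcontfun_eq_imp_diff_constant[OF assms conn peak base])
qed

text \<open>Unitaries without a logarithm still receive coordinates, because the additive group of
  bounded sequences is divisible.\<close>

lemma coordinate_hom:
  obtains r :: "('x \<Rightarrow>\<^sub>C complex) \<Rightarrow> (nat \<Rightarrow>\<^sub>C real)"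
  where "\<And>u v. u \<in> carrier unitary_group \<Longrightarrow> v \<in> carrier unitary_group \<Longrightarrow> r (u * v) = r u + r v"
    and "\<And>h. r (cis_bcontfun h) = coord h"
proof -
  interpret U: comm_group "unitary_group :: ('x \<Rightarrow>\<^sub>C complex) monoid" by (rule comm_group_unitary_group)
  have U: "(unitary_group :: ('x \<Rightarrow>\<^sub>C complex) monoid) \<in> unitary_groups" by (simp add: unitary_groups_def)
  note UD = unitary_groupsD[OF U]
  define r\<^sub>0 where "r\<^sub>0 u = coord (SOME h. u = cis_bcontfun h)" for u :: "'x \<Rightarrow>\<^sub>C complex"
  have r0: "r\<^sub>0 (cis_bcontfun h) = coord h" for h
    unfolding r\<^sub>0_def by (rule coord_cong) (metis (mono_tags, lifting) someI)
  have H: "subgroup (range (cis_bcontfun :: ('x \<Rightarrow>\<^sub>C real) \<Rightarrow> _)) unitary_group"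
  proof (rule U.subgroupI)
    show "range (cis_bcontfun :: ('x \<Rightarrow>\<^sub>C real) \<Rightarrow> _) \<subseteq> carrier unitary_group"
      using cis_bcontfun_in_unitary_groups[OF U] by blast
    show "inv\<^bsub>unitary_group\<^esub> u \<in> range cis_bcontfun" if "u \<in> range cis_bcontfun" for u :: "'x \<Rightarrow>\<^sub>C complex"
      using that cis_bcontfun_in_unitary_groups[OF U] by (auto simp: inv_unitary_group adjoint_cis_bcontfun)
    show "u \<otimes>\<^bsub>unitary_group\<^esub> v \<in> range cis_bcontfun"
      if "u \<in> range cis_bcontfun" "v \<in> range cis_bcontfun" for u v :: "'x \<Rightarrow>\<^sub>C complex"
      using that by (auto simp: UD(3) simp flip: cis_bcontfun_add)
  qed auto
  have "r\<^sub>0 (u \<otimes>\<^bsub>unitary_group\<^esub> v) = r\<^sub>0 u + r\<^sub>0 v"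
    if uv: "u \<in> range cis_bcontfun" "v \<in> range cis_bcontfun" for u v :: "'x \<Rightarrow>\<^sub>C complex"
  proof -
    obtain a b where "u = cis_bcontfun a" "v = cis_bcontfun b" using uv by blast
    then show ?thesis by (simp add: UD(3) r0 coord_add flip: cis_bcontfun_add)
  qed
  from U.extend_hom_to_real_vector[OF H this] obtain r where
    r: "\<And>u v. u \<in> carrier unitary_group \<Longrightarrow> v \<in> carrier unitary_group \<Longrightarrow> r (u \<otimes>\<^bsub>unitary_group\<^esub> v) = r u + r v"
      "\<And>u. u \<in> range cis_bcontfun \<Longrightarrow> r u = r\<^sub>0 u" by (metis (no_types))
  show thesis by (rule that[of r]) (use r r0 UD(3) in auto)
qed

text \<open>The homomorphism \<open>r\<close> of \<open>coordinate_hom\<close> gives the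
  left-invariant pseudometric \<open>norm (r u - r v)\<close>. It is continuous because
  \<open>r v - r u\<close> is the value at \<open>adjoint_bcontfun u * v\<close>, which for
  \<open>v\<close> near \<open>u\<close> is a small exponential. On the image of \<open>emb\<close>
  this pseudometric sees every coefficient.\<close>

lemma group_bounded_emb:
  assumes G: "G \<in> unitary_groups" and B: "group_bounded G (norm_topology G) B"
  obtains R where "\<And>c k. c \<in> finsupp \<Longrightarrow> emb c \<in> B \<Longrightarrow> \<bar>c k\<bar> \<le> R"
proof -
  obtain r where hom: "\<And>u v. u \<in> carrier unitary_group \<Longrightarrow> v \<in> carrier unitary_group \<Longrightarrow> r (u * v) = r u + r v"
    and cis: "\<And>h. r (cis_bcontfun h) = coord h"
    by (rule coordinate_hom) (rule that; assumption)
  define D where "D u v = norm (r u - r v)" for u v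
  note GD = unitary_groupsD[OF G]
  have lip: "left_invariant_pseudometric G D"
    unfolding left_invariant_pseudometric_def
  proof (intro conjI ballI)
    show "D x z \<le> D x y + D y z" for x y z
      unfolding D_def using norm_triangle_ineq[of "r x - r y" "r y - r z"] by simp
    show "D (u \<otimes>\<^bsub>G\<^esub> x) (u \<otimes>\<^bsub>G\<^esub> y) = D x y" if "u \<in> carrier G" "x \<in> carrier G" "y \<in> carrier G" for u x y
    proof -
      have "u \<in> carrier unitary_group" "x \<in> carrier unitary_group" "y \<in> carrier unitary_group"
        using that GD(2) by auto
      then show ?thesis by (simp add: GD(3) D_def hom)
    qed
  qed (simp_all add: D_def norm_minus_commute)
  have "continuous_on (carrier unitary_group) r"
    unfolding continuous_on_iff
  proof (intro ballI allI impI)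
    fix u :: "'x \<Rightarrow>\<^sub>C complex" and e :: real
    assume u: "u \<in> carrier unitary_group" and e: "e > 0"
    show "\<exists>d>0. \<forall>v\<in>carrier unitary_group. dist v u < d \<longrightarrow> dist (r v) (r u) < e"
    proof (intro exI conjI ballI impI)
      \<comment> \<open>The bound \<open>1/2\<close> is for \<open>near_one_imp_cis\<close>; the
        factor 4 combines its bound on the logarithm with \<open>norm_coord_le\<close>.\<close>
      show "min (1 / 2) (e / 4) > 0" using e by simp
      fix v :: "'x \<Rightarrow>\<^sub>C complex"
      assume v: "v \<in> carrier unitary_group" and d: "dist v u < min (1 / 2) (e / 4)"
      let ?w = "adjoint_bcontfun u * v"
      have nu: "norm (apply_bcontfun u x) = 1" and nv: "norm (apply_bcontfun v x) = 1" for x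
        using u v by (auto simp: in_unitary_group_iff)
      have w: "?w \<in> carrier unitary_group" using nu nv by (simp add: in_unitary_group_iff norm_mult)
      have one: "u * adjoint_bcontfun u = 1" "adjoint_bcontfun u * u = 1"
        using u by (simp_all add: unitary_group_def)
      have uw: "u * ?w = v" using one by (simp add: mult.assoc[symmetric])
      have "?w - 1 = adjoint_bcontfun u * (v - u)" using one by (simp add: right_diff_distrib)
      then have "norm (?w - 1) \<le> norm (adjoint_bcontfun u) * norm (v - u)"
        by (simp add: norm_mult_ineq)
      also have "\<dots> \<le> 1 * norm (v - u)"
        using nu by (intro mult_right_mono) (auto simp: norm_adjoint norm_le_bcontfun_iff)
      finally have wd: "norm (?w - 1) < min (1 / 2) (e / 4)" using d by (simp add: dist_norm)
      then obtain h where h: "?w = cis_bcontfun h" "norm h \<le> 2 * norm (?w - 1)"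
        using near_one_imp_cis[OF w] by auto
      have "r v = r u + coord h" using hom[OF u w] h(1) uw cis by simp
      then have "dist (r v) (r u) \<le> 2 * norm h" using norm_coord_le by (simp add: dist_norm)
      then show "dist (r v) (r u) < e" using h(2) wd by simp
    qed
  qed
  then have cr: "continuous_on (carrier G) r" using GD(2) by (rule continuous_on_subset)
  have "continuous_on (carrier G \<times> carrier G) (\<lambda>p. norm (r (fst p) - r (snd p)))"
    by (intro continuous_intros continuous_on_compose2[OF cr]) auto
  then have cont: "continuous_map (prod_topology (norm_topology G) (norm_topology G)) euclideanreal (\<lambda>(x, y). D x y)"
    by (simp add: prod_norm_topology D_def case_prod_unfold)
  obtain K where K: "\<And>x y. x \<in> B \<Longrightarrow> y \<in> B \<Longrightarrow> D x y \<le> K"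
    by (rule group_boundedD[OF B lip cont]) (rule that, assumption)
  show thesis
  \<comment> \<open>\<open>B\<close> need not contain the identity, so coefficients are compared
    with those of some fixed element of the image in \<open>B\<close>.\<close>
  proof (cases "\<exists>c\<in>finsupp. emb c \<in> B")
    case True
    then obtain c\<^sub>0 where c0: "c\<^sub>0 \<in> finsupp" "emb c\<^sub>0 \<in> B" by blast
    show thesis
    proof (rule that)
      fix c k assume c: "c \<in> finsupp" "emb c \<in> B"
      have "\<bar>c k\<bar> = norm (coord (comb c) k)"
        using comb_peak[OF c(1)] comb_base by (simp add: coord.rep_eq)
      also have "\<dots> \<le> norm (coord (comb c))" by (rule norm_bounded)
      also have "\<dots> \<le> norm (coord (comb c\<^sub>0)) + norm (coord (comb c) - coord (comb c\<^sub>0))"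
        by (rule norm_triangle_sub)
      also have "norm (coord (comb c) - coord (comb c\<^sub>0)) \<le> K"
        using K[OF c(2) c0(2)] by (simp add: D_def emb_def cis)
      finally show "\<bar>c k\<bar> \<le> norm (coord (comb c\<^sub>0)) + K" by simp
    qed
  next
    case False
    then show thesis using that[of 0] by blast
  qed
qed

lemma emb_in_carrier: "G \<in> unitary_groups \<Longrightarrow> emb c \<in> carrier G"
  unfolding emb_def by (rule cis_bcontfun_in_unitary_groups)

lemma group_controlled_embI:
  assumes G: "G \<in> unitary_groups"
    and E: "\<And>p. p \<in> E \<Longrightarrow> \<exists>c\<in>finsupp. \<exists>c'\<in>finsupp. p = (emb c, emb c') \<and> (\<forall>k. \<bar>c k - c' k\<bar> \<le> R)"
  shows "group_controlled G (norm_topology G) E"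
  unfolding group_controlled_def
proof
  show "E \<subseteq> carrier G \<times> carrier G" using E emb_in_carrier[OF G] by fastforce
  have "{inv\<^bsub>G\<^esub> x \<otimes>\<^bsub>G\<^esub> y | x y. (x, y) \<in> E} \<subseteq> {cis_bcontfun h | h. norm h \<le> 2 * R}"
  proof clarify
    fix x y assume "(x, y) \<in> E"
    then obtain c c' where c: "c \<in> finsupp" "c' \<in> finsupp" "x = emb c" "y = emb c'" "\<And>k. \<bar>c k - c' k\<bar> \<le> R"
      using E by blast
    have "inv\<^bsub>G\<^esub> x \<otimes>\<^bsub>G\<^esub> y = cis_bcontfun (comb (\<lambda>k. c' k - c k))"
      using inv_mult_emb[OF G c(1,2)] c(3,4) by (simp add: emb_def)
    moreover have "norm (comb (\<lambda>k. c' k - c k)) \<le> 2 * R"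
      using c by (intro norm_comb_le finsupp_diff) (simp_all add: abs_minus_commute)
    ultimately show "\<exists>h. inv\<^bsub>G\<^esub> x \<otimes>\<^bsub>G\<^esub> y = cis_bcontfun h \<and> norm h \<le> 2 * R" by blast
  qed
  then show "group_bounded G (norm_topology G) {inv\<^bsub>G\<^esub> x \<otimes>\<^bsub>G\<^esub> y | x y. (x, y) \<in> E}"
    by (rule group_bounded_subset[OF group_bounded_cis_bcontfun[OF G]])
qed

lemma group_controlled_embD:
  assumes G: "G \<in> unitary_groups" and E: "group_controlled G (norm_topology G) E"
  obtains R where "\<And>c c' k. c \<in> finsupp \<Longrightarrow> c' \<in> finsupp \<Longrightarrow> (emb c, emb c') \<in> E \<Longrightarrow> \<bar>c k - c' k\<bar> \<le> R"
proof -
  let ?B = "{inv\<^bsub>G\<^esub> x \<otimes>\<^bsub>G\<^esub> y | x y. (x, y) \<in> E}"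
  have B: "group_bounded G (norm_topology G) ?B" using E by (simp add: group_controlled_def)
  obtain R where R: "\<And>c k. c \<in> finsupp \<Longrightarrow> emb c \<in> ?B \<Longrightarrow> \<bar>c k\<bar> \<le> R"
    by (rule group_bounded_emb[OF G B]) (rule that, assumption)
  show thesis
  proof (rule that)
    fix c c' k assume c: "c \<in> finsupp" "c' \<in> finsupp" "(emb c, emb c') \<in> E"
    have "emb (\<lambda>k. c' k - c k) \<in> ?B" using inv_mult_emb[OF G c(1,2)] c(3) by force
    from R[OF finsupp_diff[OF c(1,2)] this, of k] show "\<bar>c k - c' k\<bar> \<le> R" by (simp add: abs_minus_commute)
  qed
qed

section \<open>Universality and failure of Hilbert space embeddings\<close>

lemma qi_universal_unitary_group0:
  "qi_universal (carrier (unitary_group0 :: ('x \<Rightarrow>\<^sub>C complex) monoid)) cel_dist"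
  unfolding qi_universal_def
proof (intro allI impI, elim conjE)
  fix M :: "(nat \<Rightarrow> real) set" and d
  assume M: "Metric_space M d" and sep: "separable_space (Metric_space.mtopology M d)"
  interpret Metric_space M d by (rule M)
  obtain c :: "(nat \<Rightarrow> real) \<Rightarrow> nat \<Rightarrow> real" where c: "c ` M \<subseteq> finsupp"
    "\<And>x y k. x \<in> M \<Longrightarrow> y \<in> M \<Longrightarrow> \<bar>c x k - c y k\<bar> \<le> d x y"
    "\<And>x y. x \<in> M \<Longrightarrow> y \<in> M \<Longrightarrow> \<exists>k. d x y / 16 - 1 \<le> \<bar>c x k - c y k\<bar>"
    by (rule aharoni_quasi_isometric[OF sep]) (rule that; assumption)
  have G: "(unitary_group0 :: ('x \<Rightarrow>\<^sub>C complex) monoid) \<in> unitary_groups" by (simp add: unitary_groups_def)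
  have "quasi_isometric_embedding M d (carrier (unitary_group0 :: ('x \<Rightarrow>\<^sub>C complex) monoid)) cel_dist (\<lambda>x. emb (c x))"
    unfolding quasi_isometric_embedding_def
  \<comment> \<open>The lower estimate \<open>1/16\<close> is halved by
    \<open>le_cel_dist_emb\<close>; the resulting 32 is ample for the other constants too.\<close>
  proof (intro conjI exI[of _ 32] ballI)
    fix x y assume xy: "x \<in> M" "y \<in> M"
    then have f: "c x \<in> finsupp" "c y \<in> finsupp" using c(1) by auto
    obtain k where "d x y / 16 - 1 \<le> \<bar>c x k - c y k\<bar>" using c(3)[OF xy] by blast
    then show "d x y / 32 - 32 \<le> cel_dist (emb (c x)) (emb (c y))"
      using le_cel_dist_emb[OF f, of k] by simp
    have "cel_dist (emb (c x)) (emb (c y)) \<le> 2 * d x y" by (rule cel_dist_emb_le[OF f c(2)[OF xy]])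
    then show "cel_dist (emb (c x)) (emb (c y)) \<le> 32 * d x y + 32" using nonneg[of x y] by linarith
  qed (use emb_in_carrier[OF G] in auto)
  then show "\<exists>f. quasi_isometric_embedding M d (carrier (unitary_group0 :: ('x \<Rightarrow>\<^sub>C complex) monoid)) cel_dist f" by blast
qed

lemma coarsely_universal_unitary_groups:
  fixes G :: "('x \<Rightarrow>\<^sub>C complex) monoid"
  assumes G: "G \<in> unitary_groups"
  shows "coarsely_universal (carrier G) (group_controlled G (norm_topology G))"
  unfolding coarsely_universal_def
proof (intro allI impI, elim conjE)
  fix M :: "(nat \<Rightarrow> real) set" and d
  assume M: "Metric_space M d" and sep: "separable_space (Metric_space.mtopology M d)"
  interpret Metric_space M d by (rule M)
  obtain c :: "(nat \<Rightarrow> real) \<Rightarrow> nat \<Rightarrow> real" where c: "c ` M \<subseteq> finsupp"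
    "\<And>x y k. x \<in> M \<Longrightarrow> y \<in> M \<Longrightarrow> \<bar>c x k - c y k\<bar> \<le> d x y"
    "\<And>x y. x \<in> M \<Longrightarrow> y \<in> M \<Longrightarrow> \<exists>k. d x y / 16 - 1 \<le> \<bar>c x k - c y k\<bar>"
    by (rule aharoni_quasi_isometric[OF sep]) (rule that; assumption)
  let ?f = "\<lambda>x. emb (c x)"
  have "coarse_embedding M (metric_controlled M d) (carrier G) (group_controlled G (norm_topology G)) ?f"
    unfolding coarse_embedding_def
  proof (intro conjI allI impI)
    show "?f ` M \<subseteq> carrier G" using emb_in_carrier[OF G] by blast
  next
    fix E assume "metric_controlled M d E"
    then obtain K where E: "E \<subseteq> M \<times> M" and "\<forall>(x, y)\<in>E. d x y \<le> K"
      unfolding metric_controlled_def by blast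
    then have K: "d x y \<le> K" if "(x, y) \<in> E" for x y using that by auto
    show "group_controlled G (norm_topology G) (map_prod ?f ?f ` E)"
    proof (rule group_controlled_embI[OF G])
      fix p assume "p \<in> map_prod ?f ?f ` E"
      then obtain x y where xy: "(x, y) \<in> E" "p = (?f x, ?f y)" by auto
      then have M: "x \<in> M" "y \<in> M" using E by auto
      then have "c x \<in> finsupp" "c y \<in> finsupp" "\<forall>k. \<bar>c x k - c y k\<bar> \<le> K"
        using c(1) order_trans[OF c(2)[OF M] K[OF xy(1)]] by auto
      then show "\<exists>a\<in>finsupp. \<exists>b\<in>finsupp. p = (emb a, emb b) \<and> (\<forall>k. \<bar>a k - b k\<bar> \<le> K)"
        using xy(2) by blast
    qed
  next
    fix E assume E: "group_controlled G (norm_topology G) E"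
    obtain R where R: "\<And>a b k. a \<in> finsupp \<Longrightarrow> b \<in> finsupp \<Longrightarrow> (emb a, emb b) \<in> E \<Longrightarrow> \<bar>a k - b k\<bar> \<le> R"
      by (rule group_controlled_embD[OF G E]) (rule that, assumption)
    have "d x y \<le> 16 * (R + 1)" if xy: "x \<in> M" "y \<in> M" "(?f x, ?f y) \<in> E" for x y
    proof -
      obtain k where "d x y / 16 - 1 \<le> \<bar>c x k - c y k\<bar>" using c(3)[OF xy(1,2)] by blast
      also have "\<dots> \<le> R" using c(1) xy by (intro R) auto
      finally show ?thesis by simp
    qed
    then show "metric_controlled M d (map_prod ?f ?f -` E \<inter> M \<times> M)"
      unfolding metric_controlled_def by (intro conjI exI[of _ "16 * (R + 1)"]) auto
  qed
  then show "\<exists>f. coarse_embedding M (metric_controlled M d) (carrier G) (group_controlled G (norm_topology G)) f"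
    by blast
qed

lemma not_coarsely_embeds_in_hilbert_unitary_groups:
  fixes G :: "('x \<Rightarrow>\<^sub>C complex) monoid"
  assumes G: "G \<in> unitary_groups"
  shows "\<not> coarsely_embeds_in_hilbert G (norm_topology G)"
proof
  assume "coarsely_embeds_in_hilbert G (norm_topology G)"
  then obtain V :: "(real, ('x \<Rightarrow>\<^sub>C complex) \<Rightarrow> real) module" and ip f where V: "real_hilbert_space V ip"
    and f: "coarse_embedding (carrier G) (group_controlled G (norm_topology G))
          (carrier V) (metric_controlled (carrier V) (hilbert_dist V ip)) f"
    unfolding coarsely_embeds_in_hilbert_def by (elim exE conjE) (rule that; assumption)
  interpret V: real_hilbert_space V ip by (rule V)
  let ?d = "hilbert_dist V ip" and ?F = "\<lambda>c. f (emb c)"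
  have F: "?F c \<in> carrier V" for c using f emb_in_carrier[OF G] by (auto simp: coarse_embedding_def)
  let ?E = "{(emb c, emb c') | c c'. c \<in> finsupp \<and> c' \<in> finsupp \<and> (\<forall>k. \<bar>c k - c' k\<bar> \<le> 2)}"
  have "group_controlled G (norm_topology G) ?E"
    by (rule group_controlled_embI[OF G, of _ 2]) blast
  then have "metric_controlled (carrier V) ?d (map_prod f f ` ?E)"
    using f by (simp add: coarse_embedding_def)
  then obtain A where "\<forall>(x, y)\<in>map_prod f f ` ?E. ?d x y \<le> A"
    unfolding metric_controlled_def by blast
  then have A: "?d (?F c) (?F c') \<le> A"
    if "c \<in> finsupp" "c' \<in> finsupp" "\<And>k. \<bar>c k - c' k\<bar> \<le> 2" for c c'
    using that by blast
  let ?E' = "{(x, y). x \<in> carrier V \<and> y \<in> carrier V \<and> ?d x y \<le> 5 * A}"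
  have "metric_controlled (carrier V) ?d ?E'"
    unfolding metric_controlled_def by auto
  from f[unfolded coarse_embedding_def, THEN conjunct2, THEN conjunct2, rule_format, OF this]
  have E': "group_controlled G (norm_topology G) (map_prod f f -` ?E' \<inter> carrier G \<times> carrier G)" .
  obtain R where R: "\<And>c c' k. c \<in> finsupp \<Longrightarrow> c' \<in> finsupp \<Longrightarrow>
      (emb c, emb c') \<in> map_prod f f -` ?E' \<inter> carrier G \<times> carrier G \<Longrightarrow> \<bar>c k - c' k\<bar> \<le> R"
    by (rule group_controlled_embD[OF G E']) (rule that, assumption)
  show False
  proof (rule finsupp_not_coarsely_in_hilbert[OF V.real_inner_product_space_axioms F A])
    fix c c' k assume "c \<in> finsupp" "c' \<in> finsupp" "?d (?F c) (?F c') \<le> 5 * A"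
    then show "\<bar>c k - c' k\<bar> \<le> R" using F emb_in_carrier[OF G] by (intro R) auto
  qed
qed

end

section \<open>The main theorem\<close>

lemma totally_disconnected_imp_group_bounded:
  fixes G :: "('x::t2_space \<Rightarrow>\<^sub>C complex) monoid"
  assumes "compact (UNIV :: 'x set)" "totally_disconnected (UNIV :: 'x set)" and G: "G \<in> unitary_groups"
  shows "group_bounded G (norm_topology G) (carrier G)"
proof (rule group_bounded_subset[OF group_bounded_cis_bcontfun[OF G]])
  show "carrier G \<subseteq> {cis_bcontfun h | h. norm h \<le> 2 * pi}"
  proof
    fix u assume "u \<in> carrier G"
    then have "u \<in> carrier unitary_group" using unitary_groupsD(2)[OF G] by blast
    then obtain h where "u = cis_bcontfun h" "norm h \<le> 2 * pi"
      by (rule totally_disconnected_imp_cis[OF assms(1,2)])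
    then show "u \<in> {cis_bcontfun h | h. norm h \<le> 2 * pi}" by blast
  qed
qed

lemma separable_space_real: "separable_space (Metric_space.mtopology UNIV (dist :: real \<Rightarrow> real \<Rightarrow> real))"
proof -
  obtain T :: "real set" where "countable T" "UNIV \<subseteq> closure T" using separable[of UNIV] by auto
  then show ?thesis
    unfolding separable_space_def mtopology_is_euclidean
    by (intro exI[of _ T]) auto
qed

text \<open>The real line has infinite diameter, whereas every quotient of two elements has a
  logarithm of norm at most \<open>2 * pi\<close>.\<close>

lemma totally_disconnected_imp_not_qi_universal:
  assumes "compact (UNIV :: 'x::t2_space set)" "totally_disconnected (UNIV :: 'x::t2_space set)"
  shows "\<not> qi_universal (carrier (unitary_group0 :: ('x \<Rightarrow>\<^sub>C complex) monoid)) cel_dist"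
proof
  let ?U = "unitary_group0 :: ('x \<Rightarrow>\<^sub>C complex) monoid"
  assume "qi_universal (carrier ?U) cel_dist"
  then obtain f where "quasi_isometric_embedding (UNIV :: real set) dist (carrier ?U) cel_dist f"
    using qi_universalD[OF _ Met_TC.Metric_space_axioms separable_space_real] by blast
  then obtain K L where f: "range f \<subseteq> carrier ?U" and K: "K > 0"
    and le: "\<And>x y. dist x y / K - L \<le> cel_dist (f x) (f y)"
    unfolding quasi_isometric_embedding_def by blast
  have G: "?U \<in> unitary_groups" by (simp add: unitary_groups_def)
  interpret group ?U by (rule unitary_groupsD[OF G])
  have bd: "cel_dist u v \<le> 2 * pi" if uv: "u \<in> carrier ?U" "v \<in> carrier ?U" for u v
  proof -
    have "inv\<^bsub>?U\<^esub> u \<otimes>\<^bsub>?U\<^esub> v \<in> carrier unitary_group"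
      using uv unitary_groupsD(2)[OF G] by blast
    then obtain h where "inv\<^bsub>?U\<^esub> u \<otimes>\<^bsub>?U\<^esub> v = cis_bcontfun h" "norm h \<le> 2 * pi"
      by (rule totally_disconnected_imp_cis[OF assms])
    then show ?thesis using cel_cis_bcontfun_le[of h] by (simp add: cel_dist_def)
  qed
  obtain t :: nat where "real t > K * (L + 2 * pi)" using reals_Archimedean2 by blast
  then have "real t / K > L + 2 * pi" using K by (simp add: field_simps)
  moreover have "dist (real t) 0 / K - L \<le> 2 * pi"
    using le[of "real t" 0] bd[of "f (real t)" "f 0"] f by (simp add: image_subset_iff)
  ultimately show False by simp
qed

lemma totally_disconnected_imp_not_coarsely_universal:
  assumes "compact (UNIV :: 'x::t2_space set)" "totally_disconnected (UNIV :: 'x::t2_space set)"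
    and G: "(G :: ('x \<Rightarrow>\<^sub>C complex) monoid) \<in> unitary_groups"
  shows "\<not> coarsely_universal (carrier G) (group_controlled G (norm_topology G))"
proof
  assume "coarsely_universal (carrier G) (group_controlled G (norm_topology G))"
  then obtain f where f: "coarse_embedding (UNIV :: real set) (metric_controlled UNIV dist)
      (carrier G) (group_controlled G (norm_topology G)) f"
    using coarsely_universalD[OF _ Met_TC.Metric_space_axioms separable_space_real] by blast
  interpret group G by (rule unitary_groupsD[OF G])
  have "group_controlled G (norm_topology G) (carrier G \<times> carrier G)"
    unfolding group_controlled_def
    by (intro conjI group_bounded_subset[OF totally_disconnected_imp_group_bounded[OF assms]]) auto
  from f[unfolded coarse_embedding_def, THEN conjunct2, THEN conjunct2, rule_format, OF this]
  have "metric_controlled UNIV dist (map_prod f f -` (carrier G \<times> carrier G) \<inter> UNIV \<times> UNIV)" .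
  moreover have "map_prod f f -` (carrier G \<times> carrier G) = UNIV"
    using f by (auto simp: coarse_embedding_def image_subset_iff)
  ultimately obtain K where "\<forall>(x, y)\<in>(UNIV :: (real \<times> real) set). dist x y \<le> K"
    unfolding metric_controlled_def by auto
  moreover obtain t :: nat where "real t > K" using reals_Archimedean2 by blast
  ultimately have "dist (real t) 0 \<le> K" "real t > K" by blast+
  then show False by simp
qed

lemma group_bounded_imp_coarsely_embeds_in_hilbert:
  assumes "Group.group G" "group_bounded G T (carrier G)"
  shows "coarsely_embeds_in_hilbert G T"
proof (rule coarsely_embeds_in_hilbertI)
  interpret group G by fact
  show "coarse_embedding (carrier G) (group_controlled G T) UNIV (metric_controlled UNIV dist) (\<lambda>_. 0 :: real)"
    unfolding coarse_embedding_def
  proof (intro conjI allI impI)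
    show "metric_controlled UNIV dist (map_prod (\<lambda>_. 0 :: real) (\<lambda>_. 0) ` E)" for E
      unfolding metric_controlled_def by (intro conjI exI[of _ 0]) auto
    show "group_controlled G T (map_prod (\<lambda>_. 0 :: real) (\<lambda>_. 0) -` E \<inter> carrier G \<times> carrier G)" for E
      unfolding group_controlled_def by (intro conjI group_bounded_subset[OF assms(2)]) auto
  qed simp
qed

text \<open>The trivial action on the real line works: a filter that leaves every bounded set leaves
  the whole group, so it is \<open>bot\<close>, and properness is vacuous.\<close>

lemma group_bounded_imp_haagerup:
  assumes G: "Group.group G" and T: "topspace T = carrier G" and bdd: "group_bounded G T (carrier G)"
  shows "haagerup G T"
proof (rule haagerupI[where \<phi> = "\<lambda>_ x. x :: real" and \<xi> = 0])
  interpret group G by (rule G)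
  have "(\<lambda>x::real. x) = \<one>\<^bsub>BijGroup UNIV\<^esub>" by (auto simp: BijGroup_def)
  then show "group_action G UNIV (\<lambda>_ x. x :: real)"
    using group_BijGroup[of "UNIV :: real set"]
    by (intro group_action.intro group_hom.intro group_hom_axioms.intro G)
      (auto simp: hom_def group.is_monoid monoid.one_closed monoid.l_one)
  show "continuous_map (prod_topology T euclidean) euclidean (\<lambda>(g, x). x :: real)"
  proof -
    have "(\<lambda>(g, x). x) = (snd :: 'a \<times> real \<Rightarrow> real)" by auto
    then show ?thesis using continuous_map_snd[of T "euclidean :: real topology"] by simp
  qed
  fix F assume F: "\<forall>\<^sub>F g in F. g \<in> carrier G" "\<And>B. group_bounded G T B \<Longrightarrow> \<forall>\<^sub>F g in F. g \<notin> B"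
  have "\<forall>\<^sub>F g in F. False" using F(1) F(2)[OF bdd] by eventually_elim simp
  then have "F = bot" by (simp add: eventually_False)
  then show "filterlim (\<lambda>g. norm (0 :: real)) at_top F" by (simp add: filterlim_def)
qed (use T in auto)

theorem theorem4p6:
  assumes "compact (UNIV :: 'x::t2_space set)"
  shows
    "((qi_universal (carrier (unitary_group0 :: ('x \<Rightarrow>\<^sub>C complex) monoid)) cel_dist
         \<longleftrightarrow> \<not> totally_disconnected (UNIV :: 'x set)) \<and>
      (coarsely_universal (carrier (unitary_group :: ('x \<Rightarrow>\<^sub>C complex) monoid))
           (group_controlled unitary_group (norm_topology unitary_group))
         \<longleftrightarrow> \<not> totally_disconnected (UNIV :: 'x set))) \<and>
     (\<forall>G \<in> {unitary_group0 :: ('x \<Rightarrow>\<^sub>C complex) monoid, unitary_group}.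
        (coarsely_embeds_in_hilbert G (norm_topology G)
           \<longleftrightarrow> totally_disconnected (UNIV :: 'x set)) \<and>
        (haagerup G (norm_topology G)
           \<longleftrightarrow> totally_disconnected (UNIV :: 'x set)))"
proof -
  have U: "(unitary_group :: ('x \<Rightarrow>\<^sub>C complex) monoid) \<in> unitary_groups"
    by (simp add: unitary_groups_def)
  have T: "topspace (norm_topology G) = carrier G" for G :: "('x \<Rightarrow>\<^sub>C complex) monoid"
    by (simp add: norm_topology_def)
  show ?thesis
    unfolding unitary_groups_def[symmetric]
  proof (cases "totally_disconnected (UNIV :: 'x set)")
    case True
    note td = assms True
    show "((qi_universal (carrier (unitary_group0 :: ('x \<Rightarrow>\<^sub>C complex) monoid)) cel_dist
         \<longleftrightarrow> \<not> totally_disconnected (UNIV :: 'x set)) \<and>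
      (coarsely_universal (carrier (unitary_group :: ('x \<Rightarrow>\<^sub>C complex) monoid))
           (group_controlled unitary_group (norm_topology unitary_group))
         \<longleftrightarrow> \<not> totally_disconnected (UNIV :: 'x set))) \<and>
     (\<forall>G \<in> (unitary_groups :: ('x \<Rightarrow>\<^sub>C complex) monoid set).
        (coarsely_embeds_in_hilbert G (norm_topology G)
           \<longleftrightarrow> totally_disconnected (UNIV :: 'x set)) \<and>
        (haagerup G (norm_topology G)
           \<longleftrightarrow> totally_disconnected (UNIV :: 'x set)))"
      using True totally_disconnected_imp_not_qi_universal[OF td]
        totally_disconnected_imp_not_coarsely_universal[OF td U]
        group_bounded_imp_coarsely_embeds_in_hilbert[OF unitary_groupsD(1) totally_disconnected_imp_group_bounded[OF td]]
        group_bounded_imp_haagerup[OF unitary_groupsD(1) T totally_disconnected_imp_group_bounded[OF td]]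
      by simp
  next
    case False
    obtain C :: "'x set" and \<xi>\<^sub>0 \<xi> g where "bump_family C \<xi>\<^sub>0 \<xi> g"
      by (rule not_totally_disconnected_imp_bump_family[OF assms False])
    then interpret bump_family C \<xi>\<^sub>0 \<xi> g .
    have "\<not> haagerup G (norm_topology G)" if "G \<in> unitary_groups" for G :: "('x \<Rightarrow>\<^sub>C complex) monoid"
      using haagerup_imp_coarsely_embeds[OF _ unitary_groupsD(1)[OF that] T]
        not_coarsely_embeds_in_hilbert_unitary_groups[OF that] by blast
    then show "((qi_universal (carrier (unitary_group0 :: ('x \<Rightarrow>\<^sub>C complex) monoid)) cel_dist
         \<longleftrightarrow> \<not> totally_disconnected (UNIV :: 'x set)) \<and>
      (coarsely_universal (carrier (unitary_group :: ('x \<Rightarrow>\<^sub>C complex) monoid))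
           (group_controlled unitary_group (norm_topology unitary_group))
         \<longleftrightarrow> \<not> totally_disconnected (UNIV :: 'x set))) \<and>
     (\<forall>G \<in> (unitary_groups :: ('x \<Rightarrow>\<^sub>C complex) monoid set).
        (coarsely_embeds_in_hilbert G (norm_topology G)
           \<longleftrightarrow> totally_disconnected (UNIV :: 'x set)) \<and>
        (haagerup G (norm_topology G)
           \<longleftrightarrow> totally_disconnected (UNIV :: 'x set)))"
      using False qi_universal_unitary_group0 coarsely_universal_unitary_groups[OF U]
        not_coarsely_embeds_in_hilbert_unitary_groups by simp
  qed
qed

end
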